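(* Let $N,R_r$ be positive integers and $K_c$ a real number with $0<K_c\le R_r\le N$. (Converse) For any RDCDS scheme with parameters $(K_c,R_r,N)$ and any time slot $t\in\mathbb{N}^*$ with $t>t_0$ (steady state), the following bounds hold on the update threshold $R_u^{(t)}$, the normalized download cost $C_r^{(t)}$ (if the read operation is executed at slot $t$) and the normalized upload cost $C_u^{(t)}$ (if the update operation is executed at slot $t$): $$R_u^{(t)}\ \ge\ N-R_r+\lceil K_c\rceil+X^{(t)},$$ $$C_r^{(t)}\ \ge\ \frac{N-|\mathcal{D}^{(t)}|}{N-R_r+\lceil K_c\rceil-|\mathcal{D}^{(t)}|},$$ $$C_u^{(t)}\ \ge\ \frac{N-|\mathcal{D}^{(t)}|}{R_r-X^{(t)}-|\mathcal{D}^{(t)}|}.$$ (Achievability) There exists an RDCDS scheme with parameters $(K_c,R_r,N)$ (for a suitable finite field $\mathbb{F}_q$ and message length $L$) that simultaneously achieves, at any time slot $t\in\mathbb{N}^*$, $$R_u^{(t)}= N-R_r+\lceil K_c\rceil+X^{(t)},$$ $$C_r^{(t)}= \frac{N-|\mathcal{D}^{(t)}|}{N-R_r+\lceil K_c\rceil-|\mathcal{D}^{(t)}|},$$ $$C_u^{(t)}= \frac{N-|\mathcal{D}^{(t)}|}{R_r-X^{(t)}-|\mathcal{D}^{(t)}|}.$$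
   Context: Notation: $[N]=\{1,\dots,N\}$, $\mathbb{N}=\{0,1,2,\dots\}$, $\mathbb{N}^*=\mathbb{N}\setminus\{0\}$. All entropies $H$ and mutual informations $I$ are in $q$-ary units (logarithms to base $q$). RDCDS (robust dynamic coded distributed storage). There are $N$ servers. At each time $t\in\mathbb{N}$ there is a message $\mathbf{W}^{(t)}$ consisting of $L\geq 1$ i.i.d. uniform symbols of the finite field $\mathbb{F}_q$, and Server $n$ holds a random storage $\mathbf{S}_n^{(t)}$. The initial message and storage (at $t=0$) are set up a priori by a global coordinator (possibly using randomness). For all $t\in\mathbb{N}$: - $R_r$-recoverability: for every $\mathcal{R}\subset[N]$ with $|\mathcal{R}|=R_r$, $H(\mathbf{W}^{(t)}\mid(\mathbf{S}_r^{(t)})_{r\in\mathcal{R}})=0$. - $K_c$-storage cost: $H(\mathbf{S}_n^{(t)})\le L/K_c$ for every $n\in[N]$. At each time slot $t\in\mathbb{N}^*$ a user executes either a read or an update operation. A set $\mathcal{D}^{(t)}\subset[N]$ of dropout servers is unavailable during slot $t$; it is known to the user and the available servers $[N]\setminus\mathcal{D}^{(t)}$, and constant during the slot. It may differ arbitrarily from slot to slot. Users are oblivious to prior server states: the procedures used at slot $t$ may depend on $\mathcal{D}^{(t)}$ and $X^{(t)}$ but not on $t$ or on the history of previous operations or dropouts. Read at slot $t$ (must be feasible whenever at least $R_r$ servers are available): the user downloads $\mathbf{A}_n^{(t)}$ from each $n\in[N]\setminus\mathcal{D}^{(t)}$, such that $H(\mathbf{A}_n^{(t)}\mid\mathbf{S}_n^{(t)})=0$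 for each such $n$, and $H(\mathbf{W}^{(t)}\mid(\mathbf{A}_n^{(t)})_{n\in[N]\setminus\mathcal{D}^{(t)}})=0$. The state is unchanged: $\mathbf{S}_n^{(t+1)}=\mathbf{S}_n^{(t)}$ for all $n\in[N]$ and $\mathbf{W}^{(t+1)}=\mathbf{W}^{(t)}$. The normalized download cost is $C_r^{(t)}=\frac1L\sum_{n\in[N]\setminus\mathcal{D}^{(t)}}H(\mathbf{A}_n^{(t)})$. Update at slot $t$, with security level $X^{(t)}$, an integer with $0\le X^{(t)}\le N$: the user has an increment $\boldsymbol{\Delta}^{(t)}$ of $L$ i.i.d. uniform symbols of $\mathbb{F}_q$ and (possibly using private randomness) uploads a coded increment $\mathbf{Q}_n^{(t)}$ to each $n\in[N]\setminus\mathcal{D}^{(t)}$, such that - correctness: $\mathbf{W}^{(t+1)}=\mathbf{W}^{(t)}+\boldsymbol{\Delta}^{(t)}$; - $X^{(t)}$-security: $I(\boldsymbol{\Delta}^{(t)};(\mathbf{Q}_n^{(t)})_{n\in\mathcal{X}})=0$ for every $\mathcal{X}\subset[N]\setminus\mathcal{D}^{(t)}$ with $|\mathcal{X}|\le X^{(t)}$; - storage transition: $H(\mathbf{S}_n^{(t+1)}\mid\mathbf{S}_n^{(t)},\mathbf{Q}_n^{(t)})=0$ for $n\in[N]\setminus\mathcal{D}^{(t)}$, and $\mathbf{S}_n^{(t+1)}=\mathbf{S}_n^{(t)}$ for $n\in\mathcal{D}^{(t)}$; - independence: $I(\boldsymbol{\Delta}^{(t)},(\mathbf{Q}_n^{(t)})_{n\in[N]\setminus\mathcal{D}^{(t)}};(\mathbf{S}_n^{(t)})_{n\in[N]})=0$.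 The update threshold $R_u^{(t)}$ of a scheme is the minimum number of available servers required by the scheme for the update operation (with security level $X^{(t)}$) to be feasible at slot $t$. The normalized upload cost is $C_u^{(t)}=\frac1L\sum_{n\in[N]\setminus\mathcal{D}^{(t)}}H(\mathbf{Q}_n^{(t)})$. Steady-state assumption (defining $t_0$): the servers experience all possible states for read and update operations within finitely many slots, i.e. there is a positive integer $t_0$ such that during slots up to $t_0$ the users execute read and update operations with all possible constraints and the servers experience all possible dropout sets during these operations. Precisely, for every $\mathcal{T}\subset[N]$ with $|\mathcal{T}|=R_r-\lceil K_c\rceil$ there is a slot $t\le t_0$ at which an update operation is executed with $\mathcal{D}^{(t)}\subset\mathcal{T}$ and $X^{(t)}=|\mathcal{T}|-|\mathcal{D}^{(t)}|$. *)

theory Defs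
  imports "HOL-Probability.Probability" "HOL-Algebra.Ring"
begin

subsection \<open>Entropies of finite-valued random variables on a pmf\<close>

text \<open>
  The entropies of \<^theory>\<open>HOL-Probability.Information\<close> are meaningful for simple functions, so the
  sample space is cut down to the support: if the support is finite, then every function is simple.
\<close>

definition outcome_space :: "'w pmf \<Rightarrow> 'w measure" where
  "outcome_space p = restrict_space (measure_pmf p) (set_pmf p)"

lemma space_outcome_space [simp]: "space (outcome_space p) = set_pmf p"
  by (simp add: outcome_space_def space_restrict_space)

lemma sets_outcome_space [simp]: "sets (outcome_space p) = Pow (set_pmf p)"
  by (auto simp: outcome_space_def sets_restrict_space)

lemma information_space_outcome_space:
  assumes "1 < b"
  shows "information_space (outcome_space p) b"
proof -
  have "prob_space (outcome_space p)"
    unfolding outcome_space_def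
    by (rule prob_space_restrict_space)
       (auto simp: measure_pmf.emeasure_eq_measure measure_measure_pmf_finite
             intro: measure_pmf.prob_eq_1[THEN iffD2] simp: AE_measure_pmf)
  then show ?thesis
    using assms by (simp add: information_space_def information_space_axioms_def)
qed

lemma simple_function_outcome_space:
  "finite (set_pmf p) \<Longrightarrow> simple_function (outcome_space p) X"
  by (simp add: simple_function_def)

text \<open>The following are \<open>\<H>(X)\<close>, \<open>\<H>(X | Y)\<close> and \<open>\<I>(X ; Y)\<close> of the library, with logarithms to base \<open>b\<close>.\<close>

definition ent :: "real \<Rightarrow> 'w pmf \<Rightarrow> ('w \<Rightarrow> 'x) \<Rightarrow> real" where
  "ent b p X = prob_space.entropy (outcome_space p) b (count_space (X ` set_pmf p)) X"

definition cond_ent :: "real \<Rightarrow> 'w pmf \<Rightarrow> ('w \<Rightarrow> 'x) \<Rightarrow> ('w \<Rightarrow> 'y) \<Rightarrow> real" where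
  "cond_ent b p X Y = prob_space.conditional_entropy (outcome_space p) b
     (count_space (X ` set_pmf p)) (count_space (Y ` set_pmf p)) X Y"

definition mut_inf :: "real \<Rightarrow> 'w pmf \<Rightarrow> ('w \<Rightarrow> 'x) \<Rightarrow> ('w \<Rightarrow> 'y) \<Rightarrow> real" where
  "mut_inf b p X Y = prob_space.mutual_information (outcome_space p) b
     (count_space (X ` set_pmf p)) (count_space (Y ` set_pmf p)) X Y"


subsection \<open>Schemes\<close>

text \<open>
  Servers are \<open>1, \<dots>, N\<close>. An operation carries its dropout set and, for updates, its security level.
\<close>

datatype oper = Read "nat set" | Update "nat set" nat

text \<open>
  A scheme fixes a field, a message length, the joint law of the initial message and storage, the
  operations it supports, and the procedures. The latter see only the constraints of the current
  slot (never the slot number or the history):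
  \<^item> \<open>answer P D n s\<close>: law of the answer of server \<open>n\<close> with storage \<open>s\<close>;
  \<^item> \<open>upload P D X d\<close>: joint law of all coded increments for the increment \<open>d\<close>;
  \<^item> \<open>store P D X n s q\<close>: law of the new storage of server \<open>n\<close> with storage \<open>s\<close> that receives \<open>q\<close>.
\<close>

record ('f, 's, 'q, 'a) scheme =
  base   :: "'f ring"
  len    :: nat
  init   :: "('f list \<times> (nat \<Rightarrow> 's)) pmf"
  admits :: "oper \<Rightarrow> bool"
  answer :: "nat set \<Rightarrow> nat \<Rightarrow> 's \<Rightarrow> 'a pmf"
  upload :: "nat set \<Rightarrow> nat \<Rightarrow> 'f list \<Rightarrow> (nat \<Rightarrow> 'q) pmf"
  store  :: "nat set \<Rightarrow> nat \<Rightarrow> nat \<Rightarrow> 's \<Rightarrow> 'q \<Rightarrow> 's pmf"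

definition qary :: "('f, 's, 'q, 'a) scheme \<Rightarrow> real" where
  "qary P = real (card (carrier (base P)))"

definition messages :: "('f, 's, 'q, 'a) scheme \<Rightarrow> 'f list set" where
  "messages P = {w. length w = len P \<and> set w \<subseteq> carrier (base P)}"

text \<open>\<open>L\<close> i.i.d. uniform symbols are a uniform vector of length \<open>L\<close>.\<close>

definition uniform_message :: "('f, 's, 'q, 'a) scheme \<Rightarrow> 'f list pmf" where
  "uniform_message P = pmf_of_set (messages P)"

definition msg_add :: "('f, 's, 'q, 'a) scheme \<Rightarrow> 'f list \<Rightarrow> 'f list \<Rightarrow> 'f list" where
  "msg_add P v w = map2 (\<lambda>x y. x \<oplus>\<^bsub>base P\<^esub> y) v w"


subsection \<open>The random variables of one time slot\<close>

record ('f, 's, 'a) read_outcome =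
  r_msg :: "'f list"
  r_sto :: "nat \<Rightarrow> 's"
  r_ans :: "nat \<Rightarrow> 'a"

record ('f, 's, 'q) update_outcome =
  u_msg  :: "'f list"
  u_sto  :: "nat \<Rightarrow> 's"
  u_inc  :: "'f list"
  u_upl  :: "nat \<Rightarrow> 'q"
  u_msg' :: "'f list"
  u_sto' :: "nat \<Rightarrow> 's"

definition read_law ::
  "nat \<Rightarrow> ('f, 's, 'q, 'a) scheme \<Rightarrow> ('f list \<times> (nat \<Rightarrow> 's)) pmf \<Rightarrow> nat set
     \<Rightarrow> ('f, 's, 'a) read_outcome pmf" where
  "read_law N P \<sigma> D =
     bind_pmf \<sigma> (\<lambda>(w, s).
     bind_pmf (Pi_pmf ({1..N} - D) undefined (\<lambda>n. answer P D n (s n))) (\<lambda>a.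
     return_pmf \<lparr>r_msg = w, r_sto = s, r_ans = a\<rparr>))"

text \<open>
  The increment and the private randomness of the user are drawn afresh. The new message is the sum
  of the old one and the increment, and dropout servers keep their storage.
\<close>

definition update_law ::
  "nat \<Rightarrow> ('f, 's, 'q, 'a) scheme \<Rightarrow> ('f list \<times> (nat \<Rightarrow> 's)) pmf \<Rightarrow> nat set \<Rightarrow> nat
     \<Rightarrow> ('f, 's, 'q) update_outcome pmf" where
  "update_law N P \<sigma> D X =
     bind_pmf \<sigma> (\<lambda>(w, s).
     bind_pmf (uniform_message P) (\<lambda>d.
     bind_pmf (upload P D X d) (\<lambda>q.
     bind_pmf (Pi_pmf ({1..N} - D) undefined (\<lambda>n. store P D X n (s n) (q n))) (\<lambda>s'.
     return_pmf \<lparr>u_msg = w, u_sto = s, u_inc = d, u_upl = q, u_msg' = msg_add P w d,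
       u_sto' = (\<lambda>n. if n \<in> {1..N} - D then s' n else s n)\<rparr>))))"

text \<open>
  Joint law of message and storage at time \<open>t\<close> when operation \<open>ops t\<close> is executed in each slot
  \<open>t \<ge> 1\<close>. The operation of slot \<open>t\<close> leads from time \<open>t\<close> to time \<open>t + 1\<close>; there is no operation
  at slot \<open>0\<close>, so nothing changes between times \<open>0\<close> and \<open>1\<close>.
\<close>

primrec state_law ::
  "nat \<Rightarrow> ('f, 's, 'q, 'a) scheme \<Rightarrow> (nat \<Rightarrow> oper) \<Rightarrow> nat \<Rightarrow> ('f list \<times> (nat \<Rightarrow> 's)) pmf" where
  "state_law N P ops 0 = init P"
| "state_law N P ops (Suc t) =
     (if t = 0 then init P
      else (case ops t of
              Read D \<Rightarrow> state_law N P ops t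
            | Update D X \<Rightarrow>
                map_pmf (\<lambda>\<omega>. (u_msg' \<omega>, u_sto' \<omega>)) (update_law N P (state_law N P ops t) D X)))"


subsection \<open>The requirements\<close>

text \<open>
  All random variables are finite-valued. The dynamics (correctness of the new message, unchanged
  storage of dropout servers, unchanged state after a read) are part of \<^const>\<open>update_law\<close> and
  \<^const>\<open>state_law\<close>; the remaining conditions are imposed here.
\<close>

definition state_ok ::
  "nat \<Rightarrow> nat \<Rightarrow> real \<Rightarrow> ('f, 's, 'q, 'a) scheme \<Rightarrow> ('f list \<times> (nat \<Rightarrow> 's)) pmf \<Rightarrow> bool" where
  "state_ok N Rr Kc P \<sigma> \<longleftrightarrow>
     finite (set_pmf \<sigma>) \<and>
     map_pmf fst \<sigma> = uniform_message P \<and>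
     (\<forall>R\<subseteq>{1..N}. card R = Rr \<longrightarrow>
        cond_ent (qary P) \<sigma> (\<lambda>(w, s). w) (\<lambda>(w, s). restrict s R) = 0) \<and>
     (\<forall>n\<in>{1..N}. ent (qary P) \<sigma> (\<lambda>(w, s). s n) \<le> real (len P) / Kc)"

definition read_ok ::
  "nat \<Rightarrow> ('f, 's, 'q, 'a) scheme \<Rightarrow> nat set \<Rightarrow> ('f, 's, 'a) read_outcome pmf \<Rightarrow> bool" where
  "read_ok N P D p \<longleftrightarrow>
     finite (set_pmf p) \<and>
     (\<forall>n\<in>{1..N} - D. cond_ent (qary P) p (\<lambda>\<omega>. r_ans \<omega> n) (\<lambda>\<omega>. r_sto \<omega> n) = 0) \<and>
     cond_ent (qary P) p r_msg (\<lambda>\<omega>. restrict (r_ans \<omega>) ({1..N} - D)) = 0"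

definition update_ok ::
  "nat \<Rightarrow> ('f, 's, 'q, 'a) scheme \<Rightarrow> nat set \<Rightarrow> nat \<Rightarrow> ('f, 's, 'q) update_outcome pmf \<Rightarrow> bool" where
  "update_ok N P D X p \<longleftrightarrow>
     finite (set_pmf p) \<and>
     (\<forall>Y\<subseteq>{1..N} - D. card Y \<le> X \<longrightarrow>
        mut_inf (qary P) p u_inc (\<lambda>\<omega>. restrict (u_upl \<omega>) Y) = 0) \<and>
     (\<forall>n\<in>{1..N} - D.
        cond_ent (qary P) p (\<lambda>\<omega>. u_sto' \<omega> n) (\<lambda>\<omega>. (u_sto \<omega> n, u_upl \<omega> n)) = 0) \<and>
     mut_inf (qary P) p (\<lambda>\<omega>. (u_inc \<omega>, restrict (u_upl \<omega>) ({1..N} - D)))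
       (\<lambda>\<omega>. restrict (u_sto \<omega>) {1..N}) = 0"

definition slot_ok ::
  "nat \<Rightarrow> ('f, 's, 'q, 'a) scheme \<Rightarrow> ('f list \<times> (nat \<Rightarrow> 's)) pmf \<Rightarrow> oper \<Rightarrow> bool" where
  "slot_ok N P \<sigma> oper =
     (case oper of
        Read D \<Rightarrow> read_ok N P D (read_law N P \<sigma> D)
      | Update D X \<Rightarrow> update_ok N P D X (update_law N P \<sigma> D X))"

fun well_formed_oper :: "nat \<Rightarrow> oper \<Rightarrow> bool" where
  "well_formed_oper N (Read D) \<longleftrightarrow> D \<subseteq> {1..N}"
| "well_formed_oper N (Update D X) \<longleftrightarrow> D \<subseteq> {1..N} \<and> X \<le> N"

definition admissible :: "nat \<Rightarrow> ('f, 's, 'q, 'a) scheme \<Rightarrow> (nat \<Rightarrow> oper) \<Rightarrow> bool" where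
  "admissible N P ops \<longleftrightarrow> (\<forall>t\<ge>1. well_formed_oper N (ops t) \<and> admits P (ops t))"

definition rdcds :: "nat \<Rightarrow> nat \<Rightarrow> real \<Rightarrow> ('f, 's, 'q, 'a) scheme \<Rightarrow> bool" where
  "rdcds N Rr Kc P \<longleftrightarrow>
     field (base P) \<and> finite (carrier (base P)) \<and> len P \<ge> 1 \<and>
     (\<forall>D\<subseteq>{1..N}. Rr \<le> N - card D \<longrightarrow> admits P (Read D)) \<and>
     (\<forall>ops. admissible N P ops \<longrightarrow>
        (\<forall>t. state_ok N Rr Kc P (state_law N P ops t)) \<and>
        (\<forall>t\<ge>1. slot_ok N P (state_law N P ops t) (ops t)))"


subsection \<open>Performance\<close>

text \<open>
  Smallest number of available servers with which an update of security level \<open>X\<close> is supported for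
  some dropout set; unspecified if there is none.
\<close>

definition update_threshold :: "nat \<Rightarrow> ('f, 's, 'q, 'a) scheme \<Rightarrow> nat \<Rightarrow> nat" where
  "update_threshold N P X =
     (LEAST m. \<exists>D\<subseteq>{1..N}. admits P (Update D X) \<and> m = N - card D)"

definition download_cost ::
  "nat \<Rightarrow> ('f, 's, 'q, 'a) scheme \<Rightarrow> (nat \<Rightarrow> oper) \<Rightarrow> nat \<Rightarrow> nat set \<Rightarrow> real" where
  "download_cost N P ops t D =
     (\<Sum>n\<in>{1..N} - D. ent (qary P) (read_law N P (state_law N P ops t) D) (\<lambda>\<omega>. r_ans \<omega> n))
       / real (len P)"

definition upload_cost ::
  "nat \<Rightarrow> ('f, 's, 'q, 'a) scheme \<Rightarrow> (nat \<Rightarrow> oper) \<Rightarrow> nat \<Rightarrow> nat set \<Rightarrow> nat \<Rightarrow> real" where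
  "upload_cost N P ops t D X =
     (\<Sum>n\<in>{1..N} - D. ent (qary P) (update_law N P (state_law N P ops t) D X) (\<lambda>\<omega>. u_upl \<omega> n))
       / real (len P)"

definition steady_state :: "nat \<Rightarrow> nat \<Rightarrow> real \<Rightarrow> (nat \<Rightarrow> oper) \<Rightarrow> nat \<Rightarrow> bool" where
  "steady_state N Rr Kc ops t0 \<longleftrightarrow>
     t0 \<ge> 1 \<and>
     (\<forall>T\<subseteq>{1..N}. int (card T) = int Rr - \<lceil>Kc\<rceil> \<longrightarrow>
        (\<exists>t\<in>{1..t0}. \<exists>D\<subseteq>T. ops t = Update D (card T - card D)))"

end

theory Submission
  imports Defs "HOL-Number_Theory.Residues"
begin

text \<open>
  Converse. An increment is uniform and independent of the storage, so it acts as a one-time pad: an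
  \<open>X\<close>-secure update with dropout set \<open>D\<close> makes the message independent of the storage of any set
  \<open>T\<close> of servers with at most \<open>X\<close> servers outside \<open>D\<close>, and later updates cannot undo this.
  Whatever is decoded is then decoded from the servers outside \<open>T\<close> alone; averaging over \<open>T\<close> gives
  the two cost bounds, and the storage bound rules out \<open>|T| > Rr - K\<close>, where \<open>K = \<lceil>Kc\<rceil>\<close>.

  Achievability. The storage consists of rows of Reed--Solomon codewords: a row \<open>\<rho>\<close> is a polynomial
  of degree less than \<open>Rr\<close> over a prime field, server \<open>n\<close> stores its value at \<open>n\<close>, and its values at
  \<open>K\<close> secret points form a part of the message. With \<open>d\<close> available servers, any combination of
  degree less than \<open>d\<close> of the row polynomials can be read; multiplying the rows by polynomials that
  vanish at the right secret points packs \<open>e = d - Rr + K\<close> secret points into one such combination.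
  Dually, for updates a polynomial of degree less than \<open>e + X\<close>, \<open>e = Rr - X - |D|\<close>, prescribed
  at \<open>e\<close> secret points and random otherwise, is multiplied by \<open>\<Prod>m\<in>D. (\<cdot> - m)\<close> and added to
  all rows that share these points. The rows are arranged such that both groupings are possible
  for all values of \<open>e\<close>. The uniform law on the linear space of valid states is invariant under
  all updates, so the scheme is in a steady state from the beginning.
\<close>

section \<open>Entropy and independence\<close>

text \<open>The entropy conditions are first translated: a vanishing conditional entropy is a
  functional dependence on the support, a vanishing mutual information a product law. From then on
  secrecy is tracked by manipulating laws, and entropies return only in chain-rule estimates.

  Nothing is known about what the initial storage reveals to a set of servers, so hiding has to be
  produced by an update; the steady state supplies a suitable one for every \<open>T\<close> with
  \<open>Rr - K\<close> servers.

  The obstacle for the code is that procedures do not see the history: one storage format must serve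
  every \<open>e\<close> between \<open>K\<close> and \<open>N\<close>. The message length is
  therefore a multiple of all these \<open>e\<close>, and the groupings for different
  \<open>e\<close> have to coexist on the same rows. Indexing the rows by sequences of
  \<open>N - K\<close> deletions from \<open>N\<close> points gives \<open>N! / K!\<close> rows and
  message length \<open>N! / (K - 1)!\<close>.\<close>

lemma measure_outcome_space:
  "measure (outcome_space p) (X -` {x} \<inter> set_pmf p) = pmf (map_pmf X p) x"
proof -
  have "measure (outcome_space p) (X -` {x} \<inter> set_pmf p) = measure p (X -` {x} \<inter> set_pmf p)"
    unfolding outcome_space_def by (rule measure_restrict_space) auto
  then show ?thesis
    by (simp add: pmf_map measure_Int_set_pmf)
qed

lemma simple_distributed_outcome_space:
  assumes "finite (set_pmf p)" "1 < (b::real)"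
  shows "simple_distributed (outcome_space p) X (pmf (map_pmf X p))"
proof -
  interpret information_space "outcome_space p" b
    by (rule information_space_outcome_space) fact
  show ?thesis
    by (rule simple_distributedI)
       (auto simp: simple_function_outcome_space assms measure_outcome_space)
qed

lemma ent_eq_sum:
  assumes "finite (set_pmf p)" "1 < b"
  shows "ent b p X = - (\<Sum>x\<in>X ` set_pmf p. pmf (map_pmf X p) x * log b (pmf (map_pmf X p) x))"
proof -
  interpret information_space "outcome_space p" b
    by (rule information_space_outcome_space) fact
  show ?thesis
    using entropy_simple_distributed[OF simple_distributed_outcome_space[OF assms, of X]]
    by (simp add: ent_def)
qed

lemma ent_Pair:
  assumes "finite (set_pmf p)" "1 < b"
  shows "ent b p (\<lambda>\<omega>. (X \<omega>, Y \<omega>)) = ent b p X + cond_ent b p Y X"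
proof -
  interpret information_space "outcome_space p" b
    by (rule information_space_outcome_space) fact
  show ?thesis
    using entropy_chain_rule[of X Y] assms
    by (simp add: ent_def cond_ent_def simple_function_outcome_space)
qed

lemma mut_inf_eq:
  assumes "finite (set_pmf p)" "1 < b"
  shows "mut_inf b p X Y = ent b p X - cond_ent b p X Y"
proof -
  interpret information_space "outcome_space p" b
    by (rule information_space_outcome_space) fact
  show ?thesis
    using mutual_information_eq_entropy_conditional_entropy[of X Y] assms
    by (simp add: ent_def cond_ent_def mut_inf_def simple_function_outcome_space)
qed

lemma cond_ent_le_ent:
  assumes "finite (set_pmf p)" "1 < b"
  shows "cond_ent b p X Y \<le> ent b p X"
proof -
  interpret information_space "outcome_space p" b
    by (rule information_space_outcome_space) fact
  show ?thesis
    using conditional_entropy_less_eq_entropy[of X Y] assms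
    by (simp add: cond_ent_def ent_def simple_function_outcome_space)
qed

lemma ent_comp_le:
  assumes "finite (set_pmf p)" "1 < b"
  shows "ent b p (f \<circ> X) \<le> ent b p X"
proof -
  interpret information_space "outcome_space p" b
    by (rule information_space_outcome_space) fact
  show ?thesis
    using entropy_data_processing[of X f] assms
    by (simp add: ent_def simple_function_outcome_space)
qed

lemma ent_le_log_card:
  assumes "finite (set_pmf p)" "1 < b"
  shows "ent b p X \<le> log b (card (X ` set_pmf p))"
proof -
  interpret information_space "outcome_space p" b
    by (rule information_space_outcome_space) fact
  show ?thesis
    using entropy_le_card[OF simple_distributed_outcome_space[OF assms, of X]]
    by (simp add: ent_def)
qed

lemma ent_le_of_subset:
  assumes "finite (set_pmf p)" "1 < b" "X ` set_pmf p \<subseteq> A" "finite A"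
  shows "ent b p X \<le> log b (card A)"
proof -
  have "card (X ` set_pmf p) \<le> card A" "0 < card (X ` set_pmf p)"
    using assms by (auto intro: card_mono simp: card_gt_0_iff set_pmf_not_empty)
  then have "log b (card (X ` set_pmf p)) \<le> log b (card A)"
    using \<open>1 < b\<close> by simp
  then show ?thesis
    using ent_le_log_card[OF assms(1,2), of X] by linarith
qed

lemma ent_map_pmf:
  assumes "finite (set_pmf p)" "1 < b"
  shows "ent b (map_pmf f p) X = ent b p (X \<circ> f)"
proof -
  have "finite (set_pmf (map_pmf f p))"
    using assms by simp
  then show ?thesis
    unfolding ent_eq_sum[OF assms] ent_eq_sum[OF \<open>finite (set_pmf (map_pmf f p))\<close> assms(2)]
    by (simp only: set_map_pmf image_comp pmf.map_comp)
qed

lemma ent_uniform: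
  assumes "finite (set_pmf p)" "1 < b" "map_pmf X p = pmf_of_set A" "finite A" "A \<noteq> {}"
  shows "ent b p X = log b (card A)"
proof -
  have "set_pmf (map_pmf X p) = A"
    unfolding assms(3) using assms(4,5) by simp
  then have "X ` set_pmf p = A"
    by simp
  then show ?thesis
    using assms by (simp add: ent_eq_sum log_divide card_gt_0_iff)
qed

text \<open>Data processing for a dependence that is known only on the support. In this form
  decodability can be used without naming a decoder.\<close>

lemma ent_function_le:
  assumes "finite (set_pmf p)" "1 < b"
    and "\<And>\<omega> \<omega>'. \<omega> \<in> set_pmf p \<Longrightarrow> \<omega>' \<in> set_pmf p \<Longrightarrow> Y \<omega> = Y \<omega>' \<Longrightarrow> X \<omega> = X \<omega>'"
  shows "ent b p X \<le> ent b p Y"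
proof -
  define f where "f y = X (SOME \<omega>. \<omega> \<in> set_pmf p \<and> Y \<omega> = y)" for y
  have f: "f (Y \<omega>) = X \<omega>" if "\<omega> \<in> set_pmf p" for \<omega>
    using someI[of "\<lambda>\<omega>'. \<omega>' \<in> set_pmf p \<and> Y \<omega>' = Y \<omega>" \<omega>] that assms(3) unfolding f_def by blast
  then have "map_pmf X p = map_pmf (f \<circ> Y) p" "X ` set_pmf p = (f \<circ> Y) ` set_pmf p"
    by (auto intro!: map_pmf_cong image_cong)
  then have "ent b p X = ent b p (f \<circ> Y)"
    unfolding ent_eq_sum[OF assms(1,2)] by metis
  then show ?thesis
    using ent_comp_le[OF assms(1,2), of f Y] by simp
qed

section \<open>Vanishing conditional entropy and vanishing mutual information\<close>

lemma pmf_map_Pair_le: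
  "pmf (map_pmf (\<lambda>\<omega>. (X \<omega>, Y \<omega>)) p) (x, y) \<le> pmf (map_pmf Y p) y"
  by (auto simp: pmf_map intro!: measure_pmf.finite_measure_mono)

lemma cond_ent_eq_sum:
  assumes "finite (set_pmf p)" "1 < b"
  shows "cond_ent b p X Y = (\<Sum>(x, y)\<in>(\<lambda>\<omega>. (X \<omega>, Y \<omega>)) ` set_pmf p.
     pmf (map_pmf (\<lambda>\<omega>. (X \<omega>, Y \<omega>)) p) (x, y) *
     log b (pmf (map_pmf Y p) y / pmf (map_pmf (\<lambda>\<omega>. (X \<omega>, Y \<omega>)) p) (x, y)))"
proof -
  interpret information_space "outcome_space p" b
    by (rule information_space_outcome_space) fact
  have pos: "pmf (map_pmf (\<lambda>\<omega>. (X \<omega>, Y \<omega>)) p) (X \<omega>, Y \<omega>) > 0" "pmf (map_pmf Y p) (Y \<omega>) > 0"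
    if "\<omega> \<in> set_pmf p" for \<omega>
    using that by (auto simp: pmf_positive_iff)
  have "log b (pmf (map_pmf (\<lambda>\<omega>. (X \<omega>, Y \<omega>)) p) (X \<omega>, Y \<omega>) / pmf (map_pmf Y p) (Y \<omega>)) =
    - log b (pmf (map_pmf Y p) (Y \<omega>) / pmf (map_pmf (\<lambda>\<omega>. (X \<omega>, Y \<omega>)) p) (X \<omega>, Y \<omega>))"
    if "\<omega> \<in> set_pmf p" for \<omega>
    using pos[OF that] by (simp add: log_divide_pos)
  then show ?thesis
    using conditional_entropy_eq[OF simple_distributed_outcome_space[OF assms, of Y]
        simple_distributed_outcome_space[OF assms, of "\<lambda>\<omega>. (X \<omega>, Y \<omega>)"]]
    unfolding cond_ent_def space_outcome_space sum_negf[symmetric]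
    by (auto intro!: sum.cong)
qed

text \<open>A joint probability is at most its marginal, so every summand of the conditional entropy
  is nonnegative. A summand vanishes only if the two probabilities agree, that is, if the fibre of
  \<open>Y\<close> carries no mass outside the fibre of \<open>X\<close>.\<close>

lemma cond_ent_eq_0_iff:
  assumes fin: "finite (set_pmf p)" and b: "1 < b"
  shows "cond_ent b p X Y = 0 \<longleftrightarrow>
    (\<forall>\<omega>\<in>set_pmf p. \<forall>\<omega>'\<in>set_pmf p. Y \<omega> = Y \<omega>' \<longrightarrow> X \<omega> = X \<omega>')"
proof -
  let ?q = "map_pmf (\<lambda>\<omega>. (X \<omega>, Y \<omega>)) p"
  let ?t = "\<lambda>(x, y). pmf ?q (x, y) * log b (pmf (map_pmf Y p) y / pmf ?q (x, y))"
  have pos: "pmf ?q (X \<omega>, Y \<omega>) > 0" "pmf (map_pmf Y p) (Y \<omega>) > 0" if "\<omega> \<in> set_pmf p" for \<omega>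
    using that by (auto simp: pmf_positive_iff)
  have t: "?t (X \<omega>, Y \<omega>) \<ge> 0"
    "?t (X \<omega>, Y \<omega>) = 0 \<longleftrightarrow> pmf (map_pmf Y p) (Y \<omega>) = pmf ?q (X \<omega>, Y \<omega>)"
    if "\<omega> \<in> set_pmf p" for \<omega>
  proof -
    have "pmf (map_pmf Y p) (Y \<omega>) / pmf ?q (X \<omega>, Y \<omega>) \<ge> 1"
      using pos[OF that] pmf_map_Pair_le[of X Y p "X \<omega>" "Y \<omega>"] by simp
    then show "?t (X \<omega>, Y \<omega>) \<ge> 0"
      using b by simp
    show "?t (X \<omega>, Y \<omega>) = 0 \<longleftrightarrow> pmf (map_pmf Y p) (Y \<omega>) = pmf ?q (X \<omega>, Y \<omega>)"
      using pos[OF that] b by (auto simp: log_def)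
  qed
  have "cond_ent b p X Y = 0 \<longleftrightarrow> (\<forall>z\<in>(\<lambda>\<omega>. (X \<omega>, Y \<omega>)) ` set_pmf p. ?t z = 0)"
    unfolding cond_ent_eq_sum[OF assms]
    using fin t(1) by (intro sum_nonneg_eq_0_iff) auto
  also have "\<dots> \<longleftrightarrow> (\<forall>\<omega>\<in>set_pmf p. pmf (map_pmf Y p) (Y \<omega>) = pmf ?q (X \<omega>, Y \<omega>))"
    using t(2) by simp
  also have "\<dots> \<longleftrightarrow> (\<forall>\<omega>\<in>set_pmf p. \<forall>\<omega>'\<in>set_pmf p. Y \<omega> = Y \<omega>' \<longrightarrow> X \<omega> = X \<omega>')"
  proof (intro ball_cong refl)
    fix \<omega> assume \<omega>: "\<omega> \<in> set_pmf p"
    let ?A = "(\<lambda>\<omega>. (X \<omega>, Y \<omega>)) -` {(X \<omega>, Y \<omega>)}" and ?B = "Y -` {Y \<omega>}"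
    have "pmf (map_pmf Y p) (Y \<omega>) = pmf ?q (X \<omega>, Y \<omega>) \<longleftrightarrow> measure p (?B - ?A) = 0"
      by (subst measure_pmf.finite_measure_Diff) (auto simp: pmf_map)
    also have "\<dots> \<longleftrightarrow> set_pmf p \<inter> (?B - ?A) = {}"
      by (simp add: measure_pmf_zero_iff)
    also have "\<dots> \<longleftrightarrow> (\<forall>\<omega>'\<in>set_pmf p. Y \<omega> = Y \<omega>' \<longrightarrow> X \<omega> = X \<omega>')"
      by auto
    finally show "pmf (map_pmf Y p) (Y \<omega>) = pmf ?q (X \<omega>, Y \<omega>) \<longleftrightarrow>
       (\<forall>\<omega>'\<in>set_pmf p. Y \<omega> = Y \<omega>' \<longrightarrow> X \<omega> = X \<omega>')" .
  qed
  finally show ?thesis .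
qed

lemma ent_Pair_pair_pmf:
  assumes fin: "finite (set_pmf p)" and b: "1 < b"
    and indep: "map_pmf (\<lambda>\<omega>. (X \<omega>, Y \<omega>)) p = pair_pmf (map_pmf X p) (map_pmf Y p)"
  shows "ent b p (\<lambda>\<omega>. (X \<omega>, Y \<omega>)) = ent b p X + ent b p Y"
proof -
  let ?PX = "pmf (map_pmf X p)" and ?PY = "pmf (map_pmf Y p)"
  let ?SX = "X ` set_pmf p" and ?SY = "Y ` set_pmf p"
  have sum1: "sum ?PX ?SX = 1" "sum ?PY ?SY = 1"
    using fin by (auto intro!: sum_pmf_eq_1)
  have "(\<lambda>\<omega>. (X \<omega>, Y \<omega>)) ` set_pmf p = ?SX \<times> ?SY"
    using arg_cong[OF indep, of set_pmf] by simp
  then have "ent b p (\<lambda>\<omega>. (X \<omega>, Y \<omega>)) =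
      - (\<Sum>(x, y)\<in>?SX \<times> ?SY. ?PX x * ?PY y * log b (?PX x * ?PY y))"
    unfolding ent_eq_sum[OF fin b] indep by (auto simp: pmf_pair intro!: sum.cong)
  also have "\<dots> = - (\<Sum>(x, y)\<in>?SX \<times> ?SY. ?PX x * log b (?PX x) * ?PY y + ?PX x * (?PY y * log b (?PY y)))"
    by (intro arg_cong[of _ _ uminus] sum.cong)
       (auto simp: log_mult_pos pmf_positive_iff algebra_simps)
  also have "\<dots> = - ((\<Sum>x\<in>?SX. ?PX x * log b (?PX x)) * sum ?PY ?SY +
      sum ?PX ?SX * (\<Sum>y\<in>?SY. ?PY y * log b (?PY y)))"
    by (simp add: sum.cartesian_product[symmetric] sum.distrib sum_product)
  also have "\<dots> = ent b p X + ent b p Y"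
    using fin b by (simp add: sum1 ent_eq_sum)
  finally show ?thesis .
qed

lemma ent_swap:
  assumes "finite (set_pmf p)" "1 < b"
  shows "ent b p (\<lambda>\<omega>. (X \<omega>, Y \<omega>)) = ent b p (\<lambda>\<omega>. (Y \<omega>, X \<omega>))"
  by (rule antisym; rule ent_function_le[OF assms]; simp)

lemma ent_Pair_le:
  assumes "finite (set_pmf p)" "1 < b"
  shows "ent b p (\<lambda>\<omega>. (X \<omega>, Y \<omega>)) \<le> ent b p X + ent b p Y"
  using ent_Pair[OF assms, of X Y] cond_ent_le_ent[OF assms, of Y X] by linarith

lemma mut_inf_eq_0_iff_ent:
  assumes "finite (set_pmf p)" "1 < b"
  shows "mut_inf b p X Y = 0 \<longleftrightarrow> ent b p (\<lambda>\<omega>. (X \<omega>, Y \<omega>)) = ent b p X + ent b p Y"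
  using ent_Pair[OF assms, of Y X] mut_inf_eq[OF assms, of X Y] ent_swap[OF assms, of X Y] by argo

lemma sum_map_pmf:
  fixes g :: "'b \<Rightarrow> real"
  assumes "finite (set_pmf q)"
  shows "(\<Sum>z\<in>set_pmf q. pmf q z * g (f z)) = (\<Sum>x\<in>f ` set_pmf q. pmf (map_pmf f q) x * g x)"
proof -
  have "(\<Sum>x\<in>f ` set_pmf q. g x * pmf (map_pmf f q) x) = measure_pmf.expectation (map_pmf f q) g"
    using assms by (intro integral_measure_pmf_real[symmetric]) auto
  also have "\<dots> = measure_pmf.expectation q (\<lambda>z. g (f z))"
    by simp
  also have "\<dots> = (\<Sum>z\<in>set_pmf q. g (f z) * pmf q z)"
    using assms by (intro integral_measure_pmf_real) auto
  finally show ?thesis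
    by (simp add: mult.commute)
qed

text \<open>By \<open>ln t \<le> t - 1\<close> with equality only at \<open>t = 1\<close>.\<close>

lemma pmf_eq_of_relative_entropy_eq_0:
  assumes fin: "finite (set_pmf q)" and ac: "set_pmf q \<subseteq> set_pmf r"
    and eq: "(\<Sum>z\<in>set_pmf q. pmf q z * ln (pmf r z / pmf q z)) = 0"
  shows "q = r"
proof -
  have Q: "pmf q z > 0" and R: "pmf r z > 0" if "z \<in> set_pmf q" for z
    using that ac by (auto simp: pmf_positive_iff)
  have sumQ: "sum (pmf q) (set_pmf q) = 1"
    using fin by (intro sum_pmf_eq_1) auto
  have sumR: "sum (pmf r) (set_pmf q) \<le> 1"
    using fin by (metis measure_measure_pmf_finite measure_pmf.prob_le_1)
  let ?d = "\<lambda>z. (pmf r z - pmf q z) - pmf q z * ln (pmf r z / pmf q z)"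
  have d_nonneg: "?d z \<ge> 0" if z: "z \<in> set_pmf q" for z
  proof -
    have "ln (pmf r z / pmf q z) \<le> pmf r z / pmf q z - 1"
      using Q[OF z] R[OF z] by (intro ln_le_minus_one) simp
    then have "pmf q z * ln (pmf r z / pmf q z) \<le> pmf q z * (pmf r z / pmf q z - 1)"
      using Q[OF z] by (intro mult_left_mono) auto
    also have "\<dots> = pmf r z - pmf q z"
      using Q[OF z] by (simp add: field_simps)
    finally show ?thesis by simp
  qed
  have "(\<Sum>z\<in>set_pmf q. ?d z) = sum (pmf r) (set_pmf q) - 1"
    by (simp only: sum_subtractf eq sumQ diff_0_right)
  moreover have "(\<Sum>z\<in>set_pmf q. ?d z) \<ge> 0"
    using d_nonneg by (intro sum_nonneg) auto
  ultimately have sumR1: "sum (pmf r) (set_pmf q) = 1" and sumd: "(\<Sum>z\<in>set_pmf q. ?d z) = 0"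
    using sumR by auto
  from sumd have d0: "\<forall>z\<in>set_pmf q. ?d z = 0"
    using d_nonneg by (subst (asm) sum_nonneg_eq_0_iff[OF fin]) auto
  have QR: "pmf q z = pmf r z" if z: "z \<in> set_pmf q" for z
  proof -
    have "pmf q z * ln (pmf r z / pmf q z) = pmf r z - pmf q z"
      using d0 z by force
    then have "ln (pmf r z / pmf q z) = pmf r z / pmf q z - 1"
      using Q[OF z] by (simp add: field_simps)
    then have "pmf r z / pmf q z = 1"
      using Q[OF z] R[OF z] by (intro ln_eq_minus_one) auto
    then show ?thesis
      using Q[OF z] by (simp add: field_simps)
  qed
  have "measure r (set_pmf q) = 1"
    using fin sumR1 by (simp only: measure_measure_pmf_finite)
  then have "AE z in r. z \<in> set_pmf q"
    by (subst (asm) measure_pmf.prob_eq_1) auto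
  then have sub: "set_pmf r \<subseteq> set_pmf q"
    by (auto simp: AE_measure_pmf_iff)
  show ?thesis
  proof (rule pmf_eqI)
    fix z show "pmf q z = pmf r z"
      using QR[of z] sub by (cases "z \<in> set_pmf q") (auto simp: set_pmf_iff)
  qed
qed

text \<open>\<open>H(X) + H(Y) - H(X, Y)\<close> is, up to the change of base by
  \<open>ln b\<close>, the relative entropy between the joint law \<open>q\<close> and the product
  \<open>r\<close> of its marginals. It vanishes only if the two laws agree.\<close>

lemma indep_of_ent_eq:
  assumes fin: "finite (set_pmf p)" and b: "1 < b"
    and eq: "ent b p (\<lambda>\<omega>. (X \<omega>, Y \<omega>)) = ent b p X + ent b p Y"
  shows "map_pmf (\<lambda>\<omega>. (X \<omega>, Y \<omega>)) p = pair_pmf (map_pmf X p) (map_pmf Y p)"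
proof -
  define q where "q = map_pmf (\<lambda>\<omega>. (X \<omega>, Y \<omega>)) p"
  define r where "r = pair_pmf (map_pmf X p) (map_pmf Y p)"
  have finq: "finite (set_pmf q)" and ac: "set_pmf q \<subseteq> set_pmf r"
    using fin by (auto simp: q_def r_def)
  have mX: "map_pmf fst q = map_pmf X p" and mY: "map_pmf snd q = map_pmf Y p"
    by (simp_all add: q_def pmf.map_comp o_def)
  have r: "r = pair_pmf (map_pmf fst q) (map_pmf snd q)"
    by (simp add: r_def mX mY)
  have "ent b p (\<lambda>\<omega>. (X \<omega>, Y \<omega>)) = ent b q (\<lambda>z. z)" "ent b p X = ent b q fst" "ent b p Y = ent b q snd"
    unfolding q_def using fin b by (simp_all add: ent_map_pmf o_def)
  then have eq': "ent b q (\<lambda>z. z) = ent b q fst + ent b q snd"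
    using eq by simp
  have pos: "pmf q z > 0" "pmf (map_pmf fst q) (fst z) > 0" "pmf (map_pmf snd q) (snd z) > 0"
    if "z \<in> set_pmf q" for z
    using that by (simp_all add: pmf_positive_iff)
  have term_eq: "pmf q z * ln (pmf r z / pmf q z) =
      (pmf q z * log b (pmf (map_pmf fst q) (fst z)) + pmf q z * log b (pmf (map_pmf snd q) (snd z))
        - pmf q z * log b (pmf q z)) * ln b" if z: "z \<in> set_pmf q" for z
    using pos[OF z] b unfolding r
    by (cases z) (simp add: pmf_pair ln_div ln_mult log_def algebra_simps)
  have "(\<Sum>z\<in>set_pmf q. pmf q z * ln (pmf r z / pmf q z)) =
      (- ent b q fst - ent b q snd + ent b q (\<lambda>z. z)) * ln b"
    unfolding ent_eq_sum[OF finq b] pmf.map_ident image_ident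
      sum_map_pmf[OF finq, of "\<lambda>x. log b (pmf (map_pmf fst q) x)" fst, symmetric]
      sum_map_pmf[OF finq, of "\<lambda>x. log b (pmf (map_pmf snd q) x)" snd, symmetric]
    by (simp add: term_eq sum_distrib_right[symmetric] sum_subtractf sum.distrib)
  also have "\<dots> = 0"
    unfolding eq' by simp
  finally have "q = r"
    by (intro pmf_eq_of_relative_entropy_eq_0 finq ac)
  then show ?thesis
    unfolding q_def r_def .
qed

lemma mut_inf_eq_0_iff:
  assumes "finite (set_pmf p)" "1 < b"
  shows "mut_inf b p X Y = 0 \<longleftrightarrow>
    map_pmf (\<lambda>\<omega>. (X \<omega>, Y \<omega>)) p = pair_pmf (map_pmf X p) (map_pmf Y p)"
  using mut_inf_eq_0_iff_ent[OF assms, of X Y] indep_of_ent_eq[OF assms, of X Y]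
    ent_Pair_pair_pmf[OF assms, of X Y] by argo

section \<open>Subadditivity, decoding and averaging\<close>

lemma ent_restrict_le_sum:
  assumes "finite (set_pmf p)" "1 < b" "finite A"
  shows "ent b p (\<lambda>\<omega>. restrict (X \<omega>) A) \<le> (\<Sum>n\<in>A. ent b p (\<lambda>\<omega>. X \<omega> n))"
  using assms(3)
proof (induction A rule: finite_induct)
  case empty
  have "ent b p (\<lambda>\<omega>. restrict (X \<omega>) {}) \<le> log b (card ((\<lambda>\<omega>. restrict (X \<omega>) {}) ` set_pmf p))"
    by (rule ent_le_log_card[OF assms(1,2)])
  also have "(\<lambda>\<omega>. restrict (X \<omega>) {}) ` set_pmf p = {\<lambda>_. undefined}"
    using set_pmf_not_empty[of p] by (auto simp: restrict_def)
  finally show ?case by simp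
next
  case (insert a A)
  have "ent b p (\<lambda>\<omega>. restrict (X \<omega>) (insert a A)) \<le> ent b p (\<lambda>\<omega>. (X \<omega> a, restrict (X \<omega>) A))"
  proof (rule ent_function_le[OF assms(1,2)])
    have upd: "restrict f (insert a A) = (restrict f A)(a := f a)" for f :: "'b \<Rightarrow> 'c"
      by auto
    show "restrict (X \<omega>) (insert a A) = restrict (X \<omega>') (insert a A)"
      if "(X \<omega> a, restrict (X \<omega>) A) = (X \<omega>' a, restrict (X \<omega>') A)" for \<omega> \<omega>'
      using that unfolding upd by simp
  qed
  also have "\<dots> \<le> ent b p (\<lambda>\<omega>. X \<omega> a) + ent b p (\<lambda>\<omega>. restrict (X \<omega>) A)"
    by (rule ent_Pair_le[OF assms(1,2)])
  finally show ?case
    using insert.IH insert.hyps by (simp del: restrict_apply)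
qed

text \<open>\<open>H(W) + H(U) = H(W, U) \<le> H(U, V) \<le> H(U) + H(V)\<close>.\<close>

lemma ent_le_of_decodable:
  assumes fin: "finite (set_pmf p)" and b: "1 < b"
    and indep: "map_pmf (\<lambda>\<omega>. (W \<omega>, U \<omega>)) p = pair_pmf (map_pmf W p) (map_pmf U p)"
    and dec: "\<And>\<omega> \<omega>'. \<omega> \<in> set_pmf p \<Longrightarrow> \<omega>' \<in> set_pmf p \<Longrightarrow> U \<omega> = U \<omega>' \<Longrightarrow> V \<omega> = V \<omega>' \<Longrightarrow> W \<omega> = W \<omega>'"
  shows "ent b p W \<le> ent b p V"
proof -
  have "ent b p W + ent b p U = ent b p (\<lambda>\<omega>. (W \<omega>, U \<omega>))"
    using ent_Pair_pair_pmf[OF fin b indep] by simp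
  also have "\<dots> \<le> ent b p (\<lambda>\<omega>. (U \<omega>, V \<omega>))"
  proof (rule ent_function_le[OF fin b])
    show "(W \<omega>, U \<omega>) = (W \<omega>', U \<omega>')"
      if "\<omega> \<in> set_pmf p" "\<omega>' \<in> set_pmf p" "(U \<omega>, V \<omega>) = (U \<omega>', V \<omega>')" for \<omega> \<omega>'
      using dec[OF that(1,2)] that(3) by simp
  qed
  also have "\<dots> \<le> ent b p U + ent b p V"
    by (rule ent_Pair_le[OF fin b])
  finally show ?thesis by simp
qed

text \<open>Averaging over all subsets of size \<open>k\<close>, done one element at a time: the
  induction hypothesis is applied to \<open>A - {x}\<close> for every \<open>x\<close> and the
  results are added. Each \<open>h y\<close> is then counted \<open>card A - 1\<close> times, a
  positive factor that cancels.\<close>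

lemma averaging_bound:
  fixes h :: "'i \<Rightarrow> real" and L :: real
  assumes "finite A" "k \<le> card A" "0 < k"
    and "\<And>U. U \<subseteq> A \<Longrightarrow> card U = k \<Longrightarrow> L \<le> sum h U"
  shows "card A * L \<le> k * sum h A"
  using assms(1,2,4)
proof (induction "card A - k" arbitrary: A)
  case 0
  then have "card A = k" by simp
  then show ?case
    using 0 by (auto intro!: mult_left_mono)
next
  case (Suc m)
  define a where "a = card A - 1"
  have a: "card A = Suc a" "0 < a"
    using Suc.hyps(2) \<open>0 < k\<close> by (auto simp: a_def)
  have "real a * L \<le> k * (sum h A - h x)" if "x \<in> A" for x
  proof -
    have card: "card (A - {x}) = a"
      using that a Suc.prems(1) by simp
    have "card (A - {x}) * L \<le> k * sum h (A - {x})"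
      by (rule Suc.hyps) (use Suc.hyps(2) Suc.prems a card that in auto)
    then show ?thesis
      using that Suc.prems(1) card by (simp add: sum_diff1)
  qed
  then have "(\<Sum>x\<in>A. real a * L) \<le> (\<Sum>x\<in>A. k * (sum h A - h x))"
    by (rule sum_mono)
  also have "\<dots> = real a * (k * sum h A)"
    using a(1) by (simp add: sum_distrib_left[symmetric] sum_subtractf algebra_simps)
  finally have "real a * (card A * L) \<le> real a * (k * sum h A)"
    by (simp add: mult_ac)
  then show ?case
    using a(2) by simp
qed

section \<open>The converse\<close>

lemma ex_function_of:
  assumes "\<And>\<omega> \<omega>'. \<omega> \<in> S \<Longrightarrow> \<omega>' \<in> S \<Longrightarrow> X \<omega> = X \<omega>' \<Longrightarrow> Y \<omega> = Y \<omega>'"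
  obtains f where "\<And>\<omega>. \<omega> \<in> S \<Longrightarrow> Y \<omega> = f (X \<omega>)"
proof
  show "Y \<omega> = Y (SOME \<omega>'. \<omega>' \<in> S \<and> X \<omega>' = X \<omega>)" if "\<omega> \<in> S" for \<omega>
    using someI[of "\<lambda>\<omega>'. \<omega>' \<in> S \<and> X \<omega>' = X \<omega>" \<omega>] that assms[of \<omega>] by metis
qed

text \<open>Any product form suffices for independence, so the second factor of a law never has to
  be computed.\<close>

lemma pair_pmf_eq_marginals:
  assumes eq: "map_pmf (\<lambda>\<omega>. (X \<omega>, Y \<omega>)) p = pair_pmf A B"
  shows "map_pmf (\<lambda>\<omega>. (X \<omega>, Y \<omega>)) p = pair_pmf (map_pmf X p) (map_pmf Y p)"
proof -
  have "map_pmf X p = A" "map_pmf Y p = B"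
    using arg_cong[OF eq, of "map_pmf fst"] arg_cong[OF eq, of "map_pmf snd"]
    by (simp_all add: pmf.map_comp o_def map_fst_pair_pmf map_snd_pair_pmf)
  with eq show ?thesis by simp
qed

text \<open>Collects only the assumptions on the base ring, so that the concrete code can use the
  results below before it is shown to satisfy \<open>rdcds\<close>.\<close>

locale finite_field_scheme =
  fixes P :: "('f, 's, 'q, 'a) scheme"
  assumes field_base: "field (base P)" and finite_base: "finite (carrier (base P))"
begin

sublocale field "base P"
  by (rule field_base)

lemma qary_gt_1: "1 < qary P"
proof -
  have "card {\<zero>\<^bsub>base P\<^esub>, \<one>\<^bsub>base P\<^esub>} \<le> card (carrier (base P))"
    using finite_base by (intro card_mono) auto
  then show ?thesis
    by (simp add: qary_def)
qed

lemma finite_messages: "finite (messages P)"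
  and card_messages: "card (messages P) = card (carrier (base P)) ^ len P"
proof -
  have "messages P = {w. set w \<subseteq> carrier (base P) \<and> length w = len P}"
    by (auto simp: messages_def)
  then show "finite (messages P)" "card (messages P) = card (carrier (base P)) ^ len P"
    using finite_base by (simp_all add: finite_lists_length_eq card_lists_length_eq)
qed

lemma messages_nonempty: "messages P \<noteq> {}"
proof -
  have "replicate (len P) \<zero>\<^bsub>base P\<^esub> \<in> messages P"
    by (auto simp: messages_def set_replicate_conv_if)
  then show ?thesis by blast
qed

lemma set_uniform_message [simp]: "set_pmf (uniform_message P) = messages P"
  unfolding uniform_message_def by (simp add: finite_messages messages_nonempty)

lemma log_card_messages: "log (qary P) (card (messages P)) = len P"
  using qary_gt_1 by (simp add: card_messages qary_def[symmetric] log_nat_power)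

lemma ent_uniform_message:
  assumes "finite (set_pmf p)" "map_pmf W p = uniform_message P"
  shows "ent (qary P) p W = len P"
  using ent_uniform[OF assms(1) qary_gt_1 assms(2)[unfolded uniform_message_def] finite_messages messages_nonempty]
  by (simp add: log_card_messages)

lemma msg_add_closed:
  assumes "v \<in> messages P" "w \<in> messages P"
  shows "msg_add P v w \<in> messages P"
proof -
  have "v ! i \<oplus>\<^bsub>base P\<^esub> w ! i \<in> carrier (base P)" if "i < len P" for i
    using assms that by (intro add.m_closed) (auto simp: messages_def)
  then show ?thesis
    using assms by (auto simp: messages_def msg_add_def set_zip)
qed

lemma msg_add_commute:
  assumes "v \<in> messages P" "w \<in> messages P"
  shows "msg_add P v w = msg_add P w v"
  using assms by (auto simp: messages_def msg_add_def list_eq_iff_nth_eq intro!: a_comm)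

lemma msg_add_cancel:
  assumes "u \<in> messages P" "v \<in> messages P" "w \<in> messages P" "msg_add P u v = msg_add P u w"
  shows "v = w"
proof (rule nth_equalityI)
  show "length v = length w"
    using assms by (simp add: messages_def)
  fix i assume i: "i < length v"
  have nth: "x \<in> messages P \<Longrightarrow> x ! i \<in> carrier (base P)" for x
    using i assms(2) by (auto simp: messages_def)
  from i have "u ! i \<oplus>\<^bsub>base P\<^esub> v ! i = u ! i \<oplus>\<^bsub>base P\<^esub> w ! i"
    using assms(1-3) arg_cong[OF assms(4), of "\<lambda>x. x ! i"] by (simp add: messages_def msg_add_def)
  then show "v ! i = w ! i"
    using r_neg1[of "u ! i" "v ! i"] r_neg1[of "u ! i" "w ! i"] nth[of u] nth[of v] nth[of w] assms(1-3)
    by metis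
qed

text \<open>The one-time pad. The first form serves when the increment is the pad, the second when
  the old message is.\<close>

lemma map_msg_add_uniform_message:
  assumes "w \<in> messages P"
  shows "map_pmf (msg_add P w) (uniform_message P) = uniform_message P"
    and "map_pmf (\<lambda>v. msg_add P v w) (uniform_message P) = uniform_message P"
proof -
  have "inj_on (msg_add P w) (messages P)"
    using assms by (auto intro!: inj_onI dest: msg_add_cancel)
  moreover have "msg_add P w ` messages P \<subseteq> messages P"
    using assms by (auto intro: msg_add_closed)
  ultimately have "bij_betw (msg_add P w) (messages P) (messages P)"
    by (simp add: bij_betw_def finite_messages endo_inj_surj)
  then show 1: "map_pmf (msg_add P w) (uniform_message P) = uniform_message P"
    unfolding uniform_message_def
    by (intro map_pmf_of_set_bij_betw finite_messages messages_nonempty)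
  have "map_pmf (\<lambda>v. msg_add P v w) (uniform_message P) = map_pmf (msg_add P w) (uniform_message P)"
    using assms by (intro map_pmf_cong) (auto simp: msg_add_commute)
  with 1 show "map_pmf (\<lambda>v. msg_add P v w) (uniform_message P) = uniform_message P"
    by simp
qed

section \<open>Secrecy of the message under one update\<close>

lemma pair_uniform_message_bind:
  "bind_pmf \<nu> (\<lambda>z. map_pmf (\<lambda>m. (m, z)) (uniform_message P)) = pair_pmf (uniform_message P) \<nu>"
  unfolding pair_pmf_def map_pmf_def by (rule bind_commute_pmf)

text \<open>\<open>f\<close> does not read the new storage, so the draws from \<open>store\<close>
  integrate out.\<close>

lemma update_law_proj:
  "map_pmf (\<lambda>\<omega>. f (u_msg \<omega>) (u_sto \<omega>) (u_inc \<omega>) (u_upl \<omega>)) (update_law N P \<sigma> D X) =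
   bind_pmf \<sigma> (\<lambda>(w, s). bind_pmf (uniform_message P) (\<lambda>d. map_pmf (f w s d) (upload P D X d)))"
  unfolding update_law_def map_pmf_def
  by (auto simp: bind_assoc_pmf bind_return_pmf case_prod_unfold intro!: bind_pmf_cong)

lemma update_lawD:
  assumes "\<omega> \<in> set_pmf (update_law N P \<sigma> D X)"
  shows "(u_msg \<omega>, u_sto \<omega>) \<in> set_pmf \<sigma>" "u_inc \<omega> \<in> messages P" "u_upl \<omega> \<in> set_pmf (upload P D X (u_inc \<omega>))"
    "u_msg' \<omega> = msg_add P (u_msg \<omega>) (u_inc \<omega>)" "n \<notin> {1..N} - D \<Longrightarrow> u_sto' \<omega> n = u_sto \<omega> n"
  using assms by (auto simp: update_law_def)

text \<open>The draws of the user do not depend on the old state, so every state in the support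
  occurs together with every possible increment and upload.\<close>

lemma update_lawI:
  assumes "(w, s) \<in> set_pmf \<sigma>" "d \<in> messages P" "q \<in> set_pmf (upload P D X d)"
  shows "\<exists>\<omega>\<in>set_pmf (update_law N P \<sigma> D X). u_msg \<omega> = w \<and> u_sto \<omega> = s \<and> u_inc \<omega> = d \<and> u_upl \<omega> = q"
proof -
  obtain s' where "s' \<in> set_pmf (Pi_pmf ({1..N} - D) undefined (\<lambda>n. store P D X n (s n) (q n)))"
    using set_pmf_not_empty by fast
  then have "\<lparr>u_msg = w, u_sto = s, u_inc = d, u_upl = q, u_msg' = msg_add P w d,
      u_sto' = (\<lambda>n. if n \<in> {1..N} - D then s' n else s n)\<rparr> \<in> set_pmf (update_law N P \<sigma> D X)"
    unfolding update_law_def using assms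
    by (auto intro!: bexI[of _ "(w, s)"] bexI[of _ d] bexI[of _ q] bexI[of _ s'])
  then show ?thesis
    by (intro bexI) auto
qed

text \<open>Independence in product form. The second factor is left open, since it changes with
  every update and only its existence matters.\<close>

definition hides :: "nat set \<Rightarrow> ('f list \<times> (nat \<Rightarrow> 's)) pmf \<Rightarrow> bool" where
  "hides T \<sigma> \<longleftrightarrow> (\<exists>\<nu>. map_pmf (\<lambda>(w, s). (w, restrict s T)) \<sigma> = pair_pmf (uniform_message P) \<nu>)"

abbreviation after_update where
  "after_update N \<sigma> D X \<equiv> map_pmf (\<lambda>\<omega>. (u_msg' \<omega>, u_sto' \<omega>)) (update_law N P \<sigma> D X)"

lemma update_ok_storage_cong:
  assumes ok: "update_ok N P D X (update_law N P \<sigma> D X)" and "T \<subseteq> {1..N}"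
    and \<omega>: "\<omega> \<in> set_pmf (update_law N P \<sigma> D X)" "\<omega>' \<in> set_pmf (update_law N P \<sigma> D X)"
    and eq: "restrict (u_sto \<omega>) T = restrict (u_sto \<omega>') T"
      "restrict (u_upl \<omega>) (T - D) = restrict (u_upl \<omega>') (T - D)"
  shows "restrict (u_sto' \<omega>) T = restrict (u_sto' \<omega>') T"
proof (rule restrict_ext)
  fix n assume n: "n \<in> T"
  have s: "u_sto \<omega> n = u_sto \<omega>' n"
    using n fun_cong[OF eq(1), of n] by simp
  show "u_sto' \<omega> n = u_sto' \<omega>' n"
  proof (cases "n \<in> D")
    case True
    then show ?thesis
      using update_lawD(5)[OF \<omega>(1), of n] update_lawD(5)[OF \<omega>(2), of n] s by simp
  next
    case False
    then have q: "u_upl \<omega> n = u_upl \<omega>' n" and "n \<in> {1..N} - D"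
      using n fun_cong[OF eq(2), of n] \<open>T \<subseteq> {1..N}\<close> by auto
    then have c: "cond_ent (qary P) (update_law N P \<sigma> D X) (\<lambda>\<omega>. u_sto' \<omega> n) (\<lambda>\<omega>. (u_sto \<omega> n, u_upl \<omega> n)) = 0"
      and fin: "finite (set_pmf (update_law N P \<sigma> D X))"
      using ok unfolding update_ok_def by blast+
    show ?thesis
      using cond_ent_eq_0_iff[OF fin qary_gt_1, THEN iffD1, OF c, rule_format, OF \<omega>] s q by simp
  qed
qed

text \<open>By the transition condition, the randomised \<open>store\<close> acts on the support as
  a function \<open>\<Phi>\<close> of what the servers in \<open>T\<close> hold and receive. The law
  after the update is thereby expressed by the old state and the draws of the user alone.\<close>

lemma after_update_storage:
  assumes "update_ok N P D X (update_law N P \<sigma> D X)" "T \<subseteq> {1..N}"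
  obtains \<Phi> where "map_pmf (\<lambda>(w, s). (w, restrict s T)) (after_update N \<sigma> D X) =
    bind_pmf \<sigma> (\<lambda>(w, s). bind_pmf (uniform_message P) (\<lambda>d.
      map_pmf (\<lambda>q. (msg_add P w d, \<Phi> (restrict s T) (restrict q (T - D)))) (upload P D X d)))"
proof -
  obtain f where f: "restrict (u_sto' \<omega>) T = f (restrict (u_sto \<omega>) T, restrict (u_upl \<omega>) (T - D))"
    if "\<omega> \<in> set_pmf (update_law N P \<sigma> D X)" for \<omega>
    using ex_function_of[of "set_pmf (update_law N P \<sigma> D X)"
        "\<lambda>\<omega>. (restrict (u_sto \<omega>) T, restrict (u_upl \<omega>) (T - D))" "\<lambda>\<omega>. restrict (u_sto' \<omega>) T"]
      update_ok_storage_cong[OF assms] by (smt (verit) prod.inject)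
  have "map_pmf (\<lambda>(w, s). (w, restrict s T)) (after_update N \<sigma> D X) =
      map_pmf (\<lambda>\<omega>. (msg_add P (u_msg \<omega>) (u_inc \<omega>), f (restrict (u_sto \<omega>) T, restrict (u_upl \<omega>) (T - D))))
        (update_law N P \<sigma> D X)"
    by (auto simp: pmf.map_comp o_def intro!: map_pmf_cong f update_lawD)
  also have "\<dots> = bind_pmf \<sigma> (\<lambda>(w, s). bind_pmf (uniform_message P) (\<lambda>d.
      map_pmf (\<lambda>q. (msg_add P w d, f (restrict s T, restrict q (T - D)))) (upload P D X d)))"
    by (rule update_law_proj)
  finally show ?thesis
    by (rule that)
qed

lemma update_law_inc: "map_pmf u_inc (update_law N P \<sigma> D X) = uniform_message P"
  using update_law_proj[of "\<lambda>w s d q. d" N \<sigma> D X]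
  by (simp add: map_pmf_const bind_return_pmf' case_prod_unfold)

text \<open>The second form mentions only the draws of the user, so it can be applied separately for
  every old state.\<close>

lemma secure_upload:
  assumes ok: "update_ok N P D X (update_law N P \<sigma> D X)"
    and Y: "Y \<subseteq> {1..N} - D" "card Y \<le> X"
  obtains \<nu> where
    "map_pmf (\<lambda>\<omega>. (u_inc \<omega>, restrict (u_upl \<omega>) Y)) (update_law N P \<sigma> D X) = pair_pmf (uniform_message P) \<nu>"
    "bind_pmf (uniform_message P) (\<lambda>d. map_pmf (\<lambda>q. (d, restrict q Y)) (upload P D X d)) = pair_pmf (uniform_message P) \<nu>"
proof -
  let ?p = "update_law N P \<sigma> D X"
  have "mut_inf (qary P) ?p u_inc (\<lambda>\<omega>. restrict (u_upl \<omega>) Y) = 0" "finite (set_pmf ?p)"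
    using ok Y unfolding update_ok_def by blast+
  then have 1: "map_pmf (\<lambda>\<omega>. (u_inc \<omega>, restrict (u_upl \<omega>) Y)) ?p =
      pair_pmf (uniform_message P) (map_pmf (\<lambda>\<omega>. restrict (u_upl \<omega>) Y) ?p)"
    by (subst (asm) mut_inf_eq_0_iff) (simp_all add: qary_gt_1 update_law_inc)
  moreover have "map_pmf (\<lambda>\<omega>. (u_inc \<omega>, restrict (u_upl \<omega>) Y)) ?p =
      bind_pmf (uniform_message P) (\<lambda>d. map_pmf (\<lambda>q. (d, restrict q Y)) (upload P D X d))"
    by (subst update_law_proj[of "\<lambda>w s d q. (d, restrict q Y)"]) (simp add: case_prod_unfold)
  ultimately show ?thesis
    using that by metis
qed

text \<open>
  The coded increments received by \<open>T\<close> are independent of the increment, which therefore acts as a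
  one-time pad on the message.
\<close>

lemma hides_after_secure_update:
  assumes ok: "update_ok N P D X (update_law N P \<sigma> D X)" and T: "T \<subseteq> {1..N}" "card (T - D) \<le> X"
    and \<sigma>: "map_pmf fst \<sigma> = uniform_message P"
  shows "hides T (after_update N \<sigma> D X)"
proof -
  obtain \<Phi> where \<Phi>: "map_pmf (\<lambda>(w, s). (w, restrict s T)) (after_update N \<sigma> D X) =
    bind_pmf \<sigma> (\<lambda>(w, s). bind_pmf (uniform_message P) (\<lambda>d.
      map_pmf (\<lambda>q. (msg_add P w d, \<Phi> (restrict s T) (restrict q (T - D)))) (upload P D X d)))"
    using after_update_storage[OF ok T(1)] .
  obtain \<nu> where \<nu>: "bind_pmf (uniform_message P) (\<lambda>d. map_pmf (\<lambda>q. (d, restrict q (T - D))) (upload P D X d))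
      = pair_pmf (uniform_message P) \<nu>"
    using secure_upload[OF ok _ T(2)] T(1) by (metis Diff_mono subset_refl)
  have "map_pmf (\<lambda>(w, s). (w, restrict s T)) (after_update N \<sigma> D X) =
    bind_pmf \<sigma> (\<lambda>(w, s). map_pmf (\<lambda>(d, y). (msg_add P w d, \<Phi> (restrict s T) y)) (pair_pmf (uniform_message P) \<nu>))"
    unfolding \<Phi> \<nu>[symmetric] by (simp add: map_bind_pmf pmf.map_comp o_def)
  also have "\<dots> = bind_pmf \<sigma> (\<lambda>(w, s). bind_pmf \<nu> (\<lambda>y.
      map_pmf (\<lambda>m. (m, \<Phi> (restrict s T) y)) (map_pmf (msg_add P w) (uniform_message P))))"
    unfolding pair_uniform_message_bind[symmetric] by (simp add: map_bind_pmf pmf.map_comp o_def)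
  also have "\<dots> = bind_pmf \<sigma> (\<lambda>(w, s). bind_pmf \<nu> (\<lambda>y. map_pmf (\<lambda>m. (m, \<Phi> (restrict s T) y)) (uniform_message P)))"
  proof (intro bind_pmf_cong refl, clarify)
    fix w s assume "(w, s) \<in> set_pmf \<sigma>"
    then have "w \<in> set_pmf (map_pmf fst \<sigma>)"
      by force
    then have "w \<in> messages P"
      by (simp add: \<sigma>)
    then show "bind_pmf \<nu> (\<lambda>y. map_pmf (\<lambda>m. (m, \<Phi> (restrict s T) y)) (map_pmf (msg_add P w) (uniform_message P))) =
        bind_pmf \<nu> (\<lambda>y. map_pmf (\<lambda>m. (m, \<Phi> (restrict s T) y)) (uniform_message P))"
      by (simp only: map_msg_add_uniform_message)
  qed
  also have "\<dots> = bind_pmf (bind_pmf \<sigma> (\<lambda>(w, s). map_pmf (\<Phi> (restrict s T)) \<nu>))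
      (\<lambda>z. map_pmf (\<lambda>m. (m, z)) (uniform_message P))"
    by (simp add: bind_assoc_pmf bind_map_pmf case_prod_unfold)
  finally show ?thesis
    unfolding hides_def pair_uniform_message_bind by blast
qed

text \<open>Here the old message is the pad: it is uniform given the storage of \<open>T\<close>,
  and it is drawn independently of the increment and the uploads. The new message is therefore
  uniform given everything that \<open>T\<close> sees, whatever the security level of this
  update.\<close>

lemma hides_after_update:
  assumes ok: "update_ok N P D X (update_law N P \<sigma> D X)" and T: "T \<subseteq> {1..N}" and hid: "hides T \<sigma>"
  shows "hides T (after_update N \<sigma> D X)"
proof -
  obtain \<Phi> where \<Phi>: "map_pmf (\<lambda>(w, s). (w, restrict s T)) (after_update N \<sigma> D X) =
    bind_pmf \<sigma> (\<lambda>(w, s). bind_pmf (uniform_message P) (\<lambda>d.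
      map_pmf (\<lambda>q. (msg_add P w d, \<Phi> (restrict s T) (restrict q (T - D)))) (upload P D X d)))"
    using after_update_storage[OF ok T] .
  obtain \<nu> where \<nu>: "map_pmf (\<lambda>(w, s). (w, restrict s T)) \<sigma> = pair_pmf (uniform_message P) \<nu>"
    using hid unfolding hides_def by blast
  have "map_pmf (\<lambda>(w, s). (w, restrict s T)) (after_update N \<sigma> D X) =
    bind_pmf (map_pmf (\<lambda>(w, s). (w, restrict s T)) \<sigma>) (\<lambda>(w, z). bind_pmf (uniform_message P) (\<lambda>d.
      map_pmf (\<lambda>q. (msg_add P w d, \<Phi> z (restrict q (T - D)))) (upload P D X d)))"
    unfolding \<Phi> by (simp add: bind_map_pmf case_prod_unfold)
  also have "\<dots> = bind_pmf \<nu> (\<lambda>z. bind_pmf (uniform_message P) (\<lambda>w. bind_pmf (uniform_message P) (\<lambda>d.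
      map_pmf (\<lambda>q. (msg_add P w d, \<Phi> z (restrict q (T - D)))) (upload P D X d))))"
    unfolding \<nu> pair_uniform_message_bind[symmetric] by (simp add: bind_assoc_pmf bind_map_pmf)
  \<comment> \<open>The draw of \<open>w\<close> is moved past those of \<open>d\<close> and
    \<open>q\<close>, so that \<open>msg_add P w d\<close> has a fixed \<open>d\<close> and a
    uniform \<open>w\<close>.\<close>
  also have "\<dots> = bind_pmf \<nu> (\<lambda>z. bind_pmf (uniform_message P) (\<lambda>d. bind_pmf (upload P D X d) (\<lambda>q.
      map_pmf (\<lambda>m. (m, \<Phi> z (restrict q (T - D)))) (map_pmf (\<lambda>w. msg_add P w d) (uniform_message P)))))"
    unfolding map_pmf_def
    by (subst (1) bind_commute_pmf, subst (2) bind_commute_pmf) (simp add: bind_assoc_pmf bind_return_pmf)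
  also have "\<dots> = bind_pmf \<nu> (\<lambda>z. bind_pmf (uniform_message P) (\<lambda>d. bind_pmf (upload P D X d) (\<lambda>q.
      map_pmf (\<lambda>m. (m, \<Phi> z (restrict q (T - D)))) (uniform_message P))))"
    by (intro bind_pmf_cong refl) (simp add: map_msg_add_uniform_message)
  also have "\<dots> = bind_pmf (bind_pmf \<nu> (\<lambda>z. bind_pmf (uniform_message P) (\<lambda>d.
      map_pmf (\<lambda>q. \<Phi> z (restrict q (T - D))) (upload P D X d)))) (\<lambda>z. map_pmf (\<lambda>m. (m, z)) (uniform_message P))"
    by (simp add: bind_assoc_pmf bind_map_pmf)
  finally show ?thesis
    unfolding hides_def pair_uniform_message_bind by blast
qed

section \<open>Entropy bounds on storage, answers and uploads\<close>

lemma len_le_sum_storage: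
  assumes ok: "state_ok N Rr Kc P \<sigma>" and hid: "hides T \<sigma>"
    and R: "T \<subseteq> R" "R \<subseteq> {1..N}" "card R = Rr"
  shows "len P \<le> (\<Sum>n\<in>R - T. ent (qary P) \<sigma> (\<lambda>(w, s). s n))"
proof -
  have fin: "finite (set_pmf \<sigma>)" and unif: "map_pmf fst \<sigma> = uniform_message P"
    and c: "cond_ent (qary P) \<sigma> (\<lambda>(w, s). w) (\<lambda>(w, s). restrict s R) = 0"
    using ok R unfolding state_ok_def by blast+
  have dec: "fst \<omega> = fst \<omega>'"
    if "\<omega> \<in> set_pmf \<sigma>" "\<omega>' \<in> set_pmf \<sigma>" "restrict (snd \<omega>) R = restrict (snd \<omega>') R" for \<omega> \<omega>'
    using cond_ent_eq_0_iff[OF fin qary_gt_1, THEN iffD1, OF c, rule_format, OF that(1,2)] that(3)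
    by (simp only: case_prod_unfold)
  obtain \<nu> where "map_pmf (\<lambda>\<omega>. (fst \<omega>, restrict (snd \<omega>) T)) \<sigma> = pair_pmf (uniform_message P) \<nu>"
    using hid unfolding hides_def case_prod_unfold by blast
  then have "map_pmf (\<lambda>\<omega>. (fst \<omega>, restrict (snd \<omega>) T)) \<sigma> =
      pair_pmf (map_pmf fst \<sigma>) (map_pmf (\<lambda>\<omega>. restrict (snd \<omega>) T) \<sigma>)"
    by (rule pair_pmf_eq_marginals)
  then have "ent (qary P) \<sigma> fst \<le> ent (qary P) \<sigma> (\<lambda>\<omega>. restrict (snd \<omega>) (R - T))"
  proof (rule ent_le_of_decodable[OF fin qary_gt_1])
    fix \<omega> \<omega>' assume \<omega>: "\<omega> \<in> set_pmf \<sigma>" "\<omega>' \<in> set_pmf \<sigma>"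
      and eq: "restrict (snd \<omega>) T = restrict (snd \<omega>') T"
        "restrict (snd \<omega>) (R - T) = restrict (snd \<omega>') (R - T)"
    have "snd \<omega> n = snd \<omega>' n" if "n \<in> R" for n
      using fun_cong[OF eq(1), of n] fun_cong[OF eq(2), of n] that by (cases "n \<in> T") auto
    then show "fst \<omega> = fst \<omega>'"
      by (intro dec \<omega> restrict_ext)
  qed
  also have "\<dots> \<le> (\<Sum>n\<in>R - T. ent (qary P) \<sigma> (\<lambda>\<omega>. snd \<omega> n))"
    using R(2) by (intro ent_restrict_le_sum[OF fin qary_gt_1]) (auto intro: finite_subset)
  finally show ?thesis
    using ent_uniform_message[OF fin unif] by (simp add: case_prod_unfold)
qed

lemma read_law_proj:
  "map_pmf (\<lambda>\<omega>. (r_msg \<omega>, r_sto \<omega>)) (read_law N P \<sigma> D) = \<sigma>"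
proof -
  have "map_pmf (\<lambda>\<omega>. (r_msg \<omega>, r_sto \<omega>)) (read_law N P \<sigma> D) = bind_pmf \<sigma> (\<lambda>(w, s). return_pmf (w, s))"
    unfolding read_law_def
    by (simp add: map_bind_pmf case_prod_unfold map_pmf_const)
  then show ?thesis
    by (simp add: case_prod_unfold bind_return_pmf')
qed

text \<open>The answers of \<open>T - D\<close> are functions of the storage of \<open>T\<close> and
  hence independent of the message, so the other available servers must deliver all of it.\<close>

lemma len_le_sum_answers:
  assumes ok: "read_ok N P D (read_law N P \<sigma> D)" and unif: "map_pmf fst \<sigma> = uniform_message P"
    and T: "T \<subseteq> {1..N}" and hid: "hides T \<sigma>"
  shows "len P \<le> (\<Sum>n\<in>{1..N} - D - T. ent (qary P) (read_law N P \<sigma> D) (\<lambda>\<omega>. r_ans \<omega> n))"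
proof -
  let ?p = "read_law N P \<sigma> D"
  have fin: "finite (set_pmf ?p)"
    and ans: "\<And>n. n \<in> {1..N} - D \<Longrightarrow> cond_ent (qary P) ?p (\<lambda>\<omega>. r_ans \<omega> n) (\<lambda>\<omega>. r_sto \<omega> n) = 0"
    and c: "cond_ent (qary P) ?p r_msg (\<lambda>\<omega>. restrict (r_ans \<omega>) ({1..N} - D)) = 0"
    using ok unfolding read_ok_def by blast+
  have dec: "r_msg \<omega> = r_msg \<omega>'"
    if "\<omega> \<in> set_pmf ?p" "\<omega>' \<in> set_pmf ?p"
      "restrict (r_ans \<omega>) ({1..N} - D) = restrict (r_ans \<omega>') ({1..N} - D)" for \<omega> \<omega>'
    by (rule cond_ent_eq_0_iff[OF fin qary_gt_1, THEN iffD1, OF c, rule_format, OF that])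
  have "restrict (r_ans \<omega>) (T - D) = restrict (r_ans \<omega>') (T - D)"
    if \<omega>: "\<omega> \<in> set_pmf ?p" "\<omega>' \<in> set_pmf ?p" and eq: "restrict (r_sto \<omega>) T = restrict (r_sto \<omega>') T" for \<omega> \<omega>'
  proof (rule restrict_ext)
    fix n assume n: "n \<in> T - D"
    then have "r_sto \<omega> n = r_sto \<omega>' n"
      using fun_cong[OF eq, of n] by simp
    moreover have "n \<in> {1..N} - D"
      using n T by auto
    ultimately show "r_ans \<omega> n = r_ans \<omega>' n"
      using cond_ent_eq_0_iff[OF fin qary_gt_1, THEN iffD1, OF ans, rule_format, OF _ \<omega>] by simp
  qed
  then obtain f where f: "\<And>\<omega>. \<omega> \<in> set_pmf ?p \<Longrightarrow> restrict (r_ans \<omega>) (T - D) = f (restrict (r_sto \<omega>) T)"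
    using ex_function_of[of "set_pmf ?p" "\<lambda>\<omega>. restrict (r_sto \<omega>) T" "\<lambda>\<omega>. restrict (r_ans \<omega>) (T - D)"] by blast
  obtain \<nu> where \<nu>: "map_pmf (\<lambda>(w, s). (w, restrict s T)) \<sigma> = pair_pmf (uniform_message P) \<nu>"
    using hid unfolding hides_def by blast
  have "map_pmf (\<lambda>\<omega>. (r_msg \<omega>, restrict (r_ans \<omega>) (T - D))) ?p =
      map_pmf (\<lambda>\<omega>. (r_msg \<omega>, f (restrict (r_sto \<omega>) T))) ?p"
    by (intro map_pmf_cong) (auto simp: f)
  also have "\<dots> = map_pmf (apsnd f) (map_pmf (\<lambda>(w, s). (w, restrict s T)) (map_pmf (\<lambda>\<omega>. (r_msg \<omega>, r_sto \<omega>)) ?p))"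
    by (simp add: pmf.map_comp o_def)
  also have "\<dots> = pair_pmf (uniform_message P) (map_pmf f \<nu>)"
    unfolding read_law_proj \<nu> by (simp add: pair_map_pmf2 apsnd_def map_prod_def)
  finally have "map_pmf (\<lambda>\<omega>. (r_msg \<omega>, restrict (r_ans \<omega>) (T - D))) ?p =
      pair_pmf (map_pmf r_msg ?p) (map_pmf (\<lambda>\<omega>. restrict (r_ans \<omega>) (T - D)) ?p)"
    by (rule pair_pmf_eq_marginals)
  then have "ent (qary P) ?p r_msg \<le> ent (qary P) ?p (\<lambda>\<omega>. restrict (r_ans \<omega>) ({1..N} - D - T))"
  proof (rule ent_le_of_decodable[OF fin qary_gt_1])
    fix \<omega> \<omega>' assume \<omega>: "\<omega> \<in> set_pmf ?p" "\<omega>' \<in> set_pmf ?p"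
      and eq: "restrict (r_ans \<omega>) (T - D) = restrict (r_ans \<omega>') (T - D)"
        "restrict (r_ans \<omega>) ({1..N} - D - T) = restrict (r_ans \<omega>') ({1..N} - D - T)"
    have "r_ans \<omega> n = r_ans \<omega>' n" if "n \<in> {1..N} - D" for n
      using fun_cong[OF eq(1), of n] fun_cong[OF eq(2), of n] that by (cases "n \<in> T") auto
    then show "r_msg \<omega> = r_msg \<omega>'"
      by (intro dec \<omega> restrict_ext)
  qed
  also have "\<dots> \<le> (\<Sum>n\<in>{1..N} - D - T. ent (qary P) ?p (\<lambda>\<omega>. r_ans \<omega> n))"
    by (intro ent_restrict_le_sum[OF fin qary_gt_1]) auto
  finally have "ent (qary P) ?p r_msg \<le> (\<Sum>n\<in>{1..N} - D - T. ent (qary P) ?p (\<lambda>\<omega>. r_ans \<omega> n))" .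
  moreover have "map_pmf r_msg ?p = uniform_message P"
    using arg_cong[OF read_law_proj[of N \<sigma> D], of "map_pmf fst"] unif by (simp add: pmf.map_comp o_def)
  ultimately show ?thesis
    using ent_uniform_message[OF fin] by simp
qed

text \<open>\<open>D\<close>, \<open>U\<close> and \<open>X\<close> further available servers
  \<open>Y\<close> form a set of \<open>Rr\<close> servers, from which the new message is
  recoverable. The servers in \<open>D\<close> receive nothing and the uploads to \<open>Y\<close>
  are independent of the increment, so the uploads to \<open>U\<close> must carry it.\<close>

lemma len_le_sum_uploads:
  assumes ok: "update_ok N P D X (update_law N P \<sigma> D X)"
    and ok': "state_ok N Rr Kc P (after_update N \<sigma> D X)" and unif: "map_pmf fst \<sigma> = uniform_message P"
    and D: "D \<subseteq> {1..N}" and "Rr \<le> N" "card D + X \<le> Rr"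
    and U: "U \<subseteq> {1..N} - D" "card U = Rr - X - card D"
  shows "len P \<le> (\<Sum>n\<in>U. ent (qary P) (update_law N P \<sigma> D X) (\<lambda>\<omega>. u_upl \<omega> n))"
proof -
  let ?p = "update_law N P \<sigma> D X"
  have finD: "finite D" and finU: "finite U"
    using D U by (auto intro: finite_subset)
  have "card ({1..N} - D - U) = N - card D - card U"
    using D U finD finU by (simp add: card_Diff_subset)
  then have "X \<le> card ({1..N} - D - U)"
    using U(2) \<open>Rr \<le> N\<close> \<open>card D + X \<le> Rr\<close> by simp
  then obtain Y where Y: "Y \<subseteq> {1..N} - D - U" "card Y = X"
    by (meson obtain_subset_with_card_n)
  define R where "R = D \<union> U \<union> Y"
  have "finite Y"
    using Y by (auto intro: finite_subset)
  then have "card R = card D + card U + card Y"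
    unfolding R_def using finD finU U(1) Y(1)
    by (subst card_Un_disjoint; (subst card_Un_disjoint)?; force)
  then have R: "R \<subseteq> {1..N}" "card R = Rr"
    using D U Y \<open>card D + X \<le> Rr\<close> by (auto simp: R_def)
  have fin: "finite (set_pmf ?p)"
    using ok unfolding update_ok_def by blast
  then have fin': "finite (set_pmf (after_update N \<sigma> D X))"
    by simp
  have c: "cond_ent (qary P) (after_update N \<sigma> D X) (\<lambda>(w, s). w) (\<lambda>(w, s). restrict s R) = 0"
    using ok' R unfolding state_ok_def by blast
  have dec: "u_msg' \<omega> = u_msg' \<omega>'"
    if "\<omega> \<in> set_pmf ?p" "\<omega>' \<in> set_pmf ?p" "restrict (u_sto' \<omega>) R = restrict (u_sto' \<omega>') R" for \<omega> \<omega>'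
    using cond_ent_eq_0_iff[OF fin' qary_gt_1, THEN iffD1, OF c, rule_format,
        of "(u_msg' \<omega>, u_sto' \<omega>)" "(u_msg' \<omega>', u_sto' \<omega>')"] that by simp
  \<comment> \<open>Recoverability compares new storages, which depend on the old state as well.
    Replaying both outcomes from one fixed old state leaves the uploads as the only
    difference.\<close>
  obtain w0 s0 where ws: "(w0, s0) \<in> set_pmf \<sigma>"
    using set_pmf_not_empty[of \<sigma>] by auto
  then have "w0 \<in> set_pmf (map_pmf fst \<sigma>)"
    by force
  then have w0: "w0 \<in> messages P"
    by (simp add: unif)
  obtain \<nu> where "map_pmf (\<lambda>\<omega>. (u_inc \<omega>, restrict (u_upl \<omega>) Y)) ?p = pair_pmf (uniform_message P) \<nu>"
    using secure_upload[OF ok, of Y] Y by (metis Diff_subset order_refl subset_trans)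
  then have "map_pmf (\<lambda>\<omega>. (u_inc \<omega>, restrict (u_upl \<omega>) Y)) ?p =
      pair_pmf (map_pmf u_inc ?p) (map_pmf (\<lambda>\<omega>. restrict (u_upl \<omega>) Y) ?p)"
    by (rule pair_pmf_eq_marginals)
  then have "ent (qary P) ?p u_inc \<le> ent (qary P) ?p (\<lambda>\<omega>. restrict (u_upl \<omega>) U)"
  proof (rule ent_le_of_decodable[OF fin qary_gt_1])
    fix \<omega> \<omega>' assume \<omega>: "\<omega> \<in> set_pmf ?p" "\<omega>' \<in> set_pmf ?p"
      and eq: "restrict (u_upl \<omega>) Y = restrict (u_upl \<omega>') Y" "restrict (u_upl \<omega>) U = restrict (u_upl \<omega>') U"
    have "u_upl \<omega> n = u_upl \<omega>' n" if "n \<in> R - D" for n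
      using fun_cong[OF eq(1), of n] fun_cong[OF eq(2), of n] that by (auto simp: R_def)
    then have upl: "restrict (u_upl \<omega>) (R - D) = restrict (u_upl \<omega>') (R - D)"
      by (rule restrict_ext)
    obtain \<omega>1 where \<omega>1: "\<omega>1 \<in> set_pmf ?p" "u_msg \<omega>1 = w0" "u_sto \<omega>1 = s0" "u_inc \<omega>1 = u_inc \<omega>" "u_upl \<omega>1 = u_upl \<omega>"
      using update_lawI[OF ws update_lawD(2,3)[OF \<omega>(1)]] by blast
    obtain \<omega>2 where \<omega>2: "\<omega>2 \<in> set_pmf ?p" "u_msg \<omega>2 = w0" "u_sto \<omega>2 = s0" "u_inc \<omega>2 = u_inc \<omega>'" "u_upl \<omega>2 = u_upl \<omega>'"
      using update_lawI[OF ws update_lawD(2,3)[OF \<omega>(2)]] by blast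
    have "restrict (u_sto' \<omega>1) R = restrict (u_sto' \<omega>2) R"
      by (rule update_ok_storage_cong[OF ok R(1) \<omega>1(1) \<omega>2(1)]) (simp_all only: \<omega>1 \<omega>2 upl)
    then have "u_msg' \<omega>1 = u_msg' \<omega>2"
      by (rule dec[OF \<omega>1(1) \<omega>2(1)])
    then have "msg_add P w0 (u_inc \<omega>) = msg_add P w0 (u_inc \<omega>')"
      using update_lawD(4)[OF \<omega>1(1)] update_lawD(4)[OF \<omega>2(1)] \<omega>1 \<omega>2 by simp
    then show "u_inc \<omega> = u_inc \<omega>'"
      by (rule msg_add_cancel[OF w0 update_lawD(2)[OF \<omega>(1)] update_lawD(2)[OF \<omega>(2)]])
  qed
  also have "\<dots> \<le> (\<Sum>n\<in>U. ent (qary P) ?p (\<lambda>\<omega>. u_upl \<omega> n))"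
    by (rule ent_restrict_le_sum[OF fin qary_gt_1 finU])
  finally show ?thesis
    using ent_uniform_message[OF fin update_law_inc] by simp
qed

end

lemma ex_subset_card_Diff_le:
  assumes "D \<subseteq> A" "finite A" "m \<le> card A" "m \<le> card D + X"
  obtains T where "T \<subseteq> A" "card T = m" "card (T - D) \<le> X"
proof (cases "m \<le> card D")
  case True
  then obtain T where "T \<subseteq> D" "card T = m"
    by (meson obtain_subset_with_card_n)
  moreover from this have "T - D = {}"
    by blast
  ultimately show ?thesis
    using that[of T] assms(1) by (metis card.empty le0 subset_trans)
next
  case False
  have finD: "finite D"
    using assms by (auto intro: finite_subset)
  have "m - card D \<le> card (A - D)"
    using assms finD by (simp add: card_Diff_subset)
  then obtain Y where Y: "Y \<subseteq> A - D" "card Y = m - card D"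
    by (meson obtain_subset_with_card_n)
  have "finite Y"
    using Y(1) assms(2) by (auto intro: finite_subset)
  then have "card (D \<union> Y) = m"
    using Y finD False by (subst card_Un_disjoint) auto
  moreover have "D \<union> Y - D = Y"
    using Y by auto
  ultimately show ?thesis
    using that[of "D \<union> Y"] Y assms(1,4) by (metis Un_least Diff_subset subset_trans add.commute le_diff_conv)
qed

section \<open>Bounds along a run of a scheme\<close>

locale rdcds_run = finite_field_scheme P for P :: "('f, 's, 'q, 'a) scheme" +
  fixes N Rr :: nat and Kc :: real and ops :: "nat \<Rightarrow> oper"
  assumes Kc: "0 < Kc" "Kc \<le> real Rr" and Rr: "Rr \<le> N"
    and rdcds: "rdcds N Rr Kc P" and adm: "admissible N P ops"
begin

abbreviation "state \<equiv> state_law N P ops"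

definition K :: nat where "K = nat \<lceil>Kc\<rceil>"

lemma ceiling_Kc: "\<lceil>Kc\<rceil> = int K"
  using Kc by (simp add: K_def)

lemma K_bounds: "0 < K" "K \<le> Rr" "real K - 1 < Kc"
  using Kc ceiling_Kc by linarith+

lemma state_ok: "state_ok N Rr Kc P (state t)"
  using rdcds adm unfolding rdcds_def by blast

lemma state_unif: "map_pmf fst (state t) = uniform_message P"
  using state_ok[of t] unfolding state_ok_def by blast

lemma len_pos: "len P \<ge> 1"
  using rdcds unfolding rdcds_def by blast

lemma slot_ok: "t \<ge> 1 \<Longrightarrow> slot_ok N P (state t) (ops t)"
  using rdcds adm unfolding rdcds_def by blast

lemma read_slot: "t \<ge> 1 \<Longrightarrow> ops t = Read D \<Longrightarrow> read_ok N P D (read_law N P (state t) D)"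
  using slot_ok[of t] by (simp add: slot_ok_def)

lemma update_slot: "t \<ge> 1 \<Longrightarrow> ops t = Update D X \<Longrightarrow> update_ok N P D X (update_law N P (state t) D X)"
  using slot_ok[of t] by (simp add: slot_ok_def)

lemma state_Suc_update: "t \<ge> 1 \<Longrightarrow> ops t = Update D X \<Longrightarrow> state (Suc t) = after_update N (state t) D X"
  by simp

lemma ops_wf: "t \<ge> 1 \<Longrightarrow> well_formed_oper N (ops t)"
  using adm by (simp add: admissible_def)

lemma hides_Suc:
  assumes "t \<ge> 1" "T \<subseteq> {1..N}" "hides T (state t)"
  shows "hides T (state (Suc t))"
proof (cases "ops t")
  case (Read D)
  then show ?thesis
    using assms by simp
next
  case (Update D X)
  then show ?thesis
    using hides_after_update[OF update_slot[OF assms(1) Update] assms(2,3)] assms(1)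
    by (simp only: state_Suc_update)
qed

lemma hides_mono:
  assumes "1 \<le> t" "t \<le> t'" "T \<subseteq> {1..N}" "hides T (state t)"
  shows "hides T (state t')"
  using assms(2)
proof (induction rule: dec_induct)
  case (step n)
  then show ?case
    using assms(1) by (intro hides_Suc assms(3)) auto
qed (rule assms(4))

lemma hides_after_slot:
  assumes "t \<ge> 1" "ops t = Update D X" "T \<subseteq> {1..N}" "card (T - D) \<le> X" "t < t'"
  shows "hides T (state t')"
proof (rule hides_mono[OF _ _ assms(3)])
  show "hides T (state (Suc t))"
    unfolding state_Suc_update[OF assms(1,2)]
    by (intro hides_after_secure_update update_slot assms state_unif)
qed (use assms in auto)

text \<open>Otherwise some set \<open>T\<close> of \<open>Rr - K + 1\<close> servers has at most
  \<open>X\<close> members outside \<open>D\<close>, and the update hides the message from it.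
  Completing \<open>T\<close> to \<open>Rr\<close> servers adds only \<open>K - 1\<close> more, and
  these hold at most \<open>(K - 1) / Kc < 1\<close> times the length of the message.\<close>

lemma update_available:
  assumes t: "t \<ge> 1" "ops t = Update D X"
  shows "card D + X + K \<le> Rr"
proof (rule ccontr)
  assume contr: "\<not> card D + X + K \<le> Rr"
  have D: "D \<subseteq> {1..N}"
    using ops_wf[OF t(1)] t(2) by simp
  obtain T where T: "T \<subseteq> {1..N}" "card T = Rr - K + 1" "card (T - D) \<le> X"
    using contr K_bounds Rr by (auto intro: ex_subset_card_Diff_le[OF D, of "Rr - K + 1" X])
  then have "finite T"
    by (auto intro: finite_subset)
  have "K - 1 \<le> card ({1..N} - T)"
    using T \<open>finite T\<close> K_bounds Rr by (simp add: card_Diff_subset)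
  then obtain V where V: "V \<subseteq> {1..N} - T" "card V = K - 1"
    by (meson obtain_subset_with_card_n)
  then have "finite V"
    by (auto intro: finite_subset)
  moreover have "T \<inter> V = {}"
    using V(1) by blast
  ultimately have "card (T \<union> V) = Rr"
    using T(2) V(2) \<open>finite T\<close> K_bounds(1,2) by (simp add: card_Un_disjoint)
  then have R: "T \<union> V \<subseteq> {1..N}" "card (T \<union> V) = Rr" "T \<union> V - T = V"
    using T(1) V(1) by auto
  have "hides T (state (Suc t))"
    by (rule hides_after_slot[OF t T(1,3)]) simp
  then have "len P \<le> (\<Sum>n\<in>V. ent (qary P) (state (Suc t)) (\<lambda>(w, s). s n))"
    using len_le_sum_storage[OF state_ok _ _ R(1,2), of T] unfolding R(3) by blast
  also have "\<dots> \<le> (\<Sum>n\<in>V. len P / Kc)"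
    using state_ok[of "Suc t"] V(1) unfolding state_ok_def by (intro sum_mono) blast
  also have "\<dots> = (real K - 1) * len P / Kc"
    using V(2) K_bounds(1) by (simp add: of_nat_diff)
  also have "\<dots> < len P"
    using K_bounds(3) Kc(1) len_pos by (simp add: divide_less_eq)
  finally show False
    by simp
qed

lemma upload_cost_ge:
  assumes t: "t \<ge> 1" "ops t = Update D X"
  shows "upload_cost N P ops t D X \<ge> (real N - card D) / (real Rr - real X - card D)"
proof -
  have D: "D \<subseteq> {1..N}" "finite D"
    using ops_wf[OF t(1)] t(2) by (auto intro: finite_subset)
  have av: "card D + X + K \<le> Rr"
    by (rule update_available[OF t])
  define k where "k = Rr - X - card D"
  let ?h = "\<lambda>n. ent (qary P) (update_law N P (state t) D X) (\<lambda>\<omega>. u_upl \<omega> n)"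
  have card: "card ({1..N} - D) = N - card D" and "card D \<le> N"
    using D card_mono[OF _ D(1)] by (simp_all add: card_Diff_subset)
  have "card ({1..N} - D) * real (len P) \<le> k * sum ?h ({1..N} - D)"
  proof (rule averaging_bound)
    show "k \<le> card ({1..N} - D)" "0 < k"
      using av Rr K_bounds(1) unfolding card k_def by simp_all
    fix U assume "U \<subseteq> {1..N} - D" "card U = k"
    then show "len P \<le> sum ?h U"
      using len_le_sum_uploads[OF update_slot[OF t] _ state_unif D(1) Rr, of Kc U] av
        state_ok[of "Suc t"] unfolding state_Suc_update[OF t] k_def by simp
  qed simp
  moreover have "real k = real Rr - real X - card D" "0 < k" "real (N - card D) = real N - card D"
    using av K_bounds(1) \<open>card D \<le> N\<close> by (simp_all add: k_def of_nat_diff)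
  ultimately show ?thesis
    using len_pos unfolding upload_cost_def card by (simp add: field_simps)
qed

text \<open>Hiding is an assumption here because it has two sources: an earlier update in the steady
  state, and the invariance of the state law for the code.\<close>

lemma download_cost_ge:
  assumes t: "t \<ge> 1" "ops t = Read D"
    and hid: "\<And>T. T \<subseteq> {1..N} \<Longrightarrow> card T = Rr - K \<Longrightarrow> hides T (state t)"
  shows "download_cost N P ops t D \<ge> (real N - card D) / (real N - real Rr + K - card D)"
proof -
  have D: "D \<subseteq> {1..N}" "finite D"
    using ops_wf[OF t(1)] t(2) by (auto intro: finite_subset)
  let ?h = "\<lambda>n. ent (qary P) (read_law N P (state t) D) (\<lambda>\<omega>. r_ans \<omega> n)"
  let ?A = "{1..N} - D"
  have card: "card ?A = N - card D" and "card D \<le> N"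
    using D card_mono[OF _ D(1)] by (simp_all add: card_Diff_subset)
  have bound: "len P \<le> sum ?h (?A - T)" if "T \<subseteq> {1..N}" "card T = Rr - K" for T
    by (rule len_le_sum_answers[OF read_slot[OF t] state_unif that(1) hid[OF that]])
  \<comment> \<open>Otherwise all available servers lie in a single hidden set \<open>T\<close>, and
    \<open>bound\<close> leaves nobody to deliver the message. This also makes the denominator
    positive.\<close>
  have gt: "Rr - K < N - card D"
  proof (rule ccontr)
    assume "\<not> Rr - K < N - card D"
    then have "card ?A \<le> Rr - K" "Rr - K \<le> card {1..N}"
      unfolding card using Rr by simp_all
    then obtain T where T: "?A \<subseteq> T" "T \<subseteq> {1..N}" "card T = Rr - K"
      using exists_subset_between[OF _ _ Diff_subset finite_atLeastAtMost] by metis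
    then have "?A - T = {}"
      by blast
    then show False
      using bound[OF T(2,3)] len_pos by (simp only: sum.empty)
  qed
  define k where "k = N - card D - (Rr - K)"
  have "card ?A * real (len P) \<le> k * sum ?h ?A"
  proof (rule averaging_bound)
    show "k \<le> card ?A" "0 < k"
      using gt unfolding card k_def by simp_all
    fix U assume U: "U \<subseteq> ?A" "card U = k"
    \<comment> \<open>The available servers outside \<open>U\<close> form the hidden set.\<close>
    then have "card (?A - U) = Rr - K"
      using gt finite_subset[OF U(1)] by (simp only: card_Diff_subset card k_def finite_Diff finite_atLeastAtMost) simp
    moreover have "?A - (?A - U) = U"
      using U by blast
    moreover have "?A - U \<subseteq> {1..N}"
      by blast
    ultimately show "len P \<le> sum ?h U"
      using bound[of "?A - U"] by simp
  qed simp
  moreover have "real k = real N - real Rr + K - card D" "0 < k" "real (N - card D) = real N - card D"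
    using gt K_bounds \<open>card D \<le> N\<close> by (simp_all add: k_def of_nat_diff)
  ultimately show ?thesis
    using len_pos unfolding download_cost_def card by (simp add: field_simps)
qed

text \<open>As \<open>D\<close> lies in \<open>T\<close>, the security level
  \<open>card T - card D\<close> is the number of servers of \<open>T\<close> that receive an
  upload.\<close>

lemma hides_steady_state:
  assumes "steady_state N Rr Kc ops t0" "t0 < t" "T \<subseteq> {1..N}" "card T = Rr - K"
  shows "hides T (state t)"
proof -
  have "int (card T) = int Rr - \<lceil>Kc\<rceil>"
    using assms(4) K_bounds by (simp add: ceiling_Kc of_nat_diff)
  then obtain t' D where t': "t' \<in> {1..t0}" "D \<subseteq> T" "ops t' = Update D (card T - card D)"
    using assms(1,3) unfolding steady_state_def by blast
  have "finite T"
    using assms(3) by (auto intro: finite_subset)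
  then have "card (T - D) \<le> card T - card D"
    using t'(2) by (simp add: card_Diff_subset finite_subset)
  then show ?thesis
    using t' assms by (intro hides_after_slot[of t' D "card T - card D"]) auto
qed

text \<open>The threshold is a minimum over all supported dropout sets, not only the one of slot
  \<open>t\<close>; the latter ensures that the minimum is attained.\<close>

lemma update_threshold_ge:
  assumes t: "t \<ge> 1" "ops t = Update D X"
  shows "N - Rr + K + X \<le> update_threshold N P X"
proof -
  have "D \<subseteq> {1..N}" "X \<le> N" "admits P (Update D X)"
    using ops_wf[OF t(1)] t adm unfolding admissible_def by (fastforce, simp, metis)
  then have "\<exists>m. \<exists>D\<subseteq>{1..N}. admits P (Update D X) \<and> m = N - card D"
    by blast
  from LeastI_ex[OF this] obtain D' where D': "D' \<subseteq> {1..N}" "admits P (Update D' X)"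
      "update_threshold N P X = N - card D'"
    unfolding update_threshold_def by blast
  \<comment> \<open>Admissibility is a slotwise condition, so a minimising dropout set may be
    substituted at slot \<open>t\<close>.\<close>
  interpret alt: rdcds_run P N Rr Kc "ops(t := Update D' X)"
  proof unfold_locales
    show "admissible N P (ops(t := Update D' X))"
      using adm D'(1,2) \<open>X \<le> N\<close> unfolding admissible_def by simp
  qed (fact Kc Rr rdcds)+
  have "card D' + X + alt.K \<le> Rr"
    by (rule alt.update_available[OF t(1)]) simp
  then show ?thesis
    using D'(3) K_bounds Rr unfolding alt.K_def K_def by simp
qed

end

theorem converse:
  fixes P :: "('f, 's, 'q, 'a) scheme"
  assumes Kc: "0 < Kc" "Kc \<le> real Rr" and Rr: "Rr \<le> N"
    and P: "rdcds N Rr Kc P" and adm: "admissible N P ops"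
    and steady: "steady_state N Rr Kc ops t0" "t0 < t"
  shows "ops t = Read D \<Longrightarrow> download_cost N P ops t D
      \<ge> (real N - card D) / (real N - real Rr + \<lceil>Kc\<rceil> - card D)"
    and "ops t = Update D X \<Longrightarrow> int (update_threshold N P X) \<ge> int N - int Rr + \<lceil>Kc\<rceil> + int X"
    and "ops t = Update D X \<Longrightarrow> upload_cost N P ops t D X
      \<ge> (real N - card D) / (real Rr - real X - card D)"
proof -
  interpret rdcds_run P N Rr Kc ops
  proof (intro rdcds_run.intro finite_field_scheme.intro rdcds_run_axioms.intro)
    show "field (base P)" "finite (carrier (base P))"
      using P unfolding rdcds_def by blast+
  qed (fact Kc Rr P adm)+
  have t: "t \<ge> 1"
    using steady by (simp add: steady_state_def)
  show "download_cost N P ops t D \<ge> (real N - card D) / (real N - real Rr + \<lceil>Kc\<rceil> - card D)"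
    if "ops t = Read D"
    using download_cost_ge[OF t that hides_steady_state[OF steady]] by (simp add: ceiling_Kc)
  show "int (update_threshold N P X) \<ge> int N - int Rr + \<lceil>Kc\<rceil> + int X" if "ops t = Update D X"
    using update_threshold_ge[OF t that] Rr by (simp add: ceiling_Kc)
  show "upload_cost N P ops t D X \<ge> (real N - card D) / (real Rr - real X - card D)" if "ops t = Update D X"
    by (rule upload_cost_ge[OF t that])
qed

section \<open>Polynomials modulo a prime\<close>

text \<open>Polynomials are kept over the integers and compared modulo \<open>p\<close>; the points
  of a separated set remain distinct as residues.\<close>

definition separated :: "nat \<Rightarrow> int set \<Rightarrow> bool" where
  "separated p S \<longleftrightarrow> finite S \<and> (\<forall>x\<in>S. \<forall>y\<in>S. [x = y] (mod int p) \<longrightarrow> x = y)"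

lemma separated_insertD:
  assumes "separated p (insert a S)" "a \<notin> S"
  shows "separated p S" "\<And>x. x \<in> S \<Longrightarrow> \<not> int p dvd x - a"
  using assms by (auto simp: separated_def cong_iff_dvd_diff)

lemma separated_of_range:
  assumes "finite S" "S \<subseteq> {0..<int p}"
  shows "separated p S"
  unfolding separated_def using assms by (auto simp: cong_def subset_iff)

text \<open>A polynomial with more roots than its degree vanishes modulo a prime. Synthetic division
  splits off the root \<open>a\<close>; since \<open>p\<close> is prime and does not divide
  \<open>x - a\<close>, the other points are roots of the quotient.\<close>

lemma poly_dvd_of_roots:
  fixes P :: "int poly"
  assumes p: "prime p" and "separated p S" "degree P < card S"
    and "\<And>x. x \<in> S \<Longrightarrow> int p dvd poly P x"
  shows "int p dvd poly P y"
proof -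
  have "finite S"
    using assms(2) by (simp add: separated_def)
  then show ?thesis
    using assms(2-4)
  proof (induction S arbitrary: P y rule: finite_induct)
    case empty
    then show ?case by simp
  next
    case (insert a S)
    define Q where "Q = synthetic_div P a"
    have P: "poly P z = (z - a) * poly Q z + poly P a" for z
      using arg_cong[OF synthetic_div_correct'[of a P], of "\<lambda>P. poly P z"] unfolding Q_def
      by (simp add: algebra_simps)
    have a: "int p dvd poly P a"
      using insert.prems(3) by simp
    show ?case
    \<comment> \<open>The quotient of a constant again has degree 0, which need not be less than
      \<open>card S\<close>, so the induction hypothesis is reserved for positive degree.\<close>
    proof (cases "degree P = 0")
      case True
      then obtain c where "P = [:c:]"
        by (rule degree_eq_zeroE)
      with a show ?thesis by simp
    next
      case False
      have "int p dvd poly Q y" for y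
      proof (rule insert.IH)
        show "separated p S"
          using separated_insertD[OF insert.prems(1) insert.hyps(2)] by blast
        show "degree Q < card S"
          using insert.prems(2) insert.hyps False by (simp add: Q_def degree_synthetic_div)
        fix x assume x: "x \<in> S"
        have "int p dvd (x - a) * poly Q x"
          using insert.prems(3)[of x] x a P[of x] by (simp add: dvd_add_left_iff)
        then show "int p dvd poly Q x"
          using p separated_insertD(2)[OF insert.prems(1) insert.hyps(2) x] by (simp add: prime_dvd_mult_iff)
      qed
      then show ?thesis
        using a unfolding P[of y] by simp
    qed
  qed
qed

lemma not_dvd_prod_diff:
  fixes a :: int
  assumes "prime p" "finite A" "\<And>x. x \<in> A \<Longrightarrow> \<not> int p dvd a - f x"
  shows "\<not> int p dvd (\<Prod>x\<in>A. a - f x)"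
  using assms by (simp add: prime_dvd_prod_iff)

lemma ex_cong_mult:
  assumes "prime p" "\<not> int p dvd c"
  shows "\<exists>z. [c * z = v] (mod int p)"
proof -
  have "coprime c (int p)"
    using assms by (metis coprime_commute prime_imp_coprime prime_nat_int_transfer)
  then obtain z where "[c * z = 1] (mod int p)"
    using cong_solve_coprime_int by blast
  then have "[c * z * v = 1 * v] (mod int p)"
    by (rule cong_scalar_right)
  then show ?thesis
    by (intro exI[of _ "z * v"]) (simp add: mult_ac)
qed

lemma degree_prod_linear:
  fixes f :: "'i \<Rightarrow> int"
  assumes "finite A"
  shows "degree (\<Prod>x\<in>A. [:- f x, 1:]) = card A"
  using assms by (subst degree_prod_eq_sum_degree) auto

lemma poly_prod_linear:
  fixes f :: "'i \<Rightarrow> int"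
  shows "poly (\<Prod>x\<in>A. [:- f x, 1:]) y = (\<Prod>x\<in>A. y - f x)"
  by (simp add: poly_prod)

text \<open>Newton interpolation: a multiple of the product of all \<open>y - x\<close> with
  \<open>x \<in> S\<close> corrects the value at the new point and leaves the values on
  \<open>S\<close> alone. The factor is found by inverting that product at the new point modulo
  \<open>p\<close>.\<close>

lemma ex_interpolation:
  assumes p: "prime p" and "separated p S" "card S \<le> d" "0 < d"
  obtains P :: "int poly" where "degree P < d" "\<And>x. x \<in> S \<Longrightarrow> [poly P x = v x] (mod int p)"
proof -
  have "finite S"
    using assms(2) by (simp add: separated_def)
  then have "\<exists>P :: int poly. degree P < d \<and> (\<forall>x\<in>S. [poly P x = v x] (mod int p))"
    using assms(2,3)
  proof (induction S rule: finite_induct)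
    case empty
    then show ?case
      using \<open>0 < d\<close> by (intro exI[of _ 0]) simp
  next
    case (insert a S)
    have sep: "separated p S"
      using separated_insertD[OF insert.prems(1) insert.hyps(2)] by blast
    then obtain P :: "int poly" where P: "degree P < d" "\<forall>x\<in>S. [poly P x = v x] (mod int p)"
      using insert by auto
    have "\<not> int p dvd a - x" if "x \<in> S" for x
      using separated_insertD(2)[OF insert.prems(1) insert.hyps(2) that] by (simp add: dvd_diff_commute)
    then have "\<not> int p dvd (\<Prod>x\<in>S. a - x)"
      using not_dvd_prod_diff[OF p insert.hyps(1), of a "\<lambda>x. x"] by blast
    then obtain z where z: "[(\<Prod>x\<in>S. a - x) * z = v a - poly P a] (mod int p)"
      using ex_cong_mult[OF p] by blast
    define Z where "Z = [:z:] * (\<Prod>x\<in>S. [:- x, 1:])"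
    have Z: "poly Z y = z * (\<Prod>x\<in>S. y - x)" for y
      by (simp add: Z_def poly_prod_linear)
    have "degree Z \<le> card S"
      unfolding Z_def using degree_mult_le[of "[:z:]" "\<Prod>x\<in>S. [:- x, 1:]"]
      degree_prod_linear[OF insert.hyps(1), of "\<lambda>x. x"] by simp
    then have "degree (P + Z) < d"
      using P(1) insert.prems(2) insert.hyps by (intro degree_add_less) auto
    moreover have "[poly (P + Z) x = v x] (mod int p)" if "x \<in> S" for x
    proof -
      have "(\<Prod>y\<in>S. x - y) = 0"
        using that insert.hyps(1) by (intro prod_zero) auto
      then show ?thesis
        using P(2) that by (simp add: Z)
    qed
    moreover have "[poly (P + Z) a = v a] (mod int p)"
      using cong_add[OF cong_refl[of "poly P a"] z] by (simp add: Z mult_ac)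
    ultimately show ?case
      by (intro exI[of _ "P + Z"]) simp
  qed
  then show ?thesis
    using that by blast
qed

text \<open>Combining the equations with the coefficients of a Lagrange polynomial isolates one unknown.\<close>

lemma vandermonde_transpose_injective:
  fixes x y :: "'i \<Rightarrow> int"
  assumes p: "prime p" and S: "finite S" "card S \<le> r" and sep: "\<And>i j. i \<in> S \<Longrightarrow> j \<in> S \<Longrightarrow> i \<noteq> j \<Longrightarrow> \<not> int p dvd x i - x j"
    and zero: "\<And>a. a < r \<Longrightarrow> int p dvd (\<Sum>i\<in>S. x i ^ a * y i)" and j: "j \<in> S"
  shows "int p dvd y j"
proof -
  define L where "L = (\<Prod>i\<in>S - {j}. [:- x i, 1:])"
  have "degree L < r"
    using S j degree_prod_linear[of "S - {j}" x] card_gt_0_iff[of S] unfolding L_def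
    by (metis Suc_pred' card_Diff_singleton empty_iff finite_Diff less_eq_Suc_le)
  have "int p dvd (\<Sum>i\<in>S. poly L (x i) * y i)"
  proof -
    have "(\<Sum>i\<in>S. poly L (x i) * y i) = (\<Sum>i\<in>S. \<Sum>a\<le>degree L. Polynomial.coeff L a * (x i ^ a * y i))"
      by (simp add: poly_altdef sum_distrib_right mult.assoc)
    also have "\<dots> = (\<Sum>a\<le>degree L. Polynomial.coeff L a * (\<Sum>i\<in>S. x i ^ a * y i))"
      by (subst sum.swap) (simp add: sum_distrib_left)
    also have "int p dvd \<dots>"
      by (rule dvd_sum, rule dvd_mult, rule zero) (use \<open>degree L < r\<close> in auto)
    finally show ?thesis .
  qed
  also have "(\<Sum>i\<in>S. poly L (x i) * y i) = poly L (x j) * y j"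
  proof -
    have "poly L (x i) = 0" if "i \<in> S - {j}" for i
      using that S(1) unfolding L_def by (auto simp: poly_prod_linear prod_zero_iff)
    then have "(\<Sum>i\<in>S. poly L (x i) * y i) = (\<Sum>i\<in>{j}. poly L (x i) * y i)"
      using S(1) j by (intro sum.mono_neutral_right) auto
    then show ?thesis by simp
  qed
  finally have "int p dvd poly L (x j) * y j" .
  moreover have "\<not> int p dvd poly L (x j)"
    unfolding L_def poly_prod_linear using sep j S(1) by (intro not_dvd_prod_diff[OF p]) auto
  ultimately show ?thesis
    using p by (simp add: prime_dvd_mult_iff)
qed

section \<open>Uniform laws on images of polynomial families\<close>

definition families :: "nat \<Rightarrow> ('i \<Rightarrow> int poly) set" where
  "families d = {u. \<forall>i. degree (u i) < d}"

definition fadd :: "('i \<Rightarrow> int poly) \<Rightarrow> ('i \<Rightarrow> int poly) \<Rightarrow> 'i \<Rightarrow> int poly" where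
  "fadd u w = (\<lambda>i. u i + w i)"

lemma fadd_families: "u \<in> families d \<Longrightarrow> w \<in> families d \<Longrightarrow> fadd u w \<in> families d"
  by (auto simp: families_def fadd_def intro: degree_add_less)

lemma families_nonempty: "0 < d \<Longrightarrow> families d \<noteq> {}"
  by (auto simp: families_def intro!: exI[of _ "\<lambda>_. 0"])

lemma ex_fadd_eq:
  assumes "u \<in> families d" "v \<in> families d"
  obtains w where "w \<in> families d" "fadd u w = v"
proof
  show "(\<lambda>i. v i - u i) \<in> families d"
    using assms by (auto simp: families_def intro: degree_diff_less)
qed (simp add: fadd_def)

text \<open>The property of an additive map that is needed, stated without an addition on the
  codomain: whether two families have the same image is unaffected by adding a third to
  both.\<close>

definition translatable :: "nat \<Rightarrow> (('i \<Rightarrow> int poly) \<Rightarrow> 'x) \<Rightarrow> bool" where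
  "translatable d g \<longleftrightarrow> (\<forall>u\<in>families d. \<forall>v\<in>families d. \<forall>w\<in>families d. g (fadd u w) = g (fadd v w) \<longleftrightarrow> g u = g v)"

text \<open>Translation by \<open>w\<close> descends to the image of \<open>g\<close>, where it is
  injective and hence a permutation of a finite set.\<close>

lemma map_translate_pmf_of_set:
  assumes g: "translatable d g" and fin: "finite (g ` families d)" and d: "0 < d"
    and w: "w \<in> families d" and \<tau>: "\<And>u. u \<in> families d \<Longrightarrow> \<tau> (g u) = g (fadd u w)"
  shows "map_pmf \<tau> (pmf_of_set (g ` families d)) = pmf_of_set (g ` families d)"
proof (rule map_pmf_of_set_bij_betw)
  have "inj_on \<tau> (g ` families d)"
    using g w by (auto intro!: inj_onI simp: \<tau> translatable_def)
  moreover have "\<tau> ` g ` families d \<subseteq> g ` families d"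
    using w by (auto simp: \<tau> intro: fadd_families)
  ultimately show "bij_betw \<tau> (g ` families d) (g ` families d)"
    using fin by (simp add: bij_betw_def endo_inj_surj)
qed (use fin d families_nonempty in auto)

lemma pmf_of_set_eqI:
  assumes fin: "finite (set_pmf q)" and const: "\<And>x y. x \<in> set_pmf q \<Longrightarrow> y \<in> set_pmf q \<Longrightarrow> pmf q x = pmf q y"
  shows "q = pmf_of_set (set_pmf q)"
proof (rule pmf_eqI)
  fix x
  show "pmf q x = pmf (pmf_of_set (set_pmf q)) x"
  proof (cases "x \<in> set_pmf q")
    case True
    have "1 = (\<Sum>y\<in>set_pmf q. pmf q y)"
      using fin by (intro sum_pmf_eq_1[symmetric]) auto
    also have "\<dots> = (\<Sum>y\<in>set_pmf q. pmf q x)"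
      using True by (intro sum.cong refl const)
    finally have "1 = card (set_pmf q) * pmf q x"
      by simp
    then show ?thesis
      using True fin set_pmf_not_empty[of q] by (simp add: field_simps card_gt_0_iff)
  next
    case False
    then show ?thesis
      using fin set_pmf_not_empty[of q] by (simp add: set_pmf_iff)
  qed
qed

text \<open>Translations permute the fibres of \<open>\<phi>\<close> transitively, so all fibres are equally likely.\<close>

lemma map_pmf_of_set_families:
  assumes g: "translatable d g" and \<phi>: "translatable d (\<phi> \<circ> g)" and fin: "finite (g ` families d)" and d: "0 < d"
  shows "map_pmf \<phi> (pmf_of_set (g ` families d)) = pmf_of_set (\<phi> ` g ` families d)"
proof -
  let ?A = "g ` families d"
  let ?p = "pmf_of_set ?A"
  have set_p: "set_pmf ?p = ?A"
    using fin families_nonempty[OF d] by (intro set_pmf_of_set) simp_all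
  have "map_pmf \<phi> ?p = pmf_of_set (set_pmf (map_pmf \<phi> ?p))"
  proof (rule pmf_of_set_eqI)
    show "finite (set_pmf (map_pmf \<phi> ?p))"
      using fin by (simp add: set_p)
    fix b1 b2 assume "b1 \<in> set_pmf (map_pmf \<phi> ?p)" "b2 \<in> set_pmf (map_pmf \<phi> ?p)"
    then obtain u1 u2 where u: "u1 \<in> families d" "u2 \<in> families d" "b1 = \<phi> (g u1)" "b2 = \<phi> (g u2)"
      by (auto simp: set_p)
    obtain w where w: "w \<in> families d" "fadd u1 w = u2"
      using ex_fadd_eq[OF u(1,2)] .
    \<comment> \<open>Translation by \<open>w\<close> on the image of \<open>g\<close>. The choice
      of the preimage is immaterial since \<open>g\<close> is translatable.\<close>
    define \<tau> where "\<tau> a = g (fadd (SOME u. u \<in> families d \<and> g u = a) w)" for a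
    have \<tau>: "\<tau> (g u) = g (fadd u w)" if "u \<in> families d" for u
    proof -
      have "(SOME v. v \<in> families d \<and> g v = g u) \<in> families d \<and> g (SOME v. v \<in> families d \<and> g v = g u) = g u"
        by (rule someI[of _ u]) (use that in simp)
      then show ?thesis
        unfolding \<tau>_def using g that w(1) unfolding translatable_def by blast
    qed
    have "pmf (map_pmf \<phi> ?p) b2 = pmf (map_pmf \<phi> (map_pmf \<tau> ?p)) b2"
      using map_translate_pmf_of_set[OF g fin d w(1) \<tau>] by simp
    also have "\<dots> = measure ?p ((\<lambda>a. \<phi> (\<tau> a)) -` {b2} \<inter> set_pmf ?p)"
      by (simp add: pmf.map_comp o_def pmf_map measure_Int_set_pmf)
    also have "(\<lambda>a. \<phi> (\<tau> a)) -` {b2} \<inter> set_pmf ?p = \<phi> -` {b1} \<inter> set_pmf ?p"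
      using \<phi> u w unfolding set_p translatable_def by (auto simp: \<tau>)
    also have "measure ?p \<dots> = pmf (map_pmf \<phi> ?p) b1"
      by (simp add: pmf_map measure_Int_set_pmf)
    finally show "pmf (map_pmf \<phi> ?p) b1 = pmf (map_pmf \<phi> ?p) b2" ..
  qed
  then show ?thesis
    by (simp only: set_map_pmf set_p)
qed

text \<open>Disintegration along \<open>\<phi>\<close>. With \<open>\<phi> = fst\<close> it allows
  \<open>upload\<close> to be defined by conditioning a joint law on the increment.\<close>

lemma bind_cond_pmf_fibres:
  "bind_pmf (map_pmf \<phi> p) (\<lambda>b. cond_pmf p {a. \<phi> a = b}) = p"
proof (rule bind_cond_pmf_cancel)
  show "measure p {a. \<phi> a = b} = measure (map_pmf \<phi> p) {b. \<phi> a = b}"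
    if "\<phi> a = b" for a b
    using that by (auto simp: vimage_def intro!: arg_cong[of _ _ "measure p"])
qed auto

section \<open>The code\<close>

text \<open>Storage, uploads and answers are lists, which are easily counted; \<open>entry\<close>
  reads them back by row, point or channel.\<close>

definition entry :: "'i list \<Rightarrow> 'v list \<Rightarrow> 'i \<Rightarrow> 'v" where
  "entry l v i = the (map_of (zip l v) i)"

lemma entry_map [simp]: "i \<in> set l \<Longrightarrow> entry l (map h l) i = h i"
  by (simp add: entry_def map_of_zip_map)

lemma map_entry:
  assumes "distinct l" "length v = length l"
  shows "map (entry l v) l = v"
  using assms by (intro nth_equalityI) (simp_all add: entry_def map_of_zip_nth)

text \<open>
  Server \<open>n\<close> is the evaluation point \<open>n\<close>, and \<open>pts \<rho>\<close> are the secret points of the row \<open>\<rho>\<close>. For every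
  \<open>e\<close> between \<open>K\<close> and \<open>N\<close>, the rows are grouped by \<open>key e\<close>; the rows with key \<open>\<kappa>\<close> have their secret
  points in the set \<open>pool e \<kappa>\<close> of size \<open>e\<close>, each point of which belongs to exactly \<open>reps e\<close> of them.
  The values of \<open>x\<close> serve as nodes of Vandermonde systems.
\<close>

locale mds_code =
  fixes N R K p :: nat and rows :: "'r list" and pts :: "'r \<Rightarrow> nat set"
    and key :: "nat \<Rightarrow> 'r \<Rightarrow> 'k" and pool :: "nat \<Rightarrow> 'k \<Rightarrow> nat set" and reps :: "nat \<Rightarrow> nat"
    and x :: "'r \<Rightarrow> int"
  assumes dims: "0 < K" "K \<le> R" "R \<le> N" and p: "prime p"
    and distinct_rows: "distinct rows" and rows_nonempty: "rows \<noteq> []"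
    and card_pts: "\<And>\<rho>. \<rho> \<in> set rows \<Longrightarrow> card (pts \<rho>) = K"
    and pool: "\<And>e \<rho>. K \<le> e \<Longrightarrow> e \<le> N \<Longrightarrow> \<rho> \<in> set rows \<Longrightarrow> pool e (key e \<rho>) \<subseteq> {N<..<p}"
    and card_pool: "\<And>e \<rho>. K \<le> e \<Longrightarrow> e \<le> N \<Longrightarrow> \<rho> \<in> set rows \<Longrightarrow> card (pool e (key e \<rho>)) = e"
    and pts_pool: "\<And>e \<rho>. K \<le> e \<Longrightarrow> e \<le> N \<Longrightarrow> \<rho> \<in> set rows \<Longrightarrow> pts \<rho> \<subseteq> pool e (key e \<rho>)"
    and star: "\<And>e \<rho> f. K \<le> e \<Longrightarrow> e \<le> N \<Longrightarrow> \<rho> \<in> set rows \<Longrightarrow> f \<in> pool e (key e \<rho>) \<Longrightarrow>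
      card {\<rho>' \<in> set rows. key e \<rho>' = key e \<rho> \<and> f \<in> pts \<rho>'} = reps e"
    and x_inj: "inj_on x (set rows)" and x_range: "x ` set rows \<subseteq> {0..<int p}"
begin

definition ev :: "int poly \<Rightarrow> nat \<Rightarrow> int" where
  "ev u y = poly u (int y) mod int p"

definition idx :: "('r \<times> nat) list" where
  "idx = (SOME l. set l = Sigma (set rows) pts \<and> distinct l)"

definition channels :: "nat \<Rightarrow> ('k \<times> nat) list" where
  "channels e = (SOME l. set l = key e ` set rows \<times> {..<reps e} \<and> distinct l)"

text \<open>The default \<open>[]\<close> outside the servers keeps the set of codewords finite and
  reduces their equality to values at secret points and servers.\<close>

definition codeword :: "('r \<Rightarrow> int poly) \<Rightarrow> int list \<times> (nat \<Rightarrow> int list)" where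
  "codeword u = (map (\<lambda>(\<rho>, f). ev (u \<rho>) f) idx, \<lambda>n. if n \<in> {1..N} then map (\<lambda>\<rho>. ev (u \<rho>) n) rows else [])"

definition cover :: "nat \<Rightarrow> 'r \<Rightarrow> int poly" where
  "cover e \<rho> = (\<Prod>f\<in>pool e (key e \<rho>) - pts \<rho>. [:- int f, 1:])"

definition mix :: "nat \<Rightarrow> ('r \<Rightarrow> int poly) \<Rightarrow> 'k \<times> nat \<Rightarrow> int poly" where
  "mix e u = (\<lambda>(\<kappa>, a). \<Sum>\<rho> | \<rho> \<in> set rows \<and> key e \<rho> = \<kappa>. [:x \<rho> ^ a:] * cover e \<rho> * u \<rho>)"

text \<open>A cover has degree \<open>e - K\<close>, so a mix has degree less than
  \<open>e + R - K\<close>. The chosen \<open>e\<close> makes this bound equal to the number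
  \<open>N - card D\<close> of available servers.\<close>

definition answer_fn :: "nat set \<Rightarrow> nat \<Rightarrow> int list \<Rightarrow> int list" where
  "answer_fn D n s = (let e = N + K - R - card D in
     map (\<lambda>(\<kappa>, a). (\<Sum>\<rho> | \<rho> \<in> set rows \<and> key e \<rho> = \<kappa>. x \<rho> ^ a * poly (cover e \<rho>) (int n) * entry rows s \<rho>) mod int p)
       (channels e))"

definition shift :: "nat set \<Rightarrow> int poly" where
  "shift D = (\<Prod>m\<in>D. [:- int m, 1:])"

text \<open>At a fixed point the sum is a polynomial in the node \<open>x \<rho>\<close> whose
  coefficients are the channel values at that point. This is the transpose of the system that occurs
  in \<open>mix\<close>.\<close>

definition delta :: "nat set \<Rightarrow> nat \<Rightarrow> ('k \<times> nat \<Rightarrow> int poly) \<Rightarrow> 'r \<Rightarrow> int poly" where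
  "delta D e v \<rho> = shift D * (\<Sum>b<reps e. [:x \<rho> ^ b:] * v (key e \<rho>, b))"

text \<open>\<open>e\<close> is what the degree bound \<open>R\<close> leaves after
  \<open>card D\<close> roots at the dropout servers and \<open>X\<close> degrees of freedom for
  security.\<close>

definition increment :: "nat set \<Rightarrow> nat \<Rightarrow> ('k \<times> nat \<Rightarrow> int poly) \<Rightarrow> int list \<times> (nat \<Rightarrow> int list)" where
  "increment D X v = (let e = R - X - card D in
     (map (\<lambda>(\<rho>, f). ev (delta D e v \<rho>) f) idx,
      \<lambda>n. if n \<in> {1..N} - D then map (\<lambda>i. ev (v i) n) (channels e) else []))"

definition store_fn :: "nat set \<Rightarrow> nat \<Rightarrow> nat \<Rightarrow> int list \<Rightarrow> int list \<Rightarrow> int list" where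
  "store_fn D X n s q = (let e = R - X - card D in
     map (\<lambda>\<rho>. (entry rows s \<rho> + poly (shift D) (int n) * (\<Sum>b<reps e. x \<rho> ^ b * entry (channels e) q (key e \<rho>, b))) mod int p)
       rows)"

lemma p_gt_1: "1 < p"
  using p by (rule prime_gt_1_nat)

lemma finite_pts: "\<rho> \<in> set rows \<Longrightarrow> finite (pts \<rho>)"
  using card_pts[of \<rho>] dims(1) by (intro card_ge_0_finite) simp

lemma finite_pool: "K \<le> e \<Longrightarrow> e \<le> N \<Longrightarrow> \<rho> \<in> set rows \<Longrightarrow> finite (pool e (key e \<rho>))"
  by (rule finite_subset[OF pool]) simp_all

lemma pts_range: "\<rho> \<in> set rows \<Longrightarrow> pts \<rho> \<subseteq> {N<..<p}"
  using pts_pool[of K \<rho>] pool[of K \<rho>] dims by auto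

lemma N_less_p: "N < p"
proof -
  obtain \<rho> where "\<rho> \<in> set rows"
    using rows_nonempty by (meson hd_in_set)
  then have "pts \<rho> \<noteq> {}" "pts \<rho> \<subseteq> {N<..<p}"
    using card_pts[of \<rho>] dims(1) pts_range by auto
  then show ?thesis
    by auto
qed

lemma set_idx: "set idx = Sigma (set rows) pts" and distinct_idx: "distinct idx"
proof -
  have "finite (Sigma (set rows) pts)"
    using finite_pts by auto
  then have "\<exists>l. set l = Sigma (set rows) pts \<and> distinct l"
    by (rule finite_distinct_list)
  from someI_ex[OF this] show "set idx = Sigma (set rows) pts" "distinct idx"
    unfolding idx_def by blast+
qed

lemma set_channels: "set (channels e) = key e ` set rows \<times> {..<reps e}"
  and distinct_channels: "distinct (channels e)"
proof -
  have "finite (key e ` set rows \<times> {..<reps e})"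
    by simp
  then have "\<exists>l. set l = key e ` set rows \<times> {..<reps e} \<and> distinct l"
    by (rule finite_distinct_list)
  from someI_ex[OF this] show "set (channels e) = key e ` set rows \<times> {..<reps e}" "distinct (channels e)"
    unfolding channels_def by blast+
qed

lemma length_idx: "length idx = length rows * K"
proof -
  have "length idx = card (Sigma (set rows) pts)"
    using distinct_card[OF distinct_idx] by (simp add: set_idx)
  also have "\<dots> = length rows * K"
    using finite_pts card_pts distinct_card[OF distinct_rows] by simp
  finally show ?thesis .
qed

text \<open>Double counting of the pairs (row, secret point) along the map \<open>(\<rho>, f) \<mapsto> (key e \<rho>, f)\<close>.\<close>

lemma length_channels:
  assumes e: "K \<le> e" "e \<le> N"
  shows "length (channels e) * e = length idx"
proof -
  let ?S = "Sigma (set rows) pts" and ?T = "Sigma (key e ` set rows) (pool e)"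
  let ?\<phi> = "\<lambda>(\<rho>, f). (key e \<rho>, f)"
  have finS: "finite ?S" and finT: "finite ?T"
    using finite_pts finite_pool[OF e] by auto
  have "card (pool e \<kappa>) = e" "finite (pool e \<kappa>)" if "\<kappa> \<in> key e ` set rows" for \<kappa>
    using that finite_pool[OF e] card_pool[OF e] by auto
  then have card_T: "card ?T = card (key e ` set rows) * e"
    by simp
  have fibre: "card {z \<in> ?S. ?\<phi> z = t} = reps e" if "t \<in> ?T" for t
  proof -
    obtain \<kappa> f where \<kappa>: "t = (\<kappa>, f)" "\<kappa> \<in> key e ` set rows" "f \<in> pool e \<kappa>"
      using \<open>t \<in> ?T\<close> by (rule SigmaE)
    then obtain \<rho> where t: "t = (key e \<rho>, f)" "\<rho> \<in> set rows" "f \<in> pool e (key e \<rho>)"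
      by blast
    have "{z \<in> ?S. ?\<phi> z = t} = (\<lambda>\<rho>'. (\<rho>', f)) ` {\<rho>' \<in> set rows. key e \<rho>' = key e \<rho> \<and> f \<in> pts \<rho>'}"
      by (auto simp: t(1))
    then show ?thesis
      using star[OF e t(2,3)] by (simp add: card_image inj_on_def)
  qed
  have "?\<phi> ` ?S \<subseteq> ?T"
    using pts_pool[OF e] by auto
  then have "(\<Sum>t\<in>?T. \<Sum>z\<in>{z \<in> ?S. ?\<phi> z = t}. 1) = (\<Sum>z\<in>?S. (1::nat))"
    by (rule sum.group[OF finS finT])
  then have "card ?S = (\<Sum>t\<in>?T. card {z \<in> ?S. ?\<phi> z = t})"
    by (simp only: card_eq_sum)
  also have "\<dots> = card ?T * reps e"
    by (simp add: fibre)
  finally have "card ?S = card (key e ` set rows) * reps e * e"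
    by (simp add: card_T mult_ac)
  moreover have "length (channels e) = card (key e ` set rows) * reps e"
    using distinct_card[OF distinct_channels[of e]] by (simp add: set_channels card_cartesian_product)
  moreover have "length idx = card ?S"
    using distinct_card[OF distinct_idx] by (simp add: set_idx)
  ultimately show ?thesis
    by simp
qed

lemma ev_range: "ev u y \<in> {0..<int p}"
  using p_gt_1 by (simp add: ev_def)

lemma ev_add: "ev (u + v) y = (ev u y + ev v y) mod int p"
  by (simp add: ev_def mod_simps)

lemma ev_eq_iff: "ev u y = ev v y \<longleftrightarrow> int p dvd poly (u - v) (int y)"
  by (simp add: ev_def mod_eq_dvd_iff)

lemma ev_add_cancel [simp]: "ev (u + w) y = ev (v + w) y \<longleftrightarrow> ev u y = ev v y"
  by (simp add: ev_eq_iff)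

lemma separated_points: "A \<subseteq> {..<p} \<Longrightarrow> separated p (int ` A)"
  by (rule separated_of_range) (auto intro: finite_subset)

lemma card_int_image [simp]: "card (int ` A) = card A"
  by (simp add: card_image)

lemma not_dvd_diff_points:
  assumes "y < p" "z < p" "y \<noteq> z"
  shows "\<not> int p dvd int y - int z"
proof
  assume "int p dvd int y - int z"
  then have "int y mod int p = int z mod int p"
    by (simp add: mod_eq_dvd_iff)
  then show False
    using assms by simp
qed

lemma ev_eq_of_points:
  assumes "A \<subseteq> {..<p}" "degree u < card A" "degree v < card A" "\<And>a. a \<in> A \<Longrightarrow> ev u a = ev v a"
  shows "ev u y = ev v y"
  unfolding ev_eq_iff
proof (rule poly_dvd_of_roots[OF p separated_points[OF assms(1)]])
  show "degree (u - v) < card (int ` A)"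
    using assms(2,3) by (simp add: degree_diff_less)
qed (use assms(4) in \<open>auto simp: ev_eq_iff\<close>)

lemma codeword_eq_iff:
  "codeword u = codeword v \<longleftrightarrow>
    (\<forall>\<rho>\<in>set rows. (\<forall>f\<in>pts \<rho>. ev (u \<rho>) f = ev (v \<rho>) f) \<and> (\<forall>n\<in>{1..N}. ev (u \<rho>) n = ev (v \<rho>) n))"
  by (auto simp: codeword_def fun_eq_iff set_idx)

lemma fst_codeword_eq_iff:
  "fst (codeword u) = fst (codeword v) \<longleftrightarrow> (\<forall>\<rho>\<in>set rows. \<forall>f\<in>pts \<rho>. ev (u \<rho>) f = ev (v \<rho>) f)"
  by (auto simp: codeword_def set_idx)

lemma snd_codeword: "n \<in> {1..N} \<Longrightarrow> snd (codeword u) n = map (\<lambda>\<rho>. ev (u \<rho>) n) rows"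
  by (simp add: codeword_def)

lemma translatable_codeword: "translatable d codeword"
  by (simp add: translatable_def codeword_eq_iff fadd_def)

lemma translatable_fst_codeword: "translatable d (fst \<circ> codeword)"
  by (simp add: translatable_def fst_codeword_eq_iff fadd_def)

lemma codeword_recover:
  assumes uv: "u \<in> families R" "v \<in> families R" and T: "T \<subseteq> {1..N}" "card T = R"
    and eq: "\<And>n. n \<in> T \<Longrightarrow> snd (codeword u) n = snd (codeword v) n"
  shows "fst (codeword u) = fst (codeword v)"
  unfolding fst_codeword_eq_iff
proof (intro ballI)
  fix \<rho> f assume \<rho>: "\<rho> \<in> set rows"
  show "ev (u \<rho>) f = ev (v \<rho>) f"
  proof (rule ev_eq_of_points)
    show "T \<subseteq> {..<p}"
      using T(1) N_less_p by auto
    show "degree (u \<rho>) < card T" "degree (v \<rho>) < card T"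
      using uv T(2) by (auto simp: families_def)
    show "ev (u \<rho>) n = ev (v \<rho>) n" if "n \<in> T" for n
      using eq[OF that] that T(1) \<rho> by (auto simp: snd_codeword subset_iff)
  qed
qed

lemma entry_idx_mod:
  assumes "set w \<subseteq> {0..<int p}" "length w = length idx" "z \<in> set idx"
  shows "entry idx w z mod int p = entry idx w z"
proof -
  have "entry idx w z \<in> set (map (entry idx w) idx)"
    using assms(3) by simp
  then have "entry idx w z \<in> set w"
    unfolding map_entry[OF distinct_idx assms(2)] .
  then show ?thesis
    using assms(1) by auto
qed

lemma codeword_surj:
  assumes "set w \<subseteq> {0..<int p}" "length w = length idx"
  obtains u where "u \<in> families R" "fst (codeword u) = w"
proof -
  have "\<exists>P. degree P < R \<and> (\<forall>f\<in>pts \<rho>. [poly P (int f) = entry idx w (\<rho>, f)] (mod int p))"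
    if \<rho>: "\<rho> \<in> set rows" for \<rho>
  proof -
    have "pts \<rho> \<subseteq> {..<p}" "card (int ` pts \<rho>) \<le> R" "0 < R"
      using pts_range[OF \<rho>] card_pts[OF \<rho>] dims by auto
    then obtain P where "degree P < R" "\<And>y. y \<in> int ` pts \<rho> \<Longrightarrow> [poly P y = entry idx w (\<rho>, nat y)] (mod int p)"
      using ex_interpolation[OF p separated_points, of "pts \<rho>" R "\<lambda>y. entry idx w (\<rho>, nat y)"] by blast
    then have "[poly P (int f) = entry idx w (\<rho>, f)] (mod int p)" if "f \<in> pts \<rho>" for f
      using that by (metis imageI nat_int)
    with \<open>degree P < R\<close> show ?thesis
      by blast
  qed
  then obtain P where P: "\<And>\<rho>. \<rho> \<in> set rows \<Longrightarrow> degree (P \<rho>) < R"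
      "\<And>\<rho> f. \<rho> \<in> set rows \<Longrightarrow> f \<in> pts \<rho> \<Longrightarrow> [poly (P \<rho>) (int f) = entry idx w (\<rho>, f)] (mod int p)"
    by metis
  define u where "u \<rho> = (if \<rho> \<in> set rows then P \<rho> else 0)" for \<rho>
  show thesis
  proof
    show "u \<in> families R"
      using P(1) dims by (auto simp: families_def u_def)
    have "fst (codeword u) = map (entry idx w) idx"
      unfolding codeword_def using P(2) entry_idx_mod[OF assms]
      by (auto simp: set_idx u_def ev_def cong_def)
    then show "fst (codeword u) = w"
      by (simp add: map_entry distinct_idx assms(2))
  qed
qed

section \<open>Reading: answers as values of mixes\<close>

lemma answer_fn_codeword:
  assumes "n \<in> {1..N}" "e = N + K - R - card D"
  shows "answer_fn D n (snd (codeword u) n) = map (\<lambda>i. ev (mix e u i) n) (channels e)"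
proof -
  have "(\<Sum>\<rho> | \<rho> \<in> set rows \<and> key e \<rho> = \<kappa>. x \<rho> ^ a * poly (cover e \<rho>) (int n) * entry rows (map (\<lambda>\<rho>. ev (u \<rho>) n) rows) \<rho>) mod int p
      = ev (mix e u (\<kappa>, a)) n" for \<kappa> a
  proof -
    have "(\<Sum>\<rho> | \<rho> \<in> set rows \<and> key e \<rho> = \<kappa>. x \<rho> ^ a * poly (cover e \<rho>) (int n) * entry rows (map (\<lambda>\<rho>. ev (u \<rho>) n) rows) \<rho>) mod int p
        = (\<Sum>\<rho> | \<rho> \<in> set rows \<and> key e \<rho> = \<kappa>. (x \<rho> ^ a * poly (cover e \<rho>) (int n) * (poly (u \<rho>) (int n) mod int p)) mod int p) mod int p"
      by (simp add: mod_sum_eq ev_def)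
    also have "\<dots> = (\<Sum>\<rho> | \<rho> \<in> set rows \<and> key e \<rho> = \<kappa>. (x \<rho> ^ a * poly (cover e \<rho>) (int n) * poly (u \<rho>) (int n)) mod int p) mod int p"
      by (simp only: mod_mult_right_eq)
    also have "\<dots> = ev (mix e u (\<kappa>, a)) n"
      by (simp add: mod_sum_eq ev_def mix_def poly_sum mult.assoc)
    finally show ?thesis .
  qed
  then show ?thesis
    using assms by (auto simp: answer_fn_def snd_codeword Let_def)
qed

lemma degree_mix:
  assumes "K \<le> e" "e \<le> N" "u \<in> families R"
  shows "degree (mix e u i) < e + R - K"
proof -
  have "degree ([:x \<rho> ^ snd i:] * cover e \<rho> * u \<rho>) < e + R - K" if \<rho>: "\<rho> \<in> set rows" for \<rho>
  proof -
    have "degree (cover e \<rho>) = e - K"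
      unfolding cover_def using finite_pool[OF assms(1,2) \<rho>] pts_pool[OF assms(1,2) \<rho>] finite_pts[OF \<rho>]
      by (subst degree_prod_linear) (simp_all add: card_Diff_subset card_pool[OF assms(1,2) \<rho>] card_pts[OF \<rho>])
    moreover have "degree (u \<rho>) < R"
      using assms(3) by (simp add: families_def)
    moreover have "degree ([:x \<rho> ^ snd i:] * cover e \<rho> * u \<rho>) \<le> degree [:x \<rho> ^ snd i:] + degree (cover e \<rho>) + degree (u \<rho>)"
      by (meson add_le_mono1 degree_mult_le order_trans)
    ultimately show ?thesis
      using assms(1) by simp
  qed
  moreover have "0 < e + R - K"
    using assms(1) dims by simp
  ultimately show ?thesis
    unfolding mix_def case_prod_unfold by (intro degree_sum_less) auto
qed

lemma x_separated:
  assumes "\<rho> \<in> set rows" "\<rho>' \<in> set rows" "\<rho> \<noteq> \<rho>'"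
  shows "\<not> int p dvd x \<rho> - x \<rho>'"
proof
  assume "int p dvd x \<rho> - x \<rho>'"
  then have "x \<rho> mod int p = x \<rho>' mod int p"
    by (simp add: mod_eq_dvd_iff)
  moreover have "x \<rho> \<in> {0..<int p}" "x \<rho>' \<in> {0..<int p}"
    using x_range assms by auto
  ultimately show False
    using inj_onD[OF x_inj _ assms(1,2)] assms(3) by simp
qed

text \<open>
  At a point \<open>f\<close> of the pool the covers kill all rows for which \<open>f\<close> is not a secret point, and the
  \<open>reps e\<close> channels of a key form a Vandermonde system for the remaining rows.
\<close>

lemma mix_decode:
  assumes e: "K \<le> e" "e \<le> N" and \<rho>: "\<rho> \<in> set rows" "f \<in> pts \<rho>"
    and eq: "\<And>a. a < reps e \<Longrightarrow> ev (mix e u (key e \<rho>, a)) f = ev (mix e v (key e \<rho>, a)) f"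
  shows "ev (u \<rho>) f = ev (v \<rho>) f"
proof -
  define S where "S = {\<rho>' \<in> set rows. key e \<rho>' = key e \<rho> \<and> f \<in> pts \<rho>'}"
  define y where "y \<rho>' = poly (cover e \<rho>') (int f) * poly (u \<rho>' - v \<rho>') (int f)" for \<rho>'
  have f: "f \<in> pool e (key e \<rho>)"
    using pts_pool[OF e \<rho>(1)] \<rho>(2) by blast
  have "int p dvd y \<rho>"
  proof (rule vandermonde_transpose_injective[OF p, of S "reps e" x y])
    show "finite S" "card S \<le> reps e" "\<rho> \<in> S"
      using star[OF e \<rho>(1) f] \<rho> by (simp_all add: S_def)
    show "\<not> int p dvd x i - x j" if "i \<in> S" "j \<in> S" "i \<noteq> j" for i j
      using that by (intro x_separated) (auto simp: S_def)
    fix a assume "a < reps e"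
    have "mix e u (key e \<rho>, a) - mix e v (key e \<rho>, a) = mix e (\<lambda>\<rho>. u \<rho> - v \<rho>) (key e \<rho>, a)"
      unfolding mix_def case_prod_conv sum_subtractf[symmetric] by (simp only: right_diff_distrib)
    then have "int p dvd poly (mix e (\<lambda>\<rho>. u \<rho> - v \<rho>) (key e \<rho>, a)) (int f)"
      using eq[OF \<open>a < reps e\<close>] unfolding ev_eq_iff by simp
    also have "poly (mix e (\<lambda>\<rho>. u \<rho> - v \<rho>) (key e \<rho>, a)) (int f) =
        (\<Sum>\<rho>' | \<rho>' \<in> set rows \<and> key e \<rho>' = key e \<rho>. x \<rho>' ^ a * y \<rho>')"
      by (simp add: mix_def poly_sum y_def mult.assoc)
    also have "\<dots> = (\<Sum>\<rho>'\<in>S. x \<rho>' ^ a * y \<rho>')"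
    proof (rule sum.mono_neutral_right)
      show "\<forall>\<rho>'\<in>{\<rho>' \<in> set rows. key e \<rho>' = key e \<rho>} - S. x \<rho>' ^ a * y \<rho>' = 0"
      proof
        fix \<rho>' assume \<rho>': "\<rho>' \<in> {\<rho>' \<in> set rows. key e \<rho>' = key e \<rho>} - S"
        have "finite (pool e (key e \<rho>') - pts \<rho>')" "f \<in> pool e (key e \<rho>') - pts \<rho>'"
          using \<rho>' f finite_pool[OF e, of \<rho>'] by (auto simp: S_def)
        then have "poly (cover e \<rho>') (int f) = 0"
          unfolding cover_def poly_prod_linear by (intro prod_zero) auto
        then show "x \<rho>' ^ a * y \<rho>' = 0"
          by (simp add: y_def)
      qed
    qed (auto simp: S_def)
    finally show "int p dvd (\<Sum>\<rho>'\<in>S. x \<rho>' ^ a * y \<rho>')" .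
  qed
  moreover have "\<not> int p dvd poly (cover e \<rho>) (int f)"
    unfolding cover_def poly_prod_linear
  proof (rule not_dvd_prod_diff[OF p])
    show "finite (pool e (key e \<rho>) - pts \<rho>)"
      using finite_pool[OF e \<rho>(1)] by simp
    fix g assume "g \<in> pool e (key e \<rho>) - pts \<rho>"
    then show "\<not> int p dvd int f - int g"
      using pool[OF e \<rho>(1)] f \<rho>(2) by (intro not_dvd_diff_points) auto
  qed
  ultimately show ?thesis
    using p unfolding ev_eq_iff y_def by (simp add: prime_dvd_mult_iff)
qed

text \<open>There are as many available servers as the degree bound of a mix, so the answers
  determine every mix at every point, in particular at the secret points, where
  \<open>mix_decode\<close> applies.\<close>

lemma answers_decode:
  assumes D: "D \<subseteq> {1..N}" "card D + R \<le> N" and uv: "u \<in> families R" "v \<in> families R"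
    and eq: "\<And>n. n \<in> {1..N} - D \<Longrightarrow> answer_fn D n (snd (codeword u) n) = answer_fn D n (snd (codeword v) n)"
  shows "fst (codeword u) = fst (codeword v)"
  unfolding fst_codeword_eq_iff
proof (intro ballI)
  define e where "e = N + K - R - card D"
  have e: "K \<le> e" "e \<le> N"
    using D(2) dims by (simp_all add: e_def)
  have "finite D"
    using D(1) by (auto intro: finite_subset)
  then have card: "card ({1..N} - D) = e + R - K"
    using D dims by (simp add: card_Diff_subset e_def)
  fix \<rho> f assume \<rho>: "\<rho> \<in> set rows" "f \<in> pts \<rho>"
  show "ev (u \<rho>) f = ev (v \<rho>) f"
  proof (rule mix_decode[OF e \<rho>])
    fix a assume a: "a < reps e"
    show "ev (mix e u (key e \<rho>, a)) f = ev (mix e v (key e \<rho>, a)) f"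
    proof (rule ev_eq_of_points)
      show "{1..N} - D \<subseteq> {..<p}"
        using N_less_p by auto
      show "degree (mix e u (key e \<rho>, a)) < card ({1..N} - D)" "degree (mix e v (key e \<rho>, a)) < card ({1..N} - D)"
        unfolding card by (intro degree_mix e uv)+
      fix n assume n: "n \<in> {1..N} - D"
      have "(key e \<rho>, a) \<in> set (channels e)"
        using \<rho>(1) a by (simp add: set_channels)
      then show "ev (mix e u (key e \<rho>, a)) n = ev (mix e v (key e \<rho>, a)) n"
        using eq[OF n] n by (simp add: answer_fn_codeword[OF _ e_def])
    qed
  qed
qed

end

section \<open>Updating: increments spread over channels\<close>

lemma poly_eq_sum_lessThan:
  fixes P :: "int poly"
  assumes "degree P < d"
  shows "poly P y = (\<Sum>b<d. y ^ b * Polynomial.coeff P b)"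
proof -
  have "poly P y = (\<Sum>b\<le>degree P. y ^ b * Polynomial.coeff P b)"
    by (simp add: poly_altdef mult.commute)
  also have "\<dots> = (\<Sum>b<d. y ^ b * Polynomial.coeff P b)"
    using assms by (intro sum.mono_neutral_left) (auto simp: coeff_eq_0)
  finally show ?thesis .
qed

context mds_code
begin

lemma poly_shift: "poly (shift D) y = (\<Prod>m\<in>D. y - int m)"
  by (simp add: shift_def poly_prod_linear)

lemma poly_delta:
  "poly (delta D e v \<rho>) y = poly (shift D) y * (\<Sum>b<reps e. x \<rho> ^ b * poly (v (key e \<rho>, b)) y)"
  by (simp add: delta_def poly_sum)

lemma delta_fadd: "delta D e (fadd v w) \<rho> = delta D e v \<rho> + delta D e w \<rho>"
  by (simp add: delta_def fadd_def sum.distrib[symmetric] distrib_left[symmetric] smult_add_right)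

lemma delta_families:
  assumes "finite D" "card D + K \<le> R" "v \<in> families (R - card D)"
  shows "delta D e v \<in> families R"
  unfolding families_def
proof (intro CollectI allI)
  fix \<rho>
  have "degree ([:x \<rho> ^ b:] * v (key e \<rho>, b)) < R - card D" for b
  proof -
    have "degree ([:x \<rho> ^ b:] * v (key e \<rho>, b)) \<le> degree [:x \<rho> ^ b:] + degree (v (key e \<rho>, b))"
      by (rule degree_mult_le)
    also have "\<dots> < R - card D"
      using assms(3) by (simp add: families_def)
    finally show ?thesis .
  qed
  then have "degree (\<Sum>b<reps e. [:x \<rho> ^ b:] * v (key e \<rho>, b)) < R - card D"
    using assms(2) dims by (intro degree_sum_less) auto
  moreover have "degree (shift D) = card D"
    unfolding shift_def by (rule degree_prod_linear[OF assms(1)])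
  ultimately show "degree (delta D e v \<rho>) < R"
    unfolding delta_def using degree_mult_le[of "shift D" "\<Sum>b<reps e. [:x \<rho> ^ b:] * v (key e \<rho>, b)"] by linarith
qed

lemma increment_eq_iff:
  assumes "e = R - X - card D"
  shows "increment D X v = increment D X w \<longleftrightarrow>
    (\<forall>\<rho>\<in>set rows. \<forall>f\<in>pts \<rho>. ev (delta D e v \<rho>) f = ev (delta D e w \<rho>) f) \<and>
    (\<forall>n\<in>{1..N} - D. \<forall>i\<in>set (channels e). ev (v i) n = ev (w i) n)"
  by (auto simp: increment_def assms Let_def fun_eq_iff set_idx)

lemma fst_increment_eq_iff:
  assumes "e = R - X - card D"
  shows "fst (increment D X v) = fst (increment D X w) \<longleftrightarrow>
    (\<forall>\<rho>\<in>set rows. \<forall>f\<in>pts \<rho>. ev (delta D e v \<rho>) f = ev (delta D e w \<rho>) f)"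
  by (auto simp: increment_def assms Let_def set_idx)

lemma snd_increment:
  assumes "e = R - X - card D" "n \<in> {1..N} - D"
  shows "snd (increment D X v) n = map (\<lambda>i. ev (v i) n) (channels e)"
  using assms by (simp add: increment_def Let_def)

lemma translatable_increment: "translatable d (increment D X)"
  unfolding translatable_def increment_eq_iff[OF refl] delta_fadd ev_add_cancel
  by (simp add: fadd_def)

text \<open>Makes the joint law of the increment and the view of \<open>Y\<close> uniform on its
  image, so that security becomes a question about this set.\<close>

lemma translatable_restrict_increment:
  assumes "Y \<subseteq> {1..N} - D"
  shows "translatable d ((\<lambda>(w, q). (w, restrict q Y)) \<circ> increment D X)"
proof -
  have restrict_eq_iff: "restrict f Y = restrict g Y \<longleftrightarrow> (\<forall>n\<in>Y. f n = g n)" for f g :: "nat \<Rightarrow> int list"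
    by (auto simp: restrict_def fun_eq_iff)
  have "((\<lambda>(w, q). (w, restrict q Y)) \<circ> increment D X) v = ((\<lambda>(w, q). (w, restrict q Y)) \<circ> increment D X) w \<longleftrightarrow>
    (\<forall>\<rho>\<in>set rows. \<forall>f\<in>pts \<rho>. ev (delta D (R - X - card D) v \<rho>) f = ev (delta D (R - X - card D) w \<rho>) f) \<and>
    (\<forall>n\<in>Y. \<forall>i\<in>set (channels (R - X - card D)). ev (v i) n = ev (w i) n)" for v w
    using assms unfolding o_def case_prod_unfold prod.inject fst_increment_eq_iff[OF refl] restrict_eq_iff
    by (auto simp: snd_increment[OF refl] subset_iff)
  then show ?thesis
    unfolding translatable_def by (simp only: delta_fadd ev_add_cancel) (simp add: fadd_def)
qed

lemma reps_pos:
  assumes e: "K \<le> e" "e \<le> N"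
  shows "0 < reps e"
proof -
  obtain \<rho> where \<rho>: "\<rho> \<in> set rows"
    using rows_nonempty by (meson hd_in_set)
  then obtain f where f: "f \<in> pts \<rho>"
    using card_pts dims(1) by fastforce
  then have "\<rho> \<in> {\<rho>' \<in> set rows. key e \<rho>' = key e \<rho> \<and> f \<in> pts \<rho>'}"
    using \<rho> by simp
  then have "0 < card {\<rho>' \<in> set rows. key e \<rho>' = key e \<rho> \<and> f \<in> pts \<rho>'}"
    by (auto simp: card_gt_0_iff)
  then show ?thesis
    using star[OF e \<rho>] pts_pool[OF e \<rho>] f by auto
qed

text \<open>The coefficients of \<open>Z\<close> are the values that the channels with key
  \<open>\<kappa>\<close> should take at \<open>f\<close>. The rows with this key and secret point
  \<open>f\<close> number \<open>reps e\<close> and have distinct nodes, so interpolation in the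
  nodes meets all their demands; \<open>shift D\<close> is invertible at \<open>f\<close> because
  \<open>f\<close> is not a server.\<close>

lemma ex_channel_values:
  assumes e: "K \<le> e" "e \<le> N" and D: "D \<subseteq> {1..N}"
    and \<kappa>: "\<kappa> \<in> key e ` set rows" "f \<in> pool e \<kappa>"
  shows "\<exists>Z :: int poly. degree Z < reps e \<and>
    (\<forall>\<rho>\<in>set rows. key e \<rho> = \<kappa> \<longrightarrow> f \<in> pts \<rho> \<longrightarrow> [poly (shift D) (int f) * poly Z (x \<rho>) = t \<rho>] (mod int p))"
proof -
  obtain \<rho>0 where \<rho>0: "\<rho>0 \<in> set rows" "\<kappa> = key e \<rho>0"
    using \<kappa>(1) by blast
  define S where "S = {\<rho> \<in> set rows. key e \<rho> = key e \<rho>0 \<and> f \<in> pts \<rho>}"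
  have f: "N < f" "f < p"
    using pool[OF e \<rho>0(1)] \<kappa>(2) \<rho>0(2) by auto
  have "\<not> int p dvd poly (shift D) (int f)"
    unfolding poly_shift
  proof (rule not_dvd_prod_diff[OF p])
    show "finite D"
      using D by (auto intro: finite_subset)
    show "\<not> int p dvd int f - int m" if "m \<in> D" for m
      using that D f N_less_p by (intro not_dvd_diff_points) auto
  qed
  then have "\<forall>\<rho>. \<exists>z. [poly (shift D) (int f) * z = t \<rho>] (mod int p)"
    using ex_cong_mult[OF p] by blast
  then obtain z where z: "\<And>\<rho>. [poly (shift D) (int f) * z \<rho> = t \<rho>] (mod int p)"
    by metis
  have "x ` S \<subseteq> {0..<int p}" "finite (x ` S)"
    using x_range by (auto simp: S_def)
  then have "separated p (x ` S)"
    by (intro separated_of_range)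
  moreover have "card (x ` S) \<le> reps e"
    using star[OF e \<rho>0(1), of f] \<kappa>(2) \<rho>0(2) card_image_le[of S x] by (simp add: S_def)
  ultimately obtain Z where Z: "degree Z < reps e"
      "\<And>y. y \<in> x ` S \<Longrightarrow> [poly Z y = z (inv_into (set rows) x y)] (mod int p)"
    using ex_interpolation[OF p _ _ reps_pos[OF e], of "x ` S" "\<lambda>y. z (inv_into (set rows) x y)"] by blast
  have "[poly (shift D) (int f) * poly Z (x \<rho>) = t \<rho>] (mod int p)"
    if \<rho>: "\<rho> \<in> set rows" "key e \<rho> = \<kappa>" "f \<in> pts \<rho>" for \<rho>
  proof -
    have "[poly Z (x \<rho>) = z \<rho>] (mod int p)"
      using Z(2)[of "x \<rho>"] \<rho> \<rho>0(2) x_inj by (simp add: S_def inv_into_f_f)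
    then have "[poly (shift D) (int f) * poly Z (x \<rho>) = poly (shift D) (int f) * z \<rho>] (mod int p)"
      by (rule cong_scalar_left)
    then show ?thesis
      using z by (rule cong_trans)
  qed
  then show ?thesis
    using Z(1) by blast
qed

text \<open>
  The polynomial of a channel is prescribed at the \<open>e\<close> points of the pool (by the increment) and at
  up to \<open>X\<close> servers, \<open>R - card D\<close> points in total.
\<close>

lemma increment_interpolate:
  assumes D: "D \<subseteq> {1..N}" "card D + X + K \<le> R" and Y: "Y \<subseteq> {1..N} - D" "card Y \<le> X"
    and w: "set w \<subseteq> {0..<int p}" "length w = length idx"
  shows "\<exists>v\<in>families (R - card D). fst (increment D X v) = w \<and>
    (\<forall>n\<in>Y. snd (increment D X v) n = snd (increment D X v') n)"
proof -
  define e where "e = R - X - card D"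
  have e: "K \<le> e" "e \<le> N" "e + X = R - card D"
    using D(2) dims by (simp_all add: e_def)
  have "\<exists>Z :: int poly. degree Z < reps e \<and>
    (\<forall>\<rho>\<in>set rows. key e \<rho> = \<kappa> \<longrightarrow> f \<in> pts \<rho> \<longrightarrow> [poly (shift D) (int f) * poly Z (x \<rho>) = entry idx w (\<rho>, f)] (mod int p))"
    if "\<kappa> \<in> key e ` set rows" "f \<in> pool e \<kappa>" for \<kappa> f
    by (rule ex_channel_values[OF e(1,2) D(1) that])
  then obtain Z :: "'k \<Rightarrow> nat \<Rightarrow> int poly" where
    Z: "\<And>\<kappa> f. \<kappa> \<in> key e ` set rows \<Longrightarrow> f \<in> pool e \<kappa> \<Longrightarrow> degree (Z \<kappa> f) < reps e \<and>
      (\<forall>\<rho>\<in>set rows. key e \<rho> = \<kappa> \<longrightarrow> f \<in> pts \<rho> \<longrightarrow>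
        [poly (shift D) (int f) * poly (Z \<kappa> f) (x \<rho>) = entry idx w (\<rho>, f)] (mod int p))"
    by metis
  \<comment> \<open>The channel \<open>(\<kappa>, b)\<close> collects the coefficients with index
    \<open>b\<close> of all \<open>Z \<kappa> f\<close>, one for every point \<open>f\<close> of the
    pool; on \<open>Y\<close> it copies \<open>v'\<close>.\<close>
  have "\<exists>P. degree P < R - card D \<and> (\<forall>f\<in>pool e \<kappa>. [poly P (int f) = Polynomial.coeff (Z \<kappa> f) b] (mod int p)) \<and>
      (\<forall>n\<in>Y. [poly P (int n) = poly (v' (\<kappa>, b)) (int n)] (mod int p))"
    if \<kappa>: "\<kappa> \<in> key e ` set rows" for \<kappa> b
  proof -
    obtain \<rho> where \<rho>: "\<rho> \<in> set rows" "\<kappa> = key e \<rho>"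
      using \<kappa> by blast
    have pool_range: "pool e \<kappa> \<subseteq> {N<..<p}"
      using pool[OF e(1,2) \<rho>(1)] \<rho>(2) by simp
    have "pool e \<kappa> \<union> Y \<subseteq> {..<p}"
      using pool_range Y(1) N_less_p by fastforce
    then have sep: "separated p (int ` (pool e \<kappa> \<union> Y))"
      by (rule separated_points)
    have "card (pool e \<kappa> \<union> Y) \<le> R - card D"
      using card_Un_le[of "pool e \<kappa>" Y] card_pool[OF e(1,2) \<rho>(1)] \<rho>(2) Y(2) e(3) by simp
    then have "card (int ` (pool e \<kappa> \<union> Y)) \<le> R - card D" "0 < R - card D"
      using D(2) dims by simp_all
    \<comment> \<open>The pool lies above \<open>N\<close> and \<open>Y\<close> does not, so the two
      kinds of prescribed values never conflict.\<close>
    with sep obtain P where P: "degree P < R - card D" "\<And>y. y \<in> int ` (pool e \<kappa> \<union> Y) \<Longrightarrow>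
        [poly P y = (if nat y \<in> Y then poly (v' (\<kappa>, b)) y else Polynomial.coeff (Z \<kappa> (nat y)) b)] (mod int p)"
      using ex_interpolation[OF p, where S = "int ` (pool e \<kappa> \<union> Y)" and d = "R - card D" and
        v = "\<lambda>y. if nat y \<in> Y then poly (v' (\<kappa>, b)) y else Polynomial.coeff (Z \<kappa> (nat y)) b"] by blast
    have "[poly P (int f) = Polynomial.coeff (Z \<kappa> f) b] (mod int p)" if "f \<in> pool e \<kappa>" for f
    proof -
      have "f \<notin> Y"
        using that pool_range Y(1) by fastforce
      then show ?thesis
        using P(2)[of "int f"] that by simp
    qed
    moreover have "[poly P (int n) = poly (v' (\<kappa>, b)) (int n)] (mod int p)" if "n \<in> Y" for n
      using P(2)[of "int n"] that by simp
    ultimately show ?thesis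
      using P(1) by blast
  qed
  then obtain V where V: "\<And>\<kappa> b. \<kappa> \<in> key e ` set rows \<Longrightarrow> degree (V \<kappa> b) < R - card D \<and>
      (\<forall>f\<in>pool e \<kappa>. [poly (V \<kappa> b) (int f) = Polynomial.coeff (Z \<kappa> f) b] (mod int p)) \<and>
      (\<forall>n\<in>Y. [poly (V \<kappa> b) (int n) = poly (v' (\<kappa>, b)) (int n)] (mod int p))"
    by metis
  define v where "v i = (if fst i \<in> key e ` set rows then V (fst i) (snd i) else 0)" for i
  have v_eq: "v (\<kappa>, b) = V \<kappa> b" if "\<kappa> \<in> key e ` set rows" for \<kappa> b
    using that by (simp add: v_def)
  have "v \<in> families (R - card D)"
    using V D(2) dims by (auto simp: families_def v_def)
  moreover have "fst (increment D X v) = w"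
  proof -
    have "ev (delta D e v \<rho>) f = entry idx w (\<rho>, f)" if \<rho>: "\<rho> \<in> set rows" "f \<in> pts \<rho>" for \<rho> f
    proof -
      have \<kappa>: "key e \<rho> \<in> key e ` set rows" and f: "f \<in> pool e (key e \<rho>)"
        using \<rho> pts_pool[OF e(1,2) \<rho>(1)] by auto
      have "[(\<Sum>b<reps e. x \<rho> ^ b * poly (v (key e \<rho>, b)) (int f)) =
          (\<Sum>b<reps e. x \<rho> ^ b * Polynomial.coeff (Z (key e \<rho>) f) b)] (mod int p)"
        using V[OF \<kappa>] f by (intro cong_sum cong_scalar_left) (simp add: v_eq[OF \<kappa>])
      then have "[poly (delta D e v \<rho>) (int f) = poly (shift D) (int f) * poly (Z (key e \<rho>) f) (x \<rho>)] (mod int p)"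
        unfolding poly_delta poly_eq_sum_lessThan[OF conjunct1[OF Z[OF \<kappa> f]]] by (rule cong_scalar_left)
      also have "[poly (shift D) (int f) * poly (Z (key e \<rho>) f) (x \<rho>) = entry idx w (\<rho>, f)] (mod int p)"
        using Z[OF \<kappa> f] \<rho> by blast
      finally show ?thesis
        using entry_idx_mod[OF w, of "(\<rho>, f)"] \<rho> by (simp add: ev_def cong_def set_idx)
    qed
    then have "fst (increment D X v) = map (entry idx w) idx"
      unfolding increment_def Let_def e_def[symmetric] by (auto simp: set_idx)
    then show ?thesis
      by (simp add: map_entry distinct_idx w(2))
  qed
  moreover have "snd (increment D X v) n = snd (increment D X v') n" if n: "n \<in> Y" for n
  proof -
    have "ev (v (\<kappa>, b)) n = ev (v' (\<kappa>, b)) n" if "\<kappa> \<in> key e ` set rows" for \<kappa> b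
      using V[OF that] n by (simp add: v_eq[OF that] ev_def cong_def)
    moreover have "n \<in> {1..N} - D"
      using n Y(1) by blast
    ultimately show ?thesis
      by (auto simp: snd_increment[OF e_def] set_channels)
  qed
  ultimately show ?thesis
    by blast
qed

lemma store_fn_correct:
  assumes e: "e = R - X - card D" and n: "n \<in> {1..N} - D"
  shows "store_fn D X n (snd (codeword u) n) (snd (increment D X v) n) = snd (codeword (fadd u (delta D e v))) n"
proof -
  have "(ev (u \<rho>) n + poly (shift D) (int n) * (\<Sum>b<reps e. x \<rho> ^ b * ev (v (key e \<rho>, b)) n)) mod int p =
      ev (u \<rho> + delta D e v \<rho>) n" for \<rho>
  proof -
    have "[ev (u \<rho>) n + poly (shift D) (int n) * (\<Sum>b<reps e. x \<rho> ^ b * ev (v (key e \<rho>, b)) n) =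
        poly (u \<rho>) (int n) + poly (shift D) (int n) * (\<Sum>b<reps e. x \<rho> ^ b * poly (v (key e \<rho>, b)) (int n))] (mod int p)"
      unfolding ev_def by (intro cong_add cong_scalar_left cong_sum) simp_all
    then show ?thesis
      by (simp add: ev_def poly_delta cong_def)
  qed
  moreover have "entry (channels e) (map (\<lambda>i. ev (v i) n) (channels e)) (key e \<rho>, b) = ev (v (key e \<rho>, b)) n"
    if "\<rho> \<in> set rows" "b < reps e" for \<rho> b
    using that by (intro entry_map) (simp add: set_channels)
  moreover have "n \<in> {1..N}"
    using n by blast
  ultimately show ?thesis
    unfolding store_fn_def Let_def e[symmetric] snd_codeword[OF \<open>n \<in> {1..N}\<close>] snd_increment[OF e n]
    by (auto simp: fadd_def)
qed

lemma codeword_dropout: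
  assumes "n \<in> D" "finite D" "n \<in> {1..N}"
  shows "snd (codeword (fadd u (delta D e v))) n = snd (codeword u) n"
proof -
  have "poly (shift D) (int n) = 0"
    unfolding poly_shift using assms by (intro prod_zero) auto
  then have "poly (delta D e v \<rho>) (int n) = 0" for \<rho>
    by (simp add: poly_delta)
  then show ?thesis
    using assms(3) by (simp add: snd_codeword fadd_def ev_def)
qed

lemma fst_codeword_fadd:
  assumes "e = R - X - card D"
  shows "fst (codeword (fadd u (delta D e v))) =
    map2 (\<lambda>a b. (a + b) mod int p) (fst (codeword u)) (fst (increment D X v))"
  using assms by (auto simp: codeword_def increment_def Let_def fadd_def ev_add map2_map_map)

end

section \<open>The scheme\<close>

lemma pair_pmf_of_set:
  assumes "finite A" "A \<noteq> {}" "finite B" "B \<noteq> {}"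
  shows "pair_pmf (pmf_of_set A) (pmf_of_set B) = pmf_of_set (A \<times> B)"
proof (rule pmf_eqI, clarify)
  fix a b
  show "pmf (pair_pmf (pmf_of_set A) (pmf_of_set B)) (a, b) = pmf (pmf_of_set (A \<times> B)) (a, b)"
    using assms by (simp add: pmf_pair pmf_of_set indicator_def card_cartesian_product)
qed

context mds_code
begin

definition states :: "(int list \<times> (nat \<Rightarrow> int list)) set" where
  "states = codeword ` families R"

definition uploads :: "nat set \<Rightarrow> nat \<Rightarrow> (int list \<times> (nat \<Rightarrow> int list)) set" where
  "uploads D X = increment D X ` families (R - card D)"

text \<open>
  The conditional law in \<open>upload\<close> is only meaningful if \<open>d\<close> is a message; otherwise no upload encodes \<open>d\<close>.
\<close>

definition code_scheme :: "(int, int list, int list, int list) scheme" where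
  "code_scheme = \<lparr>base = residue_ring (int p), len = length idx, init = pmf_of_set states,
     admits = (\<lambda>oper. case oper of Read D \<Rightarrow> D \<subseteq> {1..N} \<and> card D + R \<le> N
       | Update D X \<Rightarrow> D \<subseteq> {1..N} \<and> card D + X + K \<le> R),
     answer = (\<lambda>D n s. return_pmf (answer_fn D n s)),
     upload = (\<lambda>D X d. map_pmf snd (cond_pmf (pmf_of_set (uploads D X)) {j. fst j = d})),
     store = (\<lambda>D X n s q. return_pmf (store_fn D X n s q))\<rparr>"

abbreviation "W \<equiv> messages code_scheme"

lemma residues_prime: "residues_prime p"
  using p by unfold_locales

sublocale code: finite_field_scheme code_scheme
proof (rule finite_field_scheme.intro)
  show "field (base code_scheme)"
    using residues_prime.is_field[OF residues_prime] by (simp add: code_scheme_def)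
  show "finite (carrier (base code_scheme))"
    by (simp add: code_scheme_def residue_ring_def)
qed

lemma messages_code: "W = {w. length w = length idx \<and> set w \<subseteq> {0..<int p}}"
proof -
  have "{0..int p - 1} = {0..<int p}"
    by auto
  then show ?thesis
    by (simp add: messages_def code_scheme_def residue_ring_def)
qed

lemma msg_add_code: "msg_add code_scheme v w = map2 (\<lambda>a b. (a + b) mod int p) v w"
  by (simp add: msg_add_def code_scheme_def residue_ring_def)

lemma qary_code: "qary code_scheme = real p"
  by (simp add: qary_def code_scheme_def residue_ring_def)

lemma len_code: "len code_scheme = length idx"
  by (simp add: code_scheme_def)

definition words :: "nat \<Rightarrow> int list set" where
  "words l = {w. set w \<subseteq> {0..<int p} \<and> length w = l}"

lemma finite_words: "finite (words l)"
  unfolding words_def by (rule finite_lists_length_eq) simp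

lemma card_words: "card (words l) = p ^ l"
  unfolding words_def by (subst card_lists_length_eq) simp_all

lemma map_ev_words: "map (\<lambda>i. ev (u i) (y i)) l \<in> words (length l)"
  using ev_range by (auto simp: words_def)

text \<open>The cost estimates for the code need only this count of words. Equality is forced by the
  converse rather than by computing the laws of single answers or uploads.\<close>

lemma ent_words_le:
  assumes "finite (set_pmf P)" "\<And>\<omega>. \<omega> \<in> set_pmf P \<Longrightarrow> X \<omega> \<in> words l"
  shows "ent (qary code_scheme) P X \<le> real l"
proof -
  have "ent (qary code_scheme) P X \<le> log (qary code_scheme) (card (words l))"
    using assms finite_words by (intro ent_le_of_subset code.qary_gt_1) auto
  also have "\<dots> = real l"
    using p_gt_1 by (simp add: card_words qary_code log_nat_power)
  finally show ?thesis .
qed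

lemma messages_eq_words: "W = words (length idx)"
  by (auto simp: messages_code words_def)

lemma fst_codeword_words: "fst (codeword u) \<in> words (length idx)"
  using map_ev_words[of "\<lambda>z. u (fst z)" "\<lambda>z. snd z" idx] by (simp add: codeword_def case_prod_unfold)

lemma snd_codeword_words: "n \<in> {1..N} \<Longrightarrow> snd (codeword u) n \<in> words (length rows)"
  using map_ev_words[of u "\<lambda>_. n" rows] by (simp add: snd_codeword)

lemma fst_increment_words: "fst (increment D X v) \<in> words (length idx)"
  using map_ev_words[of "\<lambda>z. delta D (R - X - card D) v (fst z)" "\<lambda>z. snd z" idx]
  by (simp add: increment_def Let_def case_prod_unfold)

lemma snd_increment_words:
  "n \<in> {1..N} - D \<Longrightarrow> snd (increment D X v) n \<in> words (length (channels (R - X - card D)))"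
  using map_ev_words[of v "\<lambda>_. n" "channels (R - X - card D)"] by (simp only: snd_increment[OF refl])

lemma finite_words_functions:
  fixes A :: "nat set"
  assumes "finite A"
  shows "finite {s. \<forall>n. (n \<in> A \<longrightarrow> s n \<in> words l) \<and> (n \<notin> A \<longrightarrow> s n = [])}"
  using assms finite_words by (rule finite_set_of_finite_funs)

lemma finite_states: "finite states"
proof (rule finite_subset)
  show "states \<subseteq> words (length idx) \<times> {s. \<forall>n. (n \<in> {1..N} \<longrightarrow> s n \<in> words (length rows)) \<and> (n \<notin> {1..N} \<longrightarrow> s n = [])}"
  proof
    fix z assume "z \<in> states"
    then obtain u where "z = codeword u"
      by (auto simp: states_def)
    then show "z \<in> words (length idx) \<times> {s. \<forall>n. (n \<in> {1..N} \<longrightarrow> s n \<in> words (length rows)) \<and> (n \<notin> {1..N} \<longrightarrow> s n = [])}"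
      using fst_codeword_words[of u] snd_codeword_words[of _ u]
      by (simp add: mem_Times_iff) (simp add: codeword_def)
  qed
qed (intro finite_cartesian_product finite_words finite_words_functions finite_atLeastAtMost)

lemma finite_uploads: "finite (uploads D X)"
proof (rule finite_subset)
  let ?l = "length (channels (R - X - card D))"
  let ?F = "words (length idx) \<times> {s. \<forall>n. (n \<in> {1..N} - D \<longrightarrow> s n \<in> words ?l) \<and> (n \<notin> {1..N} - D \<longrightarrow> s n = [])}"
  show "uploads D X \<subseteq> ?F"
  proof
    fix z assume "z \<in> uploads D X"
    then obtain v where "z = increment D X v"
      by (auto simp: uploads_def)
    then show "z \<in> ?F"
      using fst_increment_words[of D X v] snd_increment_words[of _ D X v]
      by (simp add: mem_Times_iff) (simp add: increment_def Let_def)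
  qed
qed (intro finite_cartesian_product finite_words finite_words_functions finite_Diff finite_atLeastAtMost)

lemma states_nonempty: "states \<noteq> {}"
  using families_nonempty[of R] dims by (auto simp: states_def)

lemma uploads_nonempty: "card D < R \<Longrightarrow> uploads D X \<noteq> {}"
  using families_nonempty[of "R - card D"] by (auto simp: uploads_def)

lemma set_init: "set_pmf (pmf_of_set states) = states"
  by (rule set_pmf_of_set[OF states_nonempty finite_states])

lemma map_fst_states: "map_pmf fst (pmf_of_set states) = uniform_message code_scheme"
proof -
  have "fst ` states = W"
  proof
    show "fst ` states \<subseteq> W"
      using fst_codeword_words by (auto simp: states_def messages_eq_words)
    show "W \<subseteq> fst ` states"
    proof
      fix w assume "w \<in> W"
      then obtain u where "u \<in> families R" "fst (codeword u) = w"
        using codeword_surj[of w] by (auto simp: messages_code)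
      then show "w \<in> fst ` states"
        by (auto simp: states_def)
    qed
  qed
  moreover have "map_pmf fst (pmf_of_set states) = pmf_of_set (fst ` states)"
    unfolding states_def using dims finite_states
    by (intro map_pmf_of_set_families translatable_codeword translatable_fst_codeword) (simp_all add: states_def)
  ultimately show ?thesis
    by (simp add: uniform_message_def)
qed

text \<open>By \<open>increment_interpolate\<close> every message is compatible with every view of
  \<open>Y\<close>. The image is thus a product set, and a uniform law on a product set has
  independent components.\<close>

lemma restrict_uploads:
  assumes D: "D \<subseteq> {1..N}" "card D + X + K \<le> R" and Y: "Y \<subseteq> {1..N} - D" "card Y \<le> X"
  shows "(\<lambda>(w, q). (w, restrict q Y)) ` uploads D X = W \<times> (\<lambda>j. restrict (snd j) Y) ` uploads D X"
proof
  show "(\<lambda>(w, q). (w, restrict q Y)) ` uploads D X \<subseteq> W \<times> (\<lambda>j. restrict (snd j) Y) ` uploads D X"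
  proof clarify
    fix w q assume wq: "(w, q) \<in> uploads D X"
    then obtain v where "(w, q) = increment D X v"
      by (auto simp: uploads_def)
    then have "w \<in> W"
      using fst_increment_words[of D X v] by (metis fst_conv messages_eq_words)
    moreover have "restrict q Y \<in> (\<lambda>j. restrict (snd j) Y) ` uploads D X"
      using wq by force
    ultimately show "w \<in> W \<and> restrict q Y \<in> (\<lambda>j. restrict (snd j) Y) ` uploads D X"
      by blast
  qed
  show "W \<times> (\<lambda>j. restrict (snd j) Y) ` uploads D X \<subseteq> (\<lambda>(w, q). (w, restrict q Y)) ` uploads D X"
  proof clarify
    fix w a b assume w: "w \<in> W" and ab: "(a, b) \<in> uploads D X"
    from ab obtain v' where "(a, b) = increment D X v'"
      by (auto simp: uploads_def)
    then have v': "snd (increment D X v') = b"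
      by (metis snd_conv)
    obtain v where v: "v \<in> families (R - card D)" "fst (increment D X v) = w"
        "\<forall>n\<in>Y. snd (increment D X v) n = snd (increment D X v') n"
      using increment_interpolate[OF D Y, of w v'] w by (auto simp: messages_code)
    then have "restrict (snd (increment D X v)) Y = restrict b Y"
      using v' by (intro restrict_ext) simp
    then have "(w, restrict (snd (a, b)) Y) = (\<lambda>(w, q). (w, restrict q Y)) (increment D X v)"
      using v(2) by (simp add: case_prod_unfold)
    then show "(w, restrict (snd (a, b)) Y) \<in> (\<lambda>(w, q). (w, restrict q Y)) ` uploads D X"
      using v(1) by (auto simp: uploads_def)
  qed
qed

lemma map_restrict_uploads:
  assumes D: "D \<subseteq> {1..N}" "card D + X + K \<le> R" and Y: "Y \<subseteq> {1..N} - D" "card Y \<le> X"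
  shows "map_pmf (\<lambda>(w, q). (w, restrict q Y)) (pmf_of_set (uploads D X)) =
    pair_pmf (uniform_message code_scheme) (pmf_of_set ((\<lambda>j. restrict (snd j) Y) ` uploads D X))"
proof -
  have "uploads D X \<noteq> {}"
    using D dims by (intro uploads_nonempty) simp
  have "map_pmf (\<lambda>(w, q). (w, restrict q Y)) (pmf_of_set (uploads D X)) =
      pmf_of_set ((\<lambda>(w, q). (w, restrict q Y)) ` uploads D X)"
    unfolding uploads_def
  proof (rule map_pmf_of_set_families)
    show "0 < R - card D"
      using D dims by simp
  qed (use translatable_increment translatable_restrict_increment[OF Y(1)] finite_uploads in \<open>simp_all add: uploads_def\<close>)
  also have "\<dots> = pair_pmf (uniform_message code_scheme) (pmf_of_set ((\<lambda>j. restrict (snd j) Y) ` uploads D X))"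
    unfolding restrict_uploads[OF assms] uniform_message_def
    using finite_uploads \<open>uploads D X \<noteq> {}\<close> code.finite_messages code.messages_nonempty
    by (intro pair_pmf_of_set[symmetric]) simp_all
  finally show ?thesis .
qed

lemma map_fst_uploads:
  assumes D: "D \<subseteq> {1..N}" "card D + X + K \<le> R"
  shows "map_pmf fst (pmf_of_set (uploads D X)) = uniform_message code_scheme"
proof -
  have "map_pmf fst (map_pmf (\<lambda>(w, q). (w, restrict q {})) (pmf_of_set (uploads D X))) = uniform_message code_scheme"
    by (subst map_restrict_uploads[OF D]) (simp_all add: map_fst_pair_pmf)
  then show ?thesis
    by (simp add: pmf.map_comp o_def case_prod_unfold)
qed

text \<open>The increment of a uniform upload is itself uniform, so drawing a message and then
  conditioning on it restores the uniform law.\<close>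

lemma upload_joint:
  assumes D: "D \<subseteq> {1..N}" "card D + X + K \<le> R"
  shows "bind_pmf (uniform_message code_scheme) (\<lambda>d. map_pmf (Pair d) (upload code_scheme D X d)) = pmf_of_set (uploads D X)"
proof -
  let ?p = "pmf_of_set (uploads D X)"
  have "bind_pmf (map_pmf fst ?p) (\<lambda>d. map_pmf (Pair d) (upload code_scheme D X d)) =
      bind_pmf (map_pmf fst ?p) (\<lambda>d. cond_pmf ?p {j. fst j = d})"
  proof (intro bind_pmf_cong refl)
    fix d assume "d \<in> set_pmf (map_pmf fst ?p)"
    then have "set_pmf ?p \<inter> {j. fst j = d} \<noteq> {}"
      by auto
    then have "set_pmf (cond_pmf ?p {j. fst j = d}) = set_pmf ?p \<inter> {j. fst j = d}"
      by (rule set_cond_pmf)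
    then show "map_pmf (Pair d) (upload code_scheme D X d) = cond_pmf ?p {j. fst j = d}"
      by (auto simp: code_scheme_def pmf.map_comp o_def intro!: map_pmf_idI)
  qed
  also have "\<dots> = ?p"
    by (rule bind_cond_pmf_fibres)
  finally show ?thesis
    unfolding map_fst_uploads[OF D] .
qed

section \<open>Dynamics of the scheme\<close>

definition outcome where
  "outcome D X z j = \<lparr>u_msg = fst z, u_sto = snd z, u_inc = fst j, u_upl = snd j,
     u_msg' = msg_add code_scheme (fst z) (fst j),
     u_sto' = (\<lambda>n. if n \<in> {1..N} - D then store_fn D X n (snd z n) (snd j n) else snd z n)\<rparr>"

lemma update_law_code:
  assumes D: "D \<subseteq> {1..N}" "card D + X + K \<le> R"
  shows "update_law N code_scheme \<sigma> D X = bind_pmf \<sigma> (\<lambda>z. map_pmf (outcome D X z) (pmf_of_set (uploads D X)))"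
proof -
  have [simp]: "store code_scheme D X n s q = return_pmf (store_fn D X n s q)" for n s q
    by (simp add: code_scheme_def)
  have "update_law N code_scheme \<sigma> D X =
      bind_pmf \<sigma> (\<lambda>z. bind_pmf (uniform_message code_scheme) (\<lambda>d. map_pmf (\<lambda>q. outcome D X z (d, q)) (upload code_scheme D X d)))"
    unfolding update_law_def outcome_def map_pmf_def
    by (simp add: bind_return_pmf case_prod_unfold cong: if_cong)
  also have "\<dots> = bind_pmf \<sigma> (\<lambda>z. map_pmf (outcome D X z) (pmf_of_set (uploads D X)))"
    unfolding upload_joint[OF D, symmetric] by (simp add: map_bind_pmf pmf.map_comp o_def)
  finally show ?thesis .
qed

lemma set_update_law_code:
  assumes D: "D \<subseteq> {1..N}" "card D + X + K \<le> R"
  shows "set_pmf (update_law N code_scheme (pmf_of_set states) D X) =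
    (\<lambda>(z, j). outcome D X z j) ` (states \<times> uploads D X)"
proof -
  have "uploads D X \<noteq> {}"
    using D dims by (intro uploads_nonempty) simp
  then show ?thesis
    unfolding update_law_code[OF D] by (auto simp: set_init finite_uploads)
qed

lemma outcome_state:
  assumes D: "D \<subseteq> {1..N}"
  shows "(u_msg' (outcome D X (codeword u) (increment D X v)), u_sto' (outcome D X (codeword u) (increment D X v))) =
    codeword (fadd u (delta D (R - X - card D) v))"
proof (rule prod_eqI)
  show "fst (u_msg' (outcome D X (codeword u) (increment D X v)), u_sto' (outcome D X (codeword u) (increment D X v))) =
      fst (codeword (fadd u (delta D (R - X - card D) v)))"
    unfolding fst_codeword_fadd[OF refl] by (simp add: outcome_def msg_add_code)
  have "u_sto' (outcome D X (codeword u) (increment D X v)) n = snd (codeword (fadd u (delta D (R - X - card D) v))) n" for n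
  proof -
    consider "n \<in> {1..N} - D" | "n \<in> D" | "n \<notin> {1..N}"
      by blast
    then show ?thesis
    proof cases
      case 1
      then show ?thesis
        unfolding store_fn_correct[OF refl 1, symmetric] by (simp add: outcome_def)
    next
      case 2
      then have "n \<in> {1..N}" "finite D"
        using D by (auto intro: finite_subset)
      then show ?thesis
        unfolding codeword_dropout[OF 2 \<open>finite D\<close> \<open>n \<in> {1..N}\<close>] using 2 by (simp add: outcome_def)
    next
      case 3
      then show ?thesis
        by (auto simp: outcome_def codeword_def)
    qed
  qed
  then show "snd (u_msg' (outcome D X (codeword u) (increment D X v)), u_sto' (outcome D X (codeword u) (increment D X v))) =
      snd (codeword (fadd u (delta D (R - X - card D) v)))"
    by auto
qed

text \<open>An update translates the uniform law on the linear space of states by one of its vectors.\<close>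

lemma update_invariant:
  assumes D: "D \<subseteq> {1..N}" "card D + X + K \<le> R"
  shows "code.after_update N (pmf_of_set states) D X = pmf_of_set states"
proof -
  have finD: "finite D"
    using D by (auto intro: finite_subset)
  have "uploads D X \<noteq> {}"
    using D dims by (intro uploads_nonempty) simp
  then have set_up: "set_pmf (pmf_of_set (uploads D X)) = uploads D X"
    by (simp add: finite_uploads)
  let ?\<tau> = "\<lambda>j z. (u_msg' (outcome D X z j), u_sto' (outcome D X z j))"
  have "code.after_update N (pmf_of_set states) D X =
      bind_pmf (pmf_of_set states) (\<lambda>z. bind_pmf (pmf_of_set (uploads D X)) (\<lambda>j. return_pmf (?\<tau> j z)))"
    unfolding update_law_code[OF D] by (simp add: map_pmf_def bind_assoc_pmf bind_return_pmf)
  also have "\<dots> = bind_pmf (pmf_of_set (uploads D X)) (\<lambda>j. map_pmf (?\<tau> j) (pmf_of_set states))"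
    unfolding map_pmf_def by (rule bind_commute_pmf)
  also have "\<dots> = bind_pmf (pmf_of_set (uploads D X)) (\<lambda>j. pmf_of_set states)"
  proof (intro bind_pmf_cong refl)
    fix j assume "j \<in> set_pmf (pmf_of_set (uploads D X))"
    then obtain v where v: "v \<in> families (R - card D)" "j = increment D X v"
      unfolding set_up by (auto simp: uploads_def)
    have "delta D (R - X - card D) v \<in> families R"
      using D(2) by (intro delta_families finD v) simp
    then show "map_pmf (?\<tau> j) (pmf_of_set states) = pmf_of_set states"
      unfolding states_def using dims finite_states v(2) outcome_state[OF D(1)]
      by (intro map_translate_pmf_of_set[of R codeword "delta D (R - X - card D) v"] translatable_codeword)
         (simp_all add: states_def)
  qed
  also have "\<dots> = pmf_of_set states"
    by simp
  finally show ?thesis .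
qed

lemma admits_code:
  "admits code_scheme (Read D) \<longleftrightarrow> D \<subseteq> {1..N} \<and> card D + R \<le> N"
  "admits code_scheme (Update D X) \<longleftrightarrow> D \<subseteq> {1..N} \<and> card D + X + K \<le> R"
  by (simp_all add: code_scheme_def)

lemma state_law_code:
  assumes "admissible N code_scheme ops"
  shows "state_law N code_scheme ops t = pmf_of_set states"
proof (induction t)
  case 0
  show ?case by (simp add: code_scheme_def)
next
  case (Suc t)
  show ?case
  proof (cases "t = 0")
    case True
    then show ?thesis by (simp add: code_scheme_def)
  next
    case False
    then have "admits code_scheme (ops t)"
      using assms by (simp add: admissible_def)
    then show ?thesis
      using False by (cases "ops t") (simp_all add: Suc.IH update_invariant admits_code)
  qed
qed

section \<open>The requirements on states, reads and updates\<close>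

lemma state_ok_code:
  assumes "0 < Kc" "Kc \<le> real K"
  shows "state_ok N R Kc code_scheme (pmf_of_set states)"
  unfolding state_ok_def
proof (intro conjI allI ballI impI)
  show fin: "finite (set_pmf (pmf_of_set states))"
    by (simp add: set_init finite_states)
  show "map_pmf fst (pmf_of_set states) = uniform_message code_scheme"
    by (rule map_fst_states)
  fix T assume T: "T \<subseteq> {1..N}" "card T = R"
  show "cond_ent (qary code_scheme) (pmf_of_set states) (\<lambda>(w, s). w) (\<lambda>(w, s). restrict s T) = 0"
    unfolding cond_ent_eq_0_iff[OF fin code.qary_gt_1] set_init
  proof (intro ballI impI)
    fix z z' assume "z \<in> states" "z' \<in> states" and eq: "(case z of (w, s) \<Rightarrow> restrict s T) = (case z' of (w, s) \<Rightarrow> restrict s T)"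
    then obtain u u' where u: "u \<in> families R" "u' \<in> families R" "z = codeword u" "z' = codeword u'"
      by (auto simp: states_def)
    have "snd (codeword u) n = snd (codeword u') n" if "n \<in> T" for n
      using fun_cong[OF eq, of n] that u(3,4) by (simp add: case_prod_unfold)
    then show "(case z of (w, s) \<Rightarrow> w) = (case z' of (w, s) \<Rightarrow> w)"
      using codeword_recover[OF u(1,2) T] u(3,4) by (simp add: case_prod_unfold)
  qed
next
  have fin: "finite (set_pmf (pmf_of_set states))"
    by (simp add: set_init finite_states)
  fix n assume n: "n \<in> {1..N}"
  have "ent (qary code_scheme) (pmf_of_set states) (\<lambda>(w, s). s n) \<le> length rows"
  proof (rule ent_words_le[OF fin])
    fix z assume "z \<in> set_pmf (pmf_of_set states)"
    then obtain u where "z = codeword u"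
      unfolding set_init by (auto simp: states_def)
    then show "(case z of (w, s) \<Rightarrow> s n) \<in> words (length rows)"
      using snd_codeword_words[OF n] by (simp add: case_prod_unfold)
  qed
  also have "\<dots> = real (len code_scheme) / K"
    using dims(1) by (simp add: len_code length_idx)
  also have "\<dots> \<le> real (len code_scheme) / Kc"
    using assms by (intro divide_left_mono) auto
  finally show "ent (qary code_scheme) (pmf_of_set states) (\<lambda>(w, s). s n) \<le> real (len code_scheme) / Kc" .
qed

definition read_outcome where
  "read_outcome D z = \<lparr>r_msg = fst z, r_sto = snd z,
     r_ans = (\<lambda>n. if n \<in> {1..N} - D then answer_fn D n (snd z n) else undefined)\<rparr>"

lemma read_law_code: "read_law N code_scheme \<sigma> D = map_pmf (read_outcome D) \<sigma>"
proof -
  have [simp]: "answer code_scheme D n s = return_pmf (answer_fn D n s)" for n s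
    by (simp add: code_scheme_def)
  show ?thesis
    unfolding read_law_def read_outcome_def map_pmf_def
    by (simp add: bind_return_pmf case_prod_unfold)
qed

lemma read_ok_code:
  assumes "admits code_scheme (Read D)"
  shows "read_ok N code_scheme D (read_law N code_scheme (pmf_of_set states) D)"
  unfolding read_ok_def read_law_code
proof (intro conjI ballI)
  let ?p = "map_pmf (read_outcome D) (pmf_of_set states)"
  have D: "D \<subseteq> {1..N}" "card D + R \<le> N"
    using assms by (simp_all add: admits_code)
  have set_p: "set_pmf ?p = read_outcome D ` states"
    by (simp add: set_init)
  show fin: "finite (set_pmf ?p)"
    by (simp add: set_init finite_states)
  show "cond_ent (qary code_scheme) ?p (\<lambda>\<omega>. r_ans \<omega> n) (\<lambda>\<omega>. r_sto \<omega> n) = 0" if "n \<in> {1..N} - D" for n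
    using that unfolding cond_ent_eq_0_iff[OF fin code.qary_gt_1] set_p by (simp add: read_outcome_def)
  show "cond_ent (qary code_scheme) ?p r_msg (\<lambda>\<omega>. restrict (r_ans \<omega>) ({1..N} - D)) = 0"
    unfolding cond_ent_eq_0_iff[OF fin code.qary_gt_1] set_p
  proof (intro ballI impI)
    fix \<omega> \<omega>' assume "\<omega> \<in> read_outcome D ` states" "\<omega>' \<in> read_outcome D ` states"
      and eq: "restrict (r_ans \<omega>) ({1..N} - D) = restrict (r_ans \<omega>') ({1..N} - D)"
    then obtain u u' where u: "u \<in> families R" "u' \<in> families R"
        "\<omega> = read_outcome D (codeword u)" "\<omega>' = read_outcome D (codeword u')"
      by (auto simp: states_def)
    have "answer_fn D n (snd (codeword u) n) = answer_fn D n (snd (codeword u') n)" if "n \<in> {1..N} - D" for n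
      using fun_cong[OF eq, of n] that u(3,4) by (simp add: read_outcome_def)
    then show "r_msg \<omega> = r_msg \<omega>'"
      using answers_decode[OF D u(1,2)] u(3,4) by (simp add: read_outcome_def)
  qed
qed

lemma update_ok_code:
  assumes "admits code_scheme (Update D X)"
  shows "update_ok N code_scheme D X (update_law N code_scheme (pmf_of_set states) D X)"
  unfolding update_ok_def
proof (intro conjI ballI allI impI)
  let ?p = "update_law N code_scheme (pmf_of_set states) D X"
  let ?U = "pmf_of_set (uploads D X)"
  have D: "D \<subseteq> {1..N}" "card D + X + K \<le> R"
    using assms by (simp_all add: admits_code)
  note set_p = set_update_law_code[OF D]
  show fin: "finite (set_pmf ?p)"
    unfolding set_p by (simp add: finite_states finite_uploads)
  fix Y assume Y: "Y \<subseteq> {1..N} - D" "card Y \<le> X"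
  have "map_pmf (\<lambda>\<omega>. (u_inc \<omega>, restrict (u_upl \<omega>) Y)) ?p =
      bind_pmf (pmf_of_set states) (\<lambda>z. map_pmf (\<lambda>(w, q). (w, restrict q Y)) ?U)"
    unfolding update_law_code[OF D] by (simp add: map_bind_pmf pmf.map_comp o_def outcome_def case_prod_unfold)
  then have "map_pmf (\<lambda>\<omega>. (u_inc \<omega>, restrict (u_upl \<omega>) Y)) ?p =
      pair_pmf (uniform_message code_scheme) (pmf_of_set ((\<lambda>j. restrict (snd j) Y) ` uploads D X))"
    by (simp add: map_restrict_uploads[OF D Y])
  then show "mut_inf (qary code_scheme) ?p u_inc (\<lambda>\<omega>. restrict (u_upl \<omega>) Y) = 0"
    unfolding mut_inf_eq_0_iff[OF fin code.qary_gt_1] by (rule pair_pmf_eq_marginals)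
next
  let ?p = "update_law N code_scheme (pmf_of_set states) D X"
  let ?U = "pmf_of_set (uploads D X)"
  have D: "D \<subseteq> {1..N}" "card D + X + K \<le> R"
    using assms by (simp_all add: admits_code)
  note set_p = set_update_law_code[OF D]
  have fin: "finite (set_pmf ?p)"
    unfolding set_p by (simp add: finite_states finite_uploads)
  show "cond_ent (qary code_scheme) ?p (\<lambda>\<omega>. u_sto' \<omega> n) (\<lambda>\<omega>. (u_sto \<omega> n, u_upl \<omega> n)) = 0" for n
    unfolding cond_ent_eq_0_iff[OF fin code.qary_gt_1] set_p by (auto simp: outcome_def)
  have "map_pmf (\<lambda>\<omega>. ((u_inc \<omega>, restrict (u_upl \<omega>) ({1..N} - D)), restrict (u_sto \<omega>) {1..N})) ?p =
      pair_pmf (map_pmf (\<lambda>(w, q). (w, restrict q ({1..N} - D))) ?U) (map_pmf (\<lambda>z. restrict (snd z) {1..N}) (pmf_of_set states))"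
    unfolding update_law_code[OF D] pair_pmf_def
    by (subst bind_commute_pmf)
       (simp add: map_pmf_def bind_assoc_pmf bind_return_pmf outcome_def case_prod_unfold)
  then show "mut_inf (qary code_scheme) ?p (\<lambda>\<omega>. (u_inc \<omega>, restrict (u_upl \<omega>) ({1..N} - D)))
      (\<lambda>\<omega>. restrict (u_sto \<omega>) {1..N}) = 0"
    unfolding mut_inf_eq_0_iff[OF fin code.qary_gt_1] by (rule pair_pmf_eq_marginals)
qed

lemma rdcds_code:
  assumes "0 < Kc" "Kc \<le> real K"
  shows "rdcds N R Kc code_scheme"
  unfolding rdcds_def
proof (intro conjI allI impI)
  show "field (base code_scheme)" "finite (carrier (base code_scheme))"
    by (fact code.field_base code.finite_base)+
  show "len code_scheme \<ge> 1"
    using rows_nonempty dims(1) by (simp add: len_code length_idx Suc_le_eq)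
  show "admits code_scheme (Read D)" if "D \<subseteq> {1..N}" "R \<le> N - card D" for D
    using that dims by (simp add: admits_code)
  fix ops assume adm: "admissible N code_scheme ops"
  show "state_ok N R Kc code_scheme (state_law N code_scheme ops t)" for t
    unfolding state_law_code[OF adm] by (rule state_ok_code[OF assms])
  show "slot_ok N code_scheme (state_law N code_scheme ops t) (ops t)" if "t \<ge> 1" for t
  proof -
    have "admits code_scheme (ops t)"
      using adm that by (simp add: admissible_def)
    then show ?thesis
      unfolding state_law_code[OF adm]
      by (cases "ops t") (simp_all add: slot_ok_def read_ok_code update_ok_code)
  qed
qed

section \<open>Costs and optimality\<close>

lemma per_server_cost:
  assumes "K \<le> e" "e \<le> N"
  shows "real (length (channels e)) / len code_scheme = 1 / e"
proof -
  have "real (length (channels e)) * e = len code_scheme"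
    using length_channels[OF assms] by (simp add: len_code flip: of_nat_mult)
  moreover have "0 < len code_scheme"
    using rows_nonempty dims(1) by (simp add: len_code length_idx)
  ultimately show ?thesis
    using assms dims(1) by (simp add: field_simps)
qed

lemma card_available: "D \<subseteq> {1..N} \<Longrightarrow> real (card ({1..N} - D)) = real N - card D"
  using card_mono[of "{1..N}" D] by (simp add: card_Diff_subset finite_subset of_nat_diff)

lemma download_cost_le:
  assumes adm: "admissible N code_scheme ops" and t: "t \<ge> 1" "ops t = Read D"
  shows "download_cost N code_scheme ops t D \<le> (real N - card D) / (real N - real R + K - card D)"
proof -
  define e where "e = N + K - R - card D"
  have "admits code_scheme (Read D)"
    using adm t by (metis admissible_def)
  then have D: "D \<subseteq> {1..N}" "card D + R \<le> N"
    by (simp_all add: admits_code)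
  then have e: "K \<le> e" "e \<le> N" "real e = real N - real R + K - card D"
    using dims by (simp_all add: e_def of_nat_diff)
  let ?p = "map_pmf (read_outcome D) (pmf_of_set states)"
  have "ent (qary code_scheme) ?p (\<lambda>\<omega>. r_ans \<omega> n) \<le> length (channels e)" if n: "n \<in> {1..N} - D" for n
  proof (rule ent_words_le)
    show "finite (set_pmf ?p)"
      by (simp add: set_init finite_states)
    fix \<omega> assume "\<omega> \<in> set_pmf ?p"
    then obtain u where "\<omega> = read_outcome D (codeword u)"
      unfolding set_map_pmf set_init by (auto simp: states_def)
    moreover have "n \<in> {1..N}"
      using n by blast
    ultimately show "r_ans \<omega> n \<in> words (length (channels e))"
      using n map_ev_words[of "mix e u" "\<lambda>_. n" "channels e"]
      by (simp only: read_outcome_def read_outcome.simps if_True answer_fn_codeword[OF _ e_def])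
  qed
  then have "(\<Sum>n\<in>{1..N} - D. ent (qary code_scheme) ?p (\<lambda>\<omega>. r_ans \<omega> n)) \<le> (\<Sum>n\<in>{1..N} - D. real (length (channels e)))"
    by (rule sum_mono)
  then have "download_cost N code_scheme ops t D \<le> (real N - card D) * (real (length (channels e)) / len code_scheme)"
    unfolding download_cost_def state_law_code[OF adm] read_law_code
    using D(1) by (simp add: card_available[simplified] divide_right_mono)
  then show ?thesis
    by (simp add: per_server_cost[OF e(1,2)] e(3))
qed

lemma upload_cost_le:
  assumes adm: "admissible N code_scheme ops" and t: "t \<ge> 1" "ops t = Update D X"
  shows "upload_cost N code_scheme ops t D X \<le> (real N - card D) / (real R - real X - card D)"
proof -
  define e where "e = R - X - card D"
  have "admits code_scheme (Update D X)"
    using adm t by (metis admissible_def)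
  then have D: "D \<subseteq> {1..N}" "card D + X + K \<le> R"
    by (simp_all add: admits_code)
  then have e: "K \<le> e" "e \<le> N" "real e = real R - real X - card D"
    using dims by (simp_all add: e_def of_nat_diff)
  let ?p = "update_law N code_scheme (pmf_of_set states) D X"
  have "ent (qary code_scheme) ?p (\<lambda>\<omega>. u_upl \<omega> n) \<le> length (channels e)" if n: "n \<in> {1..N} - D" for n
  proof (rule ent_words_le)
    show "finite (set_pmf ?p)"
      unfolding set_update_law_code[OF D] by (simp add: finite_states finite_uploads)
    fix \<omega> assume "\<omega> \<in> set_pmf ?p"
    then obtain z v where "\<omega> = outcome D X z (increment D X v)"
      unfolding set_update_law_code[OF D] by (auto simp: uploads_def)
    then show "u_upl \<omega> n \<in> words (length (channels e))"
      using snd_increment_words[OF n] by (simp add: outcome_def e_def)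
  qed
  then have "(\<Sum>n\<in>{1..N} - D. ent (qary code_scheme) ?p (\<lambda>\<omega>. u_upl \<omega> n)) \<le> (\<Sum>n\<in>{1..N} - D. real (length (channels e)))"
    by (rule sum_mono)
  then have "upload_cost N code_scheme ops t D X \<le> (real N - card D) * (real (length (channels e)) / len code_scheme)"
    unfolding upload_cost_def state_law_code[OF adm]
    using D(1) by (simp add: card_available[simplified] divide_right_mono)
  then show ?thesis
    by (simp add: per_server_cost[OF e(1,2)] e(3))
qed

text \<open>
  The matching lower bounds come from the converse. For downloads it is applied to another sequence
  of operations, which is legitimate since the law of the state never changes.
\<close>

theorem code_optimal:
  fixes Kc :: real
  assumes ceil: "0 < Kc" "\<lceil>Kc\<rceil> = int K" and adm: "admissible N code_scheme ops" and t: "t \<ge> 1"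
  shows "ops t = Read D \<Longrightarrow> download_cost N code_scheme ops t D
      = (real N - card D) / (real N - real R + K - card D)"
    and "ops t = Update D X \<Longrightarrow> update_threshold N code_scheme X = N - R + K + X"
    and "ops t = Update D X \<Longrightarrow> upload_cost N code_scheme ops t D X
      = (real N - card D) / (real R - real X - card D)"
proof -
  have KcK: "Kc \<le> real K" "Kc \<le> real R"
    using ceil(2) dims(2) by linarith+
  have run: "rdcds_run code_scheme N R Kc ops" if "admissible N code_scheme ops" for ops
    using that ceil(1) KcK(2) dims(3)
    by (intro rdcds_run.intro code.finite_field_scheme_axioms rdcds_run_axioms.intro rdcds_code ceil(1) KcK(1)) auto
  interpret rdcds_run code_scheme N R Kc ops
    by (rule run[OF adm])
  have K_eq: "rdcds_run.K Kc = K"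
    unfolding K_def using ceil(2) by simp
  show "upload_cost N code_scheme ops t D X = (real N - card D) / (real R - real X - card D)"
    if "ops t = Update D X"
    using upload_cost_le[OF adm t that] upload_cost_ge[OF t that] by linarith
  show "update_threshold N code_scheme X = N - R + K + X" if up: "ops t = Update D X"
  proof (rule antisym)
    show "N - R + K + X \<le> update_threshold N code_scheme X"
      using update_threshold_ge[OF t up] by (simp only: K_eq)
    have "card D + X + K \<le> R"
      using update_available[OF t up] by (simp only: K_eq)
    have "R - K - X \<le> card {1..N}"
      using dims by simp
    \<comment> \<open>The largest dropout set that is supported at security level
      \<open>X\<close>.\<close>
    then obtain D' where D': "D' \<subseteq> {1..N}" "card D' = R - K - X"
      by (rule obtain_subset_with_card_n)
    then have "admits code_scheme (Update D' X)" "N - R + K + X = N - card D'"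
      using \<open>card D + X + K \<le> R\<close> dims by (simp_all add: admits_code)
    then show "update_threshold N code_scheme X \<le> N - R + K + X"
      unfolding update_threshold_def using D'(1) by (intro Least_le) blast
  qed
  show "download_cost N code_scheme ops t D = (real N - card D) / (real N - real R + K - card D)"
    if read: "ops t = Read D"
  proof (rule antisym[OF download_cost_le[OF adm t read]])
    have "code.hides T (state_law N code_scheme ops t)" if T: "T \<subseteq> {1..N}" "card T = R - K" for T
    proof -
      \<comment> \<open>Without dropouts, security level \<open>R - K\<close> hides the message from
        all sets of \<open>R - K\<close> servers after a single slot.\<close>
      let ?ops = "\<lambda>_::nat. Update {} (R - K)"
      have adm': "admissible N code_scheme ?ops"
        using le_trans[OF diff_le_self dims(3)] dims by (simp add: admissible_def admits_code)
      interpret alt: rdcds_run code_scheme N R Kc ?ops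
        by (rule run[OF adm'])
      have "code.hides T (state_law N code_scheme ?ops 2)"
        using T by (intro alt.hides_after_slot[of 1 "{}" "R - K"]) simp_all
      then show ?thesis
        by (simp only: state_law_code[OF adm] state_law_code[OF adm'])
    qed
    then show "download_cost N code_scheme ops t D \<ge> (real N - card D) / (real N - real R + K - card D)"
      using download_cost_ge[OF t read] by (simp only: K_eq)
  qed
qed

end

section \<open>Arrangement of the rows\<close>

text \<open>
  The rows are the ways to delete \<open>N - K\<close> of \<open>N\<close> points one after the other; the remaining points
  are the secret points of the row. Rows that agree on the first \<open>N - e\<close> deletions share a pool of
  \<open>e\<close> points, which works for all \<open>e\<close> simultaneously.
\<close>

lemma ex_mds_code:
  assumes dims: "0 < K" "K \<le> R" "R \<le> N"
  obtains p and rows :: "nat list list" and pts and key :: "nat \<Rightarrow> nat list \<Rightarrow> nat list" and pool reps x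
    where "mds_code N R K p rows pts key pool reps x"
proof -
  \<comment> \<open>The first \<open>N\<close> integers above the evaluation points of the
    servers.\<close>
  define \<Phi> where "\<Phi> = {N<..2 * N}"
  define Rows where "Rows = {\<rho>. length \<rho> = N - K \<and> distinct \<rho> \<and> set \<rho> \<subseteq> \<Phi>}"
  define pts where "pts \<rho> = \<Phi> - set \<rho>" for \<rho>
  define key where "key e \<rho> = take (N - e) \<rho>" for e and \<rho> :: "nat list"
  define pool where "pool e \<kappa> = \<Phi> - set \<kappa>" for e :: nat and \<kappa>
  \<comment> \<open>The number \<open>K * ... * (e - 1)\<close> of lists of \<open>e - K\<close>
    distinct elements from \<open>e - 1\<close> points, written in the form in which the count is
    used below.\<close>
  define reps where "reps e = \<Prod>{e - 1 - (e - K) + 1..e - 1}" for e :: nat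
  have \<Phi>: "finite \<Phi>" "card \<Phi> = N"
    by (simp_all add: \<Phi>_def)
  have "Rows \<subseteq> {\<rho>. set \<rho> \<subseteq> \<Phi> \<and> length \<rho> = N - K}"
    by (auto simp: Rows_def)
  then have "finite Rows"
    using finite_lists_length_eq[OF \<Phi>(1)] by (rule finite_subset)
  then obtain rows where rows: "set rows = Rows" "distinct rows"
    using finite_distinct_list by blast
  obtain h where h: "bij_betw h Rows {0..<card Rows}"
    using ex_bij_betw_finite_nat[OF \<open>finite Rows\<close>] by blast
  \<comment> \<open>The points of \<open>\<Phi>\<close> reach \<open>2 * N\<close>, and the rows
    need distinct residues as nodes.\<close>
  obtain p where p: "prime p" "2 * N + card Rows < p"
    using bigger_prime by blast
  have card_Diff: "card (\<Phi> - set \<sigma>) = N - length \<sigma>" if "distinct \<sigma>" "set \<sigma> \<subseteq> \<Phi>" for \<sigma>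
    using that \<Phi> by (simp add: card_Diff_subset distinct_card)
  have Rows_take: "length (take (N - e) \<rho>) = N - e" "distinct (take (N - e) \<rho>)" "set (take (N - e) \<rho>) \<subseteq> \<Phi>"
    if "\<rho> \<in> Rows" "K \<le> e" for e \<rho>
    using that set_take_subset[of "N - e" \<rho>] by (auto simp: Rows_def)
  have "mds_code N R K p rows pts key pool reps (int \<circ> h)"
  proof
    show "0 < K" "K \<le> R" "R \<le> N" "prime p" "distinct rows"
      by fact+
    \<comment> \<open>The row that deletes the first \<open>N - K\<close> points of
      \<open>\<Phi>\<close>; it is the empty list if \<open>K = N\<close>.\<close>
    have "[Suc N..<Suc (2 * N - K)] \<in> Rows"
      using dims by (auto simp: Rows_def \<Phi>_def)
    then show "rows \<noteq> []"
      using rows(1) by auto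
    show "card (pts \<rho>) = K" if "\<rho> \<in> set rows" for \<rho>
      using that card_Diff[of \<rho>] dims by (simp add: pts_def rows Rows_def)
    show "inj_on (int \<circ> h) (set rows)"
      using h by (auto simp: rows bij_betw_def intro: comp_inj_on)
    have "h ` Rows \<subseteq> {0..<p}"
      using h p(2) by (simp add: bij_betw_def)
    then show "(int \<circ> h) ` set rows \<subseteq> {0..<int p}"
      by (auto simp: rows)
    fix e \<rho> assume e: "K \<le> e" "e \<le> N" and \<rho>: "\<rho> \<in> set rows"
    show "pool e (key e \<rho>) \<subseteq> {N<..<p}"
      using p(2) by (auto simp: pool_def \<Phi>_def)
    show card_pool: "card (pool e (key e \<rho>)) = e"
      using card_Diff[OF Rows_take(2,3)] Rows_take(1) e \<rho> by (simp add: pool_def key_def rows)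
    show "pts \<rho> \<subseteq> pool e (key e \<rho>)"
      using set_take_subset[of "N - e" \<rho>] by (auto simp: pts_def pool_def key_def)
    fix f assume f: "f \<in> pool e (key e \<rho>)"
    let ?A = "pool e (key e \<rho>) - {f}"
    let ?Y = "{ys. length ys = e - K \<and> distinct ys \<and> set ys \<subseteq> ?A}"
    have \<kappa>: "length (key e \<rho>) = N - e" "distinct (key e \<rho>)" "set (key e \<rho>) \<subseteq> \<Phi>"
      using Rows_take e \<rho> by (simp_all add: key_def rows)
    have A: "finite ?A" "card ?A = e - 1"
      using f card_pool \<Phi>(1) by (simp_all add: pool_def)
    \<comment> \<open>A row with the same key continues the common prefix by \<open>e - K\<close>
      deletions from the pool, and \<open>f\<close> is secret for it exactly if these avoid
      \<open>f\<close>.\<close>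
    have "{\<rho>' \<in> set rows. key e \<rho>' = key e \<rho> \<and> f \<in> pts \<rho>'} = (@) (key e \<rho>) ` ?Y"
    proof (intro equalityI subsetI)
      fix \<rho>' assume "\<rho>' \<in> {\<rho>' \<in> set rows. key e \<rho>' = key e \<rho> \<and> f \<in> pts \<rho>'}"
      then have \<rho>': "\<rho>' \<in> Rows" "take (N - e) \<rho>' = key e \<rho>" "f \<notin> set \<rho>'"
        by (auto simp: rows key_def pts_def)
      define ys where "ys = drop (N - e) \<rho>'"
      have eq: "\<rho>' = key e \<rho> @ ys"
        using \<rho>'(2) by (metis append_take_drop_id ys_def)
      have "distinct (key e \<rho> @ ys)" "set (key e \<rho> @ ys) \<subseteq> \<Phi>" "f \<notin> set (key e \<rho> @ ys)"
        "length (key e \<rho> @ ys) = N - K"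
        using \<rho>'(1,3) unfolding eq[symmetric] by (auto simp: Rows_def)
      then have "ys \<in> ?Y"
        using \<kappa>(1) e by (auto simp: pool_def)
      then show "\<rho>' \<in> (@) (key e \<rho>) ` ?Y"
        using eq by blast
    next
      fix \<rho>' assume "\<rho>' \<in> (@) (key e \<rho>) ` ?Y"
      then obtain ys where "ys \<in> ?Y" "\<rho>' = key e \<rho> @ ys"
        by blast
      then have "\<rho>' \<in> Rows" "take (N - e) \<rho>' = key e \<rho>" "f \<in> pts \<rho>'"
        using \<kappa> e f by (auto simp: Rows_def pts_def pool_def)
      then show "\<rho>' \<in> {\<rho>' \<in> set rows. key e \<rho>' = key e \<rho> \<and> f \<in> pts \<rho>'}"
        by (simp add: rows key_def)
    qed
    then have "card {\<rho>' \<in> set rows. key e \<rho>' = key e \<rho> \<and> f \<in> pts \<rho>'} = card ?Y"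
      by (simp add: card_image inj_on_def)
    also have "\<dots> = reps e"
      using card_lists_distinct_length_eq[OF A(1), of "e - K"] A(2) e dims(1) by (simp add: reps_def)
    finally show "card {\<rho>' \<in> set rows. key e \<rho>' = key e \<rho> \<and> f \<in> pts \<rho>'} = reps e" .
  qed
  then show ?thesis
    by (rule that)
qed

theorem theorem1:
  fixes N Rr :: nat and Kc :: real
  assumes "0 < N" and "0 < Rr" and "0 < Kc" and "Kc \<le> real Rr" and "Rr \<le> N"
  shows
    "(\<forall>(P :: ('f, 's, 'q, 'a) scheme) ops t0 t.
        rdcds N Rr Kc P \<longrightarrow> admissible N P ops \<longrightarrow> steady_state N Rr Kc ops t0 \<longrightarrow> t0 < t \<longrightarrow>
          (\<forall>D. ops t = Read D \<longrightarrow>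
             download_cost N P ops t D
               \<ge> (real N - card D) / (real N - real Rr + \<lceil>Kc\<rceil> - card D)) \<and>
          (\<forall>D X. ops t = Update D X \<longrightarrow>
             int (update_threshold N P X) \<ge> int N - int Rr + \<lceil>Kc\<rceil> + int X \<and>
             upload_cost N P ops t D X
               \<ge> (real N - card D) / (real Rr - real X - card D)))
     \<and>
     (\<exists>P :: (int, int list, int list, int list) scheme.
        rdcds N Rr Kc P \<and>
        (\<forall>X\<le>N. \<forall>D\<subseteq>{1..N}. int N - int Rr + \<lceil>Kc\<rceil> + int X \<le> int N - int (card D)
           \<longrightarrow> admits P (Update D X)) \<and>
        (\<forall>ops t. admissible N P ops \<longrightarrow> t \<ge> 1 \<longrightarrow>
          (\<forall>D. ops t = Read D \<longrightarrow>
             download_cost N P ops t D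
               = (real N - card D) / (real N - real Rr + \<lceil>Kc\<rceil> - card D)) \<and>
          (\<forall>D X. ops t = Update D X \<longrightarrow>
             int (update_threshold N P X) = int N - int Rr + \<lceil>Kc\<rceil> + int X \<and>
             upload_cost N P ops t D X
               = (real N - card D) / (real Rr - real X - card D))))"
proof (intro conjI allI impI)
  fix P :: "('f, 's, 'q, 'a) scheme" and ops t0 t
  assume run: "rdcds N Rr Kc P" "admissible N P ops" "steady_state N Rr Kc ops t0" "t0 < t"
  note conv = converse[OF assms(3-5) run]
  show "download_cost N P ops t D \<ge> (real N - card D) / (real N - real Rr + \<lceil>Kc\<rceil> - card D)"
    if "ops t = Read D" for D
    by (rule conv(1)[OF that])
  show "int (update_threshold N P X) \<ge> int N - int Rr + \<lceil>Kc\<rceil> + int X" if "ops t = Update D X" for D X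
    by (rule conv(2)[OF that])
  show "upload_cost N P ops t D X \<ge> (real N - card D) / (real Rr - real X - card D)"
    if "ops t = Update D X" for D X
    by (rule conv(3)[OF that])
next
  \<comment> \<open>The bounds depend on \<open>Kc\<close> only through its ceiling, and storage of
    size \<open>L / K\<close> is within \<open>L / Kc\<close>, so the code for the integer
    \<open>K\<close> serves.\<close>
  define K where "K = nat \<lceil>Kc\<rceil>"
  have K: "\<lceil>Kc\<rceil> = int K" "0 < K" "K \<le> Rr" "Kc \<le> real K"
    using assms(3,4) unfolding K_def by linarith+
  obtain p and rows :: "nat list list" and pts and key :: "nat \<Rightarrow> nat list \<Rightarrow> nat list" and pool reps x
    where "mds_code N Rr K p rows pts key pool reps x"
    by (rule ex_mds_code[OF K(2,3) assms(5)])
  then interpret mds_code N Rr K p rows pts key pool reps x .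
  note opt = code_optimal[OF assms(3) K(1)]
  show "\<exists>P :: (int, int list, int list, int list) scheme.
        rdcds N Rr Kc P \<and>
        (\<forall>X\<le>N. \<forall>D\<subseteq>{1..N}. int N - int Rr + \<lceil>Kc\<rceil> + int X \<le> int N - int (card D)
           \<longrightarrow> admits P (Update D X)) \<and>
        (\<forall>ops t. admissible N P ops \<longrightarrow> t \<ge> 1 \<longrightarrow>
          (\<forall>D. ops t = Read D \<longrightarrow>
             download_cost N P ops t D
               = (real N - card D) / (real N - real Rr + \<lceil>Kc\<rceil> - card D)) \<and>
          (\<forall>D X. ops t = Update D X \<longrightarrow>
             int (update_threshold N P X) = int N - int Rr + \<lceil>Kc\<rceil> + int X \<and>
             upload_cost N P ops t D X
               = (real N - card D) / (real Rr - real X - card D)))"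
  proof (intro exI[of _ code_scheme] conjI allI impI)
    show "rdcds N Rr Kc code_scheme"
      by (rule rdcds_code[OF assms(3) K(4)])
    show "admits code_scheme (Update D X)"
      if "D \<subseteq> {1..N}" "int N - int Rr + \<lceil>Kc\<rceil> + int X \<le> int N - int (card D)" for D X
      using that by (simp add: admits_code K(1))
    fix ops :: "nat \<Rightarrow> oper" and t :: nat
    assume adm: "admissible N code_scheme ops" "t \<ge> 1"
    show "download_cost N code_scheme ops t D = (real N - card D) / (real N - real Rr + \<lceil>Kc\<rceil> - card D)"
      if "ops t = Read D" for D
      using opt(1)[OF adm that] by (simp add: K(1))
    show "int (update_threshold N code_scheme X) = int N - int Rr + \<lceil>Kc\<rceil> + int X"
      if "ops t = Update D X" for D X
      using opt(2)[OF adm that] assms(5) by (simp add: K(1))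
    show "upload_cost N code_scheme ops t D X = (real N - card D) / (real Rr - real X - card D)"
      if "ops t = Update D X" for D X
      by (rule opt(3)[OF adm that])
  qed
qed

end
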